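(* Let $A\in\mathbb{R}^{m\times n}$ and $b\in\mathbb{R}^m$, and let $P=\{x\in\mathbb{R}^n:\, Ax=b,\ x\ge 0\}$. Then the diameter of $P$ is $O\big((n-m)^{3}\, m\, \kappa_A \log(\kappa_A+n)\big)$, i.e. it is bounded by an absolute constant times $(n-m)^{3}\, m\, \kappa_A \log(\kappa_A+n)$.
   Context: For a linear subspace $W\subseteq\mathbb{R}^n$, an elementary vector of $W$ is a nonzero $g\in W$ whose support $\mathrm{supp}(g)=\{i: g_i\neq 0\}$ is minimal under inclusion among nonzero vectors of $W$; let $\mathcal F(W)$ be the set of elementary vectors. The fractional circuit imbalance measure is $\kappa_W=\max\{|g_j/g_i| : g\in\mathcal F(W),\ i,j\in\mathrm{supp}(g)\}$ if $W$ is nontrivial, and $\kappa_W=1$ if $W\in\{\{0\},\mathbb{R}^n\}$. For a matrix $A$, $\kappa_A:=\kappa_{\ker(A)}$. The diameter of a polyhedron is the diameter of its vertex-edge graph (edges are bounded one-dimensional faces).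
   Formalization: The formal statement assumes in addition that A has full row rank m; without this the claim fails, e.g. for A=[[1,1],[1,1]], b=(1,1), where the bound is 0 but P is a segment of diameter 1. *)

theory Defs
  imports
    "Jordan_Normal_Form.Matrix_Kernel"
    "Jordan_Normal_Form.DL_Rank"
    "Graph_Theory.Pair_Digraph"
    "Graph_Theory.Shortest_Path"
begin

section \<open>The fractional circuit imbalance measure\<close>

definition vec_supp :: "real vec \<Rightarrow> nat set" where
  "vec_supp g = {i. i < dim_vec g \<and> g $ i \<noteq> 0}"

definition elementary_vectors :: "nat \<Rightarrow> real vec set \<Rightarrow> real vec set" where
  "elementary_vectors n W =
     {g \<in> W. g \<noteq> 0\<^sub>v n \<and> \<not> (\<exists>h \<in> W. h \<noteq> 0\<^sub>v n \<and> vec_supp h \<subset> vec_supp g)}"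

text \<open>For a nontrivial linear subspace \<open>W\<close> the maximum is taken over a finite nonempty
  set: two elementary vectors with the same support are proportional, so a quotient
  depends only on the support and the two indices.\<close>

definition circuit_imbalance :: "nat \<Rightarrow> real vec set \<Rightarrow> real" where
  "circuit_imbalance n W =
     (if W = {0\<^sub>v n} \<or> W = carrier_vec n then 1
      else Max {\<bar>g $ j / g $ i\<bar> | g i j.
                  g \<in> elementary_vectors n W \<and> i \<in> vec_supp g \<and> j \<in> vec_supp g})"

definition kappa :: "real mat \<Rightarrow> real" where
  "kappa A = circuit_imbalance (dim_col A) (mat_kernel A)"

section \<open>Polyhedra, their vertex-edge graph, and the diameter\<close>

definition std_polyhedron :: "real mat \<Rightarrow> real vec \<Rightarrow> real vec set" where
  "std_polyhedron A b =
     {x \<in> carrier_vec (dim_col A). A *\<^sub>v x = b \<and> 0\<^sub>v (dim_col A) \<le> x}"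

text \<open>Nonempty faces: the sets of maximisers over \<open>P\<close> of a linear functional attaining
  its maximum. The choice \<open>c = 0\<close> gives \<open>P\<close> itself.\<close>

definition is_face :: "nat \<Rightarrow> real vec set \<Rightarrow> real vec set \<Rightarrow> bool" where
  "is_face n P F \<longleftrightarrow>
     F \<noteq> {} \<and>
     (\<exists>c \<in> carrier_vec n. \<exists>\<delta>. (\<forall>x \<in> P. c \<bullet> x \<le> \<delta>) \<and> F = {x \<in> P. c \<bullet> x = \<delta>})"

text \<open>The dimension of the affine hull of \<open>F\<close>, i.e. of the linear space parallel to it
  (meaningful for nonempty \<open>F\<close>).\<close>

definition (in vec_space) affine_dim :: "'a vec set \<Rightarrow> nat" where
  "affine_dim F = vectorspace.dim class_ring (span_vs {x - y | x y. x \<in> F \<and> y \<in> F})"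

definition bounded_vecs :: "nat \<Rightarrow> real vec set \<Rightarrow> bool" where
  "bounded_vecs n F \<longleftrightarrow> (\<exists>M. \<forall>x \<in> F. \<forall>i < n. \<bar>x $ i\<bar> \<le> M)"

definition vertices_of :: "nat \<Rightarrow> real vec set \<Rightarrow> real vec set" where
  "vertices_of n P = {v. is_face n P {v}}"

definition is_edge :: "nat \<Rightarrow> real vec set \<Rightarrow> real vec set \<Rightarrow> bool" where
  "is_edge n P F \<longleftrightarrow> is_face n P F \<and> vec_space.affine_dim n F = 1 \<and> bounded_vecs n F"

text \<open>The undirected vertex-edge graph, as a symmetric digraph.\<close>

definition vertex_edge_graph :: "nat \<Rightarrow> real vec set \<Rightarrow> real vec pair_pre_digraph" where
  "vertex_edge_graph n P =
     \<lparr> pverts = vertices_of n P,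
       parcs = {(u, v). u \<in> vertices_of n P \<and> v \<in> vertices_of n P \<and> u \<noteq> v \<and>
                  (\<exists>F. is_edge n P F \<and> u \<in> F \<and> v \<in> F)} \<rparr>"

text \<open>So the shortest-path distance \<open>\<mu>\<close>, whose definition needs a well-formed digraph, is available.\<close>

lemma wf_vertex_edge_graph: "wf_digraph (with_proj (vertex_edge_graph n P))"
  by unfold_locales (auto simp: vertex_edge_graph_def)

text \<open>The largest graph distance between two vertices; it is \<open>\<infinity>\<close> if the graph is
  disconnected. Inserting \<open>0\<close> only matters when there are no vertices, where the
  supremum in \<^typ>\<open>ereal\<close> would otherwise be \<open>-\<infinity>\<close>.\<close>

definition poly_diameter :: "nat \<Rightarrow> real vec set \<Rightarrow> ereal" where
  "poly_diameter n P =
     Sup (insert 0 {wf_digraph.\<mu> (with_proj (vertex_edge_graph n P)) (\<lambda>_. 1) u v | u v.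
                      u \<in> vertices_of n P \<and> v \<in> vertices_of n P})"

end

theory Submission
  imports Defs "HOL-Probability.Probability"
begin

text \<open>
  Cobases \<open>N\<close> of the kernel \<open>W\<close> (coordinate sets on which \<open>W\<close> projects isomorphically) are the
  complements of simplex bases. The dual basis \<open>fund N\<close> of \<open>W\<close> consists of elementary vectors, so
  its entries are bounded by \<open>\<kappa>\<close>. After a generic perturbation of the right-hand side the bases
  form the vertices of a simple polyhedron, and every pivot becomes an edge or a stationary step
  of the original polyhedron.

  The shadow path follows the optimal bases of the cost \<open>e\<^sup>t c + e\<^sup>-\<^sup>t c' + X\<close> for
  \<open>t \<in> [-T, T]\<close>, where \<open>c\<close>, \<open>c'\<close> are the indicators of the two end cobases and the
  coordinates of \<open>X\<close> are independent standard exponentials; \<open>T \<approx> ln (\<kappa> n)\<close> makes the end bases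
  optimal at the ends with good probability. By memorylessness, the rate of entering the normal cone of
  \<open>N\<close> at time \<open>t\<close> is at most the probability of lying in it, weighted by the speeds of the reduced
  costs towards zero. A reduced cost that vanishes has a drift which is balanced by the
  exponential part, hence speed \<open>O(\<kappa> (\<Sum>|X i| + d))\<close>. The cones have disjoint interiors, so the
  expected number of cones entered is \<open>O(\<kappa> d n T)\<close> with \<open>d = n - m\<close>.
\<close>

section \<open>Bases and pivots of a linear subspace\<close>

text \<open>Counting pivots along a shadow path would normally require the curve to cross normal
  cones through facets only. This is avoided. The pivot distance from the first basis is a level
  function that rises by at most one per pivot, and the optimal bases at any fixed time are
  connected by pivots, so every level up to the distance is attained by some basis whose cone the
  curve touches. What remains is to count the cones touched; no general position of the noise
  relative to the curve is involved. The two-sided exponential keeps the travel time logarithmic.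
  Along the curve a reduced cost is \<open>g t\<close> plus noise with
  \<open>g t = \<beta> * exp t + \<alpha> * exp (- t)\<close>, and over a short step
  \<open>g\<close> changes in proportion to its own absolute value plus twice the bound on
  \<open>\<alpha>\<close> and \<open>\<beta>\<close>. Near a zero of the reduced cost
  \<open>g\<close> is as small as the noise, so the entry rate contains no factor
  \<open>exp \<bar>t\<bar>\<close>, although the costs at the two ends must outweigh the
  noise.\<close>

lemma finite_ex_min:
  fixes f :: "'a \<Rightarrow> real"
  assumes "finite K" "K \<noteq> {}"
  shows "\<exists>k\<in>K. \<forall>l\<in>K. f k \<le> f l"
  using arg_min_if_finite(1)[OF assms, of f] arg_min_least[OF assms, of _ f] by blast

text \<open>Vectors are total functions that vanish from \<open>n\<close> on, so equality of vectors
  is plain function equality. Zero and closure under \<open>w + c * v\<close> give all linear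
  combinations.\<close>

locale coord_subspace =
  fixes n :: nat and W :: "(nat \<Rightarrow> real) set"
  assumes zero_mem: "(\<lambda>_. 0) \<in> W"
    and add_scale_mem: "w \<in> W \<Longrightarrow> v \<in> W \<Longrightarrow> (\<lambda>i. w i + c * v i) \<in> W"
    and vanish: "w \<in> W \<Longrightarrow> i \<ge> n \<Longrightarrow> w i = 0"
begin

lemma scale_mem: "v \<in> W \<Longrightarrow> (\<lambda>i. c * v i) \<in> W"
  using add_scale_mem[OF zero_mem, of v c] by simp

lemma diff_mem: "w \<in> W \<Longrightarrow> v \<in> W \<Longrightarrow> (\<lambda>i. w i - v i) \<in> W"
  using add_scale_mem[of w v "-1"] by simp

lemma sum_mem: "finite J \<Longrightarrow> (\<And>j. j \<in> J \<Longrightarrow> w j \<in> W) \<Longrightarrow> (\<lambda>i. \<Sum>j\<in>J. c j * w j i) \<in> W"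
proof (induction J rule: finite_induct)
  case empty
  then show ?case using zero_mem by simp
next
  case (insert x F)
  then have "(\<lambda>i. (\<Sum>j\<in>F. c j * w j i) + c x * w x i) \<in> W"
    by (intro add_scale_mem) auto
  then show ?case using insert by (simp add: add.commute)
qed

definition cobasis :: "nat set \<Rightarrow> bool" where
  "cobasis N \<longleftrightarrow> N \<subseteq> {..<n} \<and> (\<forall>w\<in>W. (\<forall>i\<in>N. w i = 0) \<longrightarrow> w = (\<lambda>_. 0)) \<and>
     (\<forall>j\<in>N. \<exists>w\<in>W. \<forall>l\<in>N. w l = (if l = j then 1 else 0))"

text \<open>The lift of the unit vector at \<open>j\<close> from \<open>N\<close> to
  \<open>W\<close>, unique for a cobasis. In simplex terms it is the direction in which the nonbasic
  variable \<open>j\<close> grows at unit rate; its entries outside \<open>N\<close> are a negated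
  tableau column.\<close>

definition fund :: "nat set \<Rightarrow> nat \<Rightarrow> nat \<Rightarrow> real" where
  "fund N j = (SOME w. w \<in> W \<and> (\<forall>l\<in>N. w l = (if l = j then 1 else 0)))"

lemma cobasis_subset: "cobasis N \<Longrightarrow> N \<subseteq> {..<n}"
  and cobasis_finite: "cobasis N \<Longrightarrow> finite N"
  and cobasis_zero: "cobasis N \<Longrightarrow> w \<in> W \<Longrightarrow> (\<And>i. i \<in> N \<Longrightarrow> w i = 0) \<Longrightarrow> w = (\<lambda>_. 0)"
  by (auto simp: cobasis_def intro: finite_subset)

lemma finite_cobases: "finite {N. cobasis N}"
  by (rule finite_subset[of _ "Pow {..<n}"]) (auto simp: cobasis_def)

lemma cobasis_eqI:
  assumes "cobasis N" "w \<in> W" "v \<in> W" "\<And>i. i \<in> N \<Longrightarrow> w i = v i"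
  shows "w = v"
proof -
  have "(\<lambda>i. w i - v i) = (\<lambda>_. 0)"
    using assms by (intro cobasis_zero diff_mem) auto
  then show ?thesis by (simp add: fun_eq_iff)
qed

lemma
  assumes "cobasis N" "j \<in> N"
  shows fund_mem: "fund N j \<in> W"
    and fund_delta: "\<And>l. l \<in> N \<Longrightarrow> fund N j l = (if l = j then 1 else 0)"
proof -
  have "\<exists>w. w \<in> W \<and> (\<forall>l\<in>N. w l = (if l = j then 1 else 0))"
    using assms unfolding cobasis_def by blast
  from someI_ex[OF this] show "fund N j \<in> W" "\<And>l. l \<in> N \<Longrightarrow> fund N j l = (if l = j then 1 else 0)"
    unfolding fund_def by auto
qed

lemma fund_eqI:
  assumes "cobasis N" "j \<in> N" "w \<in> W" "\<And>l. l \<in> N \<Longrightarrow> w l = (if l = j then 1 else 0)"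
  shows "fund N j = w"
  using assms fund_mem fund_delta by (intro cobasis_eqI[of N]) auto

lemma expand:
  assumes "cobasis N" "w \<in> W"
  shows "w = (\<lambda>i. \<Sum>j\<in>N. w j * fund N j i)"
proof (rule cobasis_eqI[OF assms])
  show "(\<lambda>i. \<Sum>j\<in>N. w j * fund N j i) \<in> W"
    using assms by (intro sum_mem cobasis_finite fund_mem)
  fix i assume "i \<in> N"
  then have "(\<Sum>j\<in>N. w j * fund N j i) = (\<Sum>j\<in>N. if i = j then w i else 0)"
    using assms by (intro sum.cong) (auto simp: fund_delta)
  then show "w i = (\<Sum>j\<in>N. w j * fund N j i)"
    using \<open>i \<in> N\<close> cobasis_finite[OF assms(1)] by simp
qed

section \<open>Reduced costs and basic solutions\<close>

definition pair :: "(nat \<Rightarrow> real) \<Rightarrow> (nat \<Rightarrow> real) \<Rightarrow> real" where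
  "pair c x = (\<Sum>i<n. c i * x i)"

definition rcost :: "nat set \<Rightarrow> (nat \<Rightarrow> real) \<Rightarrow> nat \<Rightarrow> real" where
  "rcost N c j = pair c (fund N j)"

lemma pair_diff: "pair c (\<lambda>i. x i - y i) = pair c x - pair c y"
  by (simp add: pair_def sum_subtractf algebra_simps)

lemma pair_add_scale: "pair c (\<lambda>i. x i + a * y i) = pair c x + a * pair c y"
  by (simp add: pair_def sum.distrib sum_distrib_left algebra_simps)

lemma pair_expand:
  assumes "cobasis N" "w \<in> W"
  shows "pair c w = (\<Sum>j\<in>N. w j * rcost N c j)"
proof -
  have "pair c w = pair c (\<lambda>i. \<Sum>j\<in>N. w j * fund N j i)"
    using expand[OF assms] by simp
  also have "\<dots> = (\<Sum>i<n. \<Sum>j\<in>N. w j * (c i * fund N j i))"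
    by (simp add: pair_def sum_distrib_left algebra_simps)
  also have "\<dots> = (\<Sum>j\<in>N. w j * rcost N c j)"
    by (subst sum.swap) (simp add: rcost_def pair_def sum_distrib_left)
  finally show ?thesis .
qed

text \<open>The right-hand side of the linear system is encoded by a solution \<open>q\<close>,
  whose coset \<open>q + W\<close> is cut with the nonnegative orthant. Perturbing the right-hand
  side is then a change of \<open>q\<close> that leaves \<open>W\<close> and its cobases
  alone.\<close>

definition slice :: "(nat \<Rightarrow> real) \<Rightarrow> (nat \<Rightarrow> real) set" where
  "slice q = {x. (\<forall>i. 0 \<le> x i) \<and> (\<lambda>i. x i - q i) \<in> W}"

text \<open>Subtracting from \<open>q\<close> the lift of its coordinates in \<open>N\<close> stays
  in the coset and annihilates these coordinates. This is the basic solution, written without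
  inverting a basis matrix.\<close>

definition bsol :: "nat set \<Rightarrow> (nat \<Rightarrow> real) \<Rightarrow> nat \<Rightarrow> real" where
  "bsol N q = (\<lambda>i. q i - (\<Sum>j\<in>N. q j * fund N j i))"

lemma bsol_mem: "cobasis N \<Longrightarrow> (\<lambda>i. bsol N q i - q i) \<in> W"
proof -
  assume N: "cobasis N"
  have "(\<lambda>i. \<Sum>j\<in>N. (- q j) * fund N j i) \<in> W"
    using N by (intro sum_mem cobasis_finite fund_mem)
  then show ?thesis by (simp add: bsol_def sum_negf)
qed

lemma bsol_zero: "cobasis N \<Longrightarrow> j \<in> N \<Longrightarrow> bsol N q j = 0"
proof -
  assume N: "cobasis N" "j \<in> N"
  have "(\<Sum>l\<in>N. q l * fund N l j) = (\<Sum>l\<in>N. if j = l then q j else 0)"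
    using N by (intro sum.cong) (auto simp: fund_delta)
  then show ?thesis using N cobasis_finite by (simp add: bsol_def)
qed

lemma coset_diff:
  assumes "(\<lambda>i. x i - q i) \<in> W" "(\<lambda>i. y i - q i) \<in> W"
  shows "(\<lambda>i. x i - y i) \<in> W"
  using diff_mem[OF assms] by simp

lemma bsol_eqI:
  assumes "cobasis N" "(\<lambda>i. x i - q i) \<in> W" "\<And>j. j \<in> N \<Longrightarrow> x j = 0"
  shows "bsol N q = x"
proof -
  have "(\<lambda>i. bsol N q i - x i) = (\<lambda>_. 0)"
    using assms bsol_zero by (intro cobasis_zero[OF assms(1)] coset_diff[OF bsol_mem]) auto
  then show ?thesis by (simp add: fun_eq_iff)
qed

definition feasible :: "(nat \<Rightarrow> real) \<Rightarrow> nat set \<Rightarrow> bool" where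
  "feasible q N \<longleftrightarrow> cobasis N \<and> (\<forall>i. 0 \<le> bsol N q i)"

lemma bsol_slice: "feasible q N \<Longrightarrow> bsol N q \<in> slice q"
  by (simp add: feasible_def slice_def bsol_mem)

text \<open>The expansion of \<open>x - bsol N q\<close> in the dual basis has the coefficients
  \<open>x j\<close>, since \<open>bsol\<close> vanishes on \<open>N\<close>. Optimality and
  uniqueness arguments read off the excess cost from this identity.\<close>

lemma pair_slice:
  assumes "cobasis N" "x \<in> slice q"
  shows "pair c x = pair c (bsol N q) + (\<Sum>j\<in>N. x j * rcost N c j)"
proof -
  have "pair c (\<lambda>i. x i - bsol N q i) = (\<Sum>j\<in>N. (x j - bsol N q j) * rcost N c j)"
    using assms by (intro pair_expand coset_diff[OF _ bsol_mem]) (auto simp: slice_def)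
  also have "\<dots> = (\<Sum>j\<in>N. x j * rcost N c j)"
    using assms by (intro sum.cong) (auto simp: bsol_zero)
  finally show ?thesis by (simp add: pair_diff)
qed

section \<open>Dual feasibility and pivots\<close>

definition dual_feasible :: "(nat \<Rightarrow> real) \<Rightarrow> nat set \<Rightarrow> bool" where
  "dual_feasible c N \<longleftrightarrow> (\<forall>j\<in>N. 0 \<le> rcost N c j)"

definition nondegenerate :: "(nat \<Rightarrow> real) \<Rightarrow> bool" where
  "nondegenerate q \<longleftrightarrow> (\<forall>N k. feasible q N \<longrightarrow> k < n \<longrightarrow> k \<notin> N \<longrightarrow> 0 < bsol N q k)"

text \<open>The negative entry says that moving along \<open>fund N j\<close> is eventually blocked
  by coordinate \<open>k\<close>. It is recorded because it later makes the face belonging to the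
  pivot bounded, hence an edge and not a ray.\<close>

definition pivot_rel :: "(nat \<Rightarrow> real) \<Rightarrow> (nat set \<times> nat set) set" where
  "pivot_rel q = {(N, N'). feasible q N \<and> feasible q N' \<and>
     (\<exists>j\<in>N. \<exists>k. k < n \<and> k \<notin> N \<and> fund N j k < 0 \<and> N' = insert k (N - {j}))}"

text \<open>Gaussian elimination on the dual basis: \<open>fund N j\<close> is scaled to have entry
  1 at \<open>k\<close>, and multiples of it clear the entry at \<open>k\<close> from the other
  vectors.\<close>

lemma exchange:
  assumes N: "cobasis N" "j \<in> N" "k < n" "k \<notin> N" "fund N j k \<noteq> 0"
  defines "N' \<equiv> insert k (N - {j})"
  shows "cobasis N'"
    and "fund N' k = (\<lambda>i. fund N j i / fund N j k)"
    and "\<And>l. l \<in> N - {j} \<Longrightarrow> fund N' l = (\<lambda>i. fund N l i + - (fund N l k / fund N j k) * fund N j i)"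
proof -
  note W = fund_mem[OF N(1)] and D = fund_delta[OF N(1)]
  have m1: "(\<lambda>i. fund N j i / fund N j k) \<in> W"
    using scale_mem[OF W[OF N(2)], of "1 / fund N j k"] by simp
  have d1: "(fund N j l / fund N j k) = (if l = k then 1 else 0)" if "l \<in> N'" for l
    using that N D[of j l] by (auto simp: N'_def)
  have m2: "(\<lambda>i. fund N l i + - (fund N l k / fund N j k) * fund N j i) \<in> W" if "l \<in> N - {j}" for l
    using that N by (intro add_scale_mem W) auto
  have d2: "fund N l i + - (fund N l k / fund N j k) * fund N j i = (if i = l then 1 else 0)"
    if "l \<in> N - {j}" "i \<in> N'" for l i
    using that N D[of l i] D[of j i] by (auto simp: N'_def)
  show *: "cobasis N'"
    unfolding cobasis_def
  proof (intro conjI ballI impI)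
    show "N' \<subseteq> {..<n}" using N cobasis_subset[OF N(1)] by (auto simp: N'_def)
  next
    fix w assume w: "w \<in> W" "\<forall>i\<in>N'. w i = 0"
    have e: "w i = w j * fund N j i" for i
    proof -
      have "w i = (\<Sum>l\<in>N. w l * fund N l i)"
        using expand[OF N(1) w(1)] by (rule fun_cong)
      also have "\<dots> = (\<Sum>l\<in>N. if l = j then w j * fund N j i else 0)"
        using w(2) by (intro sum.cong) (auto simp: N'_def)
      also have "\<dots> = w j * fund N j i"
        using N(2) cobasis_finite[OF N(1)] by simp
      finally show ?thesis .
    qed
    have "w k = 0" using w(2) unfolding N'_def by blast
    then have "w j * fund N j k = 0" using e[of k] by metis
    then have "w j = 0" using N(5) by (simp only: mult_eq_0_iff) blast
    then have "w i = 0" for i using e[of i] by (simp only: mult_zero_left)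
    then show "w = (\<lambda>_. 0)" by blast
  next
    fix l assume l: "l \<in> N'"
    show "\<exists>w\<in>W. \<forall>i\<in>N'. w i = (if i = l then 1 else 0)"
    proof (cases "l = k")
      case True
      then show ?thesis using m1 d1 by (intro bexI[OF _ m1]) auto
    next
      case False
      with l have "l \<in> N - {j}" by (auto simp: N'_def)
      then show ?thesis using d2 by (intro bexI[OF _ m2]) auto
    qed
  qed
  show "fund N' k = (\<lambda>i. fund N j i / fund N j k)"
    using m1 d1 by (intro fund_eqI[OF *]) (auto simp: N'_def)
  show "\<And>l. l \<in> N - {j} \<Longrightarrow> fund N' l = (\<lambda>i. fund N l i + - (fund N l k / fund N j k) * fund N j i)"
    using m2 d2 by (intro fund_eqI[OF *]) (auto simp: N'_def)
qed

text \<open>The ratio test: the first coordinate to reach zero along \<open>fund N j\<close> joins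
  the cobasis. By nondegeneracy it is strictly positive at the start, so the step length is strictly
  positive.\<close>

lemma pivot_exists:
  assumes nd: "nondegenerate q" and F: "feasible q N" and j: "j \<in> N"
    and neg: "\<exists>k<n. fund N j k < 0"
  obtains k \<theta> where "k < n" "k \<notin> N" "fund N j k < 0" "(N, insert k (N - {j})) \<in> pivot_rel q"
    "\<theta> > 0" "bsol (insert k (N - {j})) q = (\<lambda>i. bsol N q i + \<theta> * fund N j i)"
proof -
  have N: "cobasis N" using F by (simp add: feasible_def)
  define K where "K = {k. k < n \<and> fund N j k < 0}"
  define rat where "rat k = bsol N q k / - fund N j k" for k
  have "finite K" "K \<noteq> {}" using neg by (auto simp: K_def)
  then obtain k where k: "k \<in> K" "\<And>l. l \<in> K \<Longrightarrow> rat k \<le> rat l"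
    using finite_ex_min[of K rat] by blast
  \<comment> \<open>On \<open>N\<close> the direction has only the entries 0 and 1, so a negative
    entry lies outside.\<close>
  have kN: "k \<notin> N"
    using k(1) fund_delta[OF N j, of k] by (auto simp: K_def split: if_splits)
  have kn: "k < n" "fund N j k < 0" using k by (auto simp: K_def)
  define \<theta> where "\<theta> = rat k"
  have bk: "bsol N q k > 0" using nd F kn kN unfolding nondegenerate_def by blast
  then have \<theta>: "\<theta> > 0" using kn by (simp add: \<theta>_def rat_def divide_neg_pos divide_pos_neg)
  define x where "x = (\<lambda>i. bsol N q i + \<theta> * fund N j i)"
  note ex = exchange[OF N j kn(1) kN less_imp_neq[OF kn(2)]]
  have "(\<lambda>i. (bsol N q i - q i) + \<theta> * fund N j i) \<in> W"
    by (intro add_scale_mem bsol_mem fund_mem N j)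
  then have xW: "(\<lambda>i. x i - q i) \<in> W" by (simp add: x_def algebra_simps)
  have xz: "x l = 0" if "l \<in> insert k (N - {j})" for l
  proof (cases "l = k")
    case True
    then show ?thesis using kn by (simp add: x_def \<theta>_def rat_def field_simps)
  next
    case False
    then show ?thesis using that bsol_zero[OF N] fund_delta[OF N j] by (auto simp: x_def)
  qed
  have bs: "bsol (insert k (N - {j})) q = x"
    by (rule bsol_eqI[OF ex(1) xW xz])
  have "0 \<le> x i" for i
  proof (cases "i \<in> K")
    case True
    then have "\<theta> \<le> rat i" using k \<theta>_def by simp
    moreover have "0 < - fund N j i" using True by (simp add: K_def)
    ultimately have "\<theta> * (- fund N j i) \<le> bsol N q i"
      unfolding rat_def by (simp only: pos_le_divide_eq)
    then show ?thesis by (simp add: x_def)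
  next
    case False
    then have "0 \<le> fund N j i" using vanish[OF fund_mem[OF N j]] by (cases "i < n") (auto simp: K_def)
    then show ?thesis using F \<theta> by (simp add: x_def feasible_def)
  qed
  then have "feasible q (insert k (N - {j}))" using bs ex(1) by (simp add: feasible_def)
  then have "(N, insert k (N - {j})) \<in> pivot_rel q"
    using F j kn kN unfolding pivot_rel_def by blast
  then show ?thesis using that kn kN \<theta> bs x_def by blast
qed

text \<open>The new dual basis arises from the old one by scaling and by adding multiples of
  \<open>fund N j\<close>, which costs nothing. The surviving reduced costs are unchanged and the
  one at \<open>k\<close> is zero.\<close>

lemma dual_feasible_exchange:
  assumes N: "cobasis N" "j \<in> N" "k < n" "k \<notin> N" "fund N j k \<noteq> 0"
    and "dual_feasible c N" "rcost N c j = 0"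
  shows "dual_feasible c (insert k (N - {j}))"
  unfolding dual_feasible_def
proof
  fix l assume l: "l \<in> insert k (N - {j})"
  show "0 \<le> rcost (insert k (N - {j})) c l"
  proof (cases "l = k")
    case True
    have "rcost (insert k (N - {j})) c k = pair c (\<lambda>i. 0 + (1 / fund N j k) * fund N j i)"
      unfolding rcost_def exchange(2)[OF N] by simp
    also have "\<dots> = 0" using assms(7) unfolding pair_add_scale by (simp add: rcost_def pair_def)
    finally show ?thesis using True by simp
  next
    case False
    then have l: "l \<in> N - {j}" using l by auto
    show ?thesis using assms(6,7) l
      unfolding rcost_def exchange(3)[OF N l] pair_add_scale by (auto simp: dual_feasible_def rcost_def)
  qed
qed

text \<open>A minimal subset of \<open>Z\<close> that still detects \<open>W\<close> is a cobasis:
  by minimality, dropping \<open>j\<close> admits a nonzero vector vanishing on the other indices,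
  and after scaling it is the lift of the unit vector at \<open>j\<close>.\<close>

lemma cobasis_within:
  assumes "Z \<subseteq> {..<n}" "\<And>w. w \<in> W \<Longrightarrow> (\<And>i. i \<in> Z \<Longrightarrow> w i = 0) \<Longrightarrow> w = (\<lambda>_. 0)"
  shows "\<exists>N\<subseteq>Z. cobasis N"
proof -
  define det where "det N \<longleftrightarrow> (\<forall>w\<in>W. (\<forall>i\<in>N. w i = 0) \<longrightarrow> w = (\<lambda>_. 0))" for N
  have "finite Z" using assms(1) finite_subset by blast
  then have "finite {N. N \<subseteq> Z \<and> det N}" by simp
  moreover have "Z \<in> {N. N \<subseteq> Z \<and> det N}" using assms by (auto simp: det_def)
  ultimately obtain N where N: "N \<subseteq> Z" "det N" and min: "\<And>N'. N' \<subseteq> Z \<Longrightarrow> det N' \<Longrightarrow> N' \<subseteq> N \<Longrightarrow> N' = N"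
    using finite_has_minimal2[of "{N. N \<subseteq> Z \<and> det N}" Z] by (metis (no_types, lifting) mem_Collect_eq)
  have "\<exists>w\<in>W. \<forall>l\<in>N. w l = (if l = j then 1 else 0)" if "j \<in> N" for j
  proof -
    have "\<not> det (N - {j})" using min[of "N - {j}"] N that by auto
    then obtain w where w: "w \<in> W" "\<forall>i\<in>N-{j}. w i = 0" "w \<noteq> (\<lambda>_. 0)" by (auto simp: det_def)
    have "w j \<noteq> 0" using w N(2) by (auto simp: det_def)
    then show ?thesis using w
      by (intro bexI[OF _ scale_mem[OF w(1), of "1 / w j"]]) auto
  qed
  then show ?thesis using N assms(1) by (intro exI[of _ N]) (auto simp: cobasis_def det_def)
qed

text \<open>A point of the slice with minimal support admits no nonzero direction of \<open>W\<close> inside its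
  support, so its zero set contains a cobasis.\<close>

lemma feasible_exists:
  assumes "\<And>i. 0 \<le> q i"
  shows "\<exists>N. feasible q N"
proof -
  define sp where "sp x = {i. i < n \<and> x i \<noteq> 0}" for x :: "nat \<Rightarrow> real"
  have fsp: "finite (sp x)" for x by (simp add: sp_def)
  have "q \<in> slice q" using assms zero_mem by (simp add: slice_def)
  then obtain x where x: "x \<in> slice q" and min: "\<And>y. y \<in> slice q \<Longrightarrow> card (sp x) \<le> card (sp y)"
    using ex_has_least_nat[of "\<lambda>x. x \<in> slice q" q "\<lambda>x. card (sp x)"] by auto
  have key: False if w: "w \<in> W" "\<And>i. i < n \<Longrightarrow> x i = 0 \<Longrightarrow> w i = 0" and ng: "\<exists>k. w k < 0" for w
  proof -
    define K where "K = {k. k < n \<and> w k < 0}"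
    from ng obtain k' where "w k' < 0" by blast
    then have "k' \<in> K" using vanish[OF w(1), of k'] by (cases "k' < n") (auto simp: K_def)
    then have "K \<noteq> {}" by blast
    moreover have "finite K" by (simp add: K_def)
    ultimately obtain k where k: "k \<in> K" "\<And>l. l \<in> K \<Longrightarrow> x k / - w k \<le> x l / - w l"
      using finite_ex_min[of K "\<lambda>k. x k / - w k"] by blast
    define \<theta> where "\<theta> = x k / - w k"
    have kn: "k < n" "w k < 0" using k by (auto simp: K_def)
    have xk: "x k \<noteq> 0" using w(2)[of k] kn by auto
    have x0: "0 \<le> x i" for i using x by (simp add: slice_def)
    have \<theta>: "\<theta> \<ge> 0" using kn x0[of k] by (simp add: \<theta>_def divide_nonneg_neg)
    define y where "y = (\<lambda>i. x i + \<theta> * w i)"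
    have "0 \<le> y i" for i
    proof (cases "i \<in> K")
      case True
      then have "\<theta> \<le> x i / - w i" using k \<theta>_def by simp
      moreover have "0 < - w i" using True by (simp add: K_def)
      ultimately have "\<theta> * (- w i) \<le> x i" by (simp only: pos_le_divide_eq)
      then show ?thesis by (simp add: y_def)
    next
      case False
      then have "0 \<le> w i" using vanish[OF w(1)] by (cases "i < n") (auto simp: K_def)
      then show ?thesis using x0[of i] \<theta> by (simp add: y_def)
    qed
    moreover have "(\<lambda>i. (x i - q i) + \<theta> * w i) \<in> W"
      using x by (intro add_scale_mem w(1)) (simp add: slice_def)
    ultimately have "y \<in> slice q" by (simp add: slice_def y_def algebra_simps)
    then have c: "card (sp x) \<le> card (sp y)" by (rule min)
    have "y k = 0" using kn by (simp add: y_def \<theta>_def field_simps)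
    then have "k \<notin> sp y" "k \<in> sp x" using xk kn by (auto simp: sp_def)
    moreover have "sp y \<subseteq> sp x" using w(2) by (auto simp: sp_def y_def)
    ultimately have "sp y \<subset> sp x" by auto
    then have "card (sp y) < card (sp x)" by (rule psubset_card_mono[OF fsp])
    then show False using c by linarith
  qed
  have "w = (\<lambda>_. 0)" if w: "w \<in> W" "\<And>i. i \<in> {i. i < n \<and> x i = 0} \<Longrightarrow> w i = 0" for w
  proof (rule ccontr)
    assume "w \<noteq> (\<lambda>_. 0)"
    then obtain k where "w k \<noteq> 0" by auto
    \<comment> \<open>The ratio test needs a negative entry; a nonzero vector or its negative
      provides one.\<close>
    then consider "w k < 0" | "- 1 * w k < 0" by linarith
    then show False
      using key[OF w(1)] key[OF scale_mem[OF w(1), of "-1"]] w(2) by cases auto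
  qed
  then obtain N where N: "N \<subseteq> {i. i < n \<and> x i = 0}" "cobasis N"
    using cobasis_within[of "{i. i < n \<and> x i = 0}"] by auto
  have "bsol N q = x" using x N by (intro bsol_eqI[OF N(2)]) (auto simp: slice_def)
  then show ?thesis using x N by (auto simp: feasible_def slice_def)
qed

text \<open>The hypothesis \<open>bd\<close> excludes rays of decreasing cost.\<close>

lemma optimum_exists:
  assumes nd: "nondegenerate q" and q: "\<And>i. 0 \<le> q i"
    and bd: "\<And>N j. feasible q N \<Longrightarrow> j \<in> N \<Longrightarrow> (\<And>k. 0 \<le> fund N j k) \<Longrightarrow> 0 \<le> rcost N c j"
  shows "\<exists>N. feasible q N \<and> dual_feasible c N"
proof -
  define val where "val N = pair c (bsol N q)" for N
  have "finite {N. feasible q N}" by (rule finite_subset[OF _ finite_cobases]) (auto simp: feasible_def)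
  moreover have "{N. feasible q N} \<noteq> {}" using feasible_exists[OF q] by auto
  ultimately obtain N where N: "feasible q N" "\<And>N'. feasible q N' \<Longrightarrow> val N \<le> val N'"
    using finite_ex_min[of "{N. feasible q N}" val] by blast
  have "0 \<le> rcost N c j" if j: "j \<in> N" for j
  proof (cases "\<exists>k<n. fund N j k < 0")
    case True
    from pivot_exists[OF nd N(1) j True] obtain k \<theta> where k: "(N, insert k (N - {j})) \<in> pivot_rel q"
      "\<theta> > 0" "bsol (insert k (N - {j})) q = (\<lambda>i. bsol N q i + \<theta> * fund N j i)" by metis
    then have "val N \<le> val (insert k (N - {j}))" by (intro N(2)) (auto simp: pivot_rel_def)
    then have "0 \<le> \<theta> * rcost N c j" unfolding val_def k(3) pair_add_scale by (simp add: rcost_def)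
    then show ?thesis using k(2) by (simp add: zero_le_mult_iff)
  next
    case False
    have "0 \<le> fund N j k" for k
      using False vanish[OF fund_mem, of N j k] N j by (cases "k < n") (auto simp: feasible_def)
    then show ?thesis using bd[OF N(1) j] by blast
  qed
  then show ?thesis using N by (auto simp: dual_feasible_def)
qed

section \<open>Comparison of optimal bases\<close>

lemma pair_nonneg: "(\<And>i. i < n \<Longrightarrow> 0 \<le> c i) \<Longrightarrow> (\<And>i. 0 \<le> x i) \<Longrightarrow> 0 \<le> pair c x"
  unfolding pair_def by (intro sum_nonneg mult_nonneg_nonneg) auto

lemma optimum_exists_nonneg:
  assumes "nondegenerate q" "\<And>i. 0 \<le> q i" "\<And>i. i < n \<Longrightarrow> 0 \<le> c i"
  shows "\<exists>N. feasible q N \<and> dual_feasible c N"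
  using assms pair_nonneg by (intro optimum_exists) (auto simp: rcost_def)

lemma optimal_value:
  assumes "cobasis N" "dual_feasible c N" "x \<in> slice q"
  shows "pair c (bsol N q) \<le> pair c x"
proof -
  have "0 \<le> (\<Sum>j\<in>N. x j * rcost N c j)"
    using assms by (intro sum_nonneg mult_nonneg_nonneg) (auto simp: slice_def dual_feasible_def)
  then show ?thesis using pair_slice[OF assms(1,3)] by simp
qed

lemma nondegenerate_support:
  assumes "nondegenerate q" "feasible q N"
  shows "N = {i. i < n \<and> bsol N q i = 0}"
  using assms cobasis_subset[of N] bsol_zero[of N] unfolding nondegenerate_def feasible_def
  by (fastforce simp: subset_iff)

text \<open>The excess cost of another optimal basic solution is a sum over \<open>N\<close> with
  strictly positive weights, so that solution vanishes on \<open>N\<close> and equals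
  \<open>bsol N q\<close>; nondegeneracy recovers the cobasis from the point. This makes the open
  normal cones disjoint.\<close>

lemma strict_dual_feasible_unique:
  assumes nd: "nondegenerate q" and N: "feasible q N" "\<And>j. j \<in> N \<Longrightarrow> 0 < rcost N c j"
    and N': "feasible q N'" "dual_feasible c N'"
  shows "N' = N"
proof -
  have cb: "cobasis N" "cobasis N'" using N N' by (auto simp: feasible_def)
  have x': "bsol N' q \<in> slice q" using N'(1) by (rule bsol_slice)
  have "(\<Sum>j\<in>N. bsol N' q j * rcost N c j) = pair c (bsol N' q) - pair c (bsol N q)"
    using pair_slice[OF cb(1) x'] by simp
  also have "\<dots> \<le> 0" using optimal_value[OF cb(2) N'(2) bsol_slice[OF N(1)]] by simp
  finally have "(\<Sum>j\<in>N. bsol N' q j * rcost N c j) \<le> 0" .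
  moreover have nn: "0 \<le> bsol N' q j * rcost N c j" if "j \<in> N" for j
    using N(2)[OF that] N'(1) by (auto simp: feasible_def intro!: mult_nonneg_nonneg less_imp_le)
  ultimately have "(\<Sum>j\<in>N. bsol N' q j * rcost N c j) = 0"
    using sum_nonneg[of N "\<lambda>j. bsol N' q j * rcost N c j"] by fastforce
  then have "\<forall>j\<in>N. bsol N' q j * rcost N c j = 0"
    using nn by (subst (asm) sum_nonneg_eq_0_iff) (auto intro: cobasis_finite[OF cb(1)])
  then have "bsol N' q j = 0" if "j \<in> N" for j using N(2)[OF that] that by auto
  then have "bsol N q = bsol N' q" by (intro bsol_eqI[OF cb(1) bsol_mem[OF cb(2)]])
  then show ?thesis using nondegenerate_support[OF nd N(1)] nondegenerate_support[OF nd N'(1)] by simp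
qed

definition opt_pivot_rel :: "(nat \<Rightarrow> real) \<Rightarrow> (nat \<Rightarrow> real) \<Rightarrow> (nat set \<times> nat set) set" where
  "opt_pivot_rel q c = {(N, N') \<in> pivot_rel q. dual_feasible c N \<and> dual_feasible c N'}"

text \<open>Inside the optimal face, pivot so as to decrease the sum of the coordinates in the target
  cobasis; that sum vanishes only at the target.\<close>

lemma optimal_face_connected:
  assumes nd: "nondegenerate q" and N': "feasible q N'" "dual_feasible c N'"
    and N: "feasible q N" "dual_feasible c N"
  shows "(N, N') \<in> (opt_pivot_rel q c)\<^sup>*"
proof -
  define e where "e = (\<lambda>i. if i \<in> N' then 1 else 0 :: real)"
  define val where "val M = pair e (bsol M q)" for M
  \<comment> \<open>The values are real, so the induction runs on the number of feasible cobases of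
    smaller value.\<close>
  define below where "below M = {L. feasible q L \<and> val L < val M}" for M
  have fin: "finite (below M)" for M
    by (rule finite_subset[OF _ finite_cobases]) (auto simp: feasible_def below_def)
  have cb': "cobasis N'" and x': "bsol N' q \<in> slice q"
    using N' bsol_slice by (auto simp: feasible_def)
  show ?thesis using N
  proof (induction "card (below N)" arbitrary: N rule: less_induct)
    case less
    have cb: "cobasis N" using less.prems by (simp add: feasible_def)
    show ?case
    proof (cases "N = N'")
      case False
      let ?x = "bsol N q" and ?x' = "bsol N' q"
      have neq: "?x \<noteq> ?x'"
        using False nondegenerate_support[OF nd less.prems(1)] nondegenerate_support[OF nd N'(1)] by metis
      have v': "val N' = 0"
        using bsol_zero[OF cb'] by (auto simp: val_def pair_def e_def intro!: sum.neutral)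
      have "val N > 0"
      proof -
        have "0 \<le> val N" using less.prems unfolding val_def
          by (intro pair_nonneg) (auto simp: e_def feasible_def)
        moreover have "val N \<noteq> 0"
        proof
          assume "val N = 0"
          then have "\<forall>i\<in>{..<n}. e i * ?x i = 0" unfolding val_def pair_def
            using less.prems by (subst (asm) sum_nonneg_eq_0_iff) (auto simp: feasible_def e_def)
          then have "?x i = 0" if "i \<in> N'" for i
            using that cobasis_subset[OF cb'] by (force simp: e_def)
          then have "?x' = ?x" by (intro bsol_eqI[OF cb' bsol_mem[OF cb]])
          with neq show False by simp
        qed
        ultimately show ?thesis by simp
      qed
      then have "(\<Sum>j\<in>N. ?x' j * rcost N e j) < 0"
        using pair_slice[OF cb x', of e] v' by (simp add: val_def)
      then obtain j where j: "j \<in> N" "?x' j * rcost N e j < 0"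
        by (metis (no_types, lifting) not_less sum_nonneg)
      then have x'j: "?x' j > 0" and rj: "rcost N e j < 0"
        using N'(1) unfolding feasible_def mult_less_0_iff by (meson not_less)+
      have "pair c ?x' \<le> pair c ?x"
        using optimal_value[OF cb' N'(2) bsol_slice[OF less.prems(1)]] .
      then have "(\<Sum>j\<in>N. ?x' j * rcost N c j) \<le> 0"
        using pair_slice[OF cb x', of c] by simp
      moreover have nn: "0 \<le> ?x' j * rcost N c j" if "j \<in> N" for j
        using that less.prems N'(1) by (auto simp: feasible_def dual_feasible_def intro!: mult_nonneg_nonneg)
      ultimately have "(\<Sum>j\<in>N. ?x' j * rcost N c j) = 0"
        using sum_nonneg[of N "\<lambda>j. ?x' j * rcost N c j"] by fastforce
      then have "\<forall>j\<in>N. ?x' j * rcost N c j = 0"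
        using nn by (subst (asm) sum_nonneg_eq_0_iff) (auto intro: cobasis_finite[OF cb])
      \<comment> \<open>Source and target have the same cost, so every \<open>j\<close> in
        \<open>N\<close> at which the target is positive has reduced cost zero. Pivoting on such a
        \<open>j\<close> stays in the optimal face.\<close>
      then have cj: "rcost N c j = 0" using j x'j by auto
      have "\<exists>k<n. fund N j k < 0"
      proof (rule ccontr)
        assume "\<not> ?thesis"
        then have "0 \<le> fund N j k" for k
          using vanish[OF fund_mem[OF cb j(1)], of k] by (cases "k < n") auto
        then have "0 \<le> rcost N e j" unfolding rcost_def by (intro pair_nonneg) (auto simp: e_def)
        then show False using rj by simp
      qed
      from pivot_exists[OF nd less.prems(1) j(1) this] obtain k \<theta> where k: "k < n" "k \<notin> N" "fund N j k < 0" "(N, insert k (N - {j})) \<in> pivot_rel q"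
        "\<theta> > 0" "bsol (insert k (N - {j})) q = (\<lambda>i. bsol N q i + \<theta> * fund N j i)"
        by blast
      let ?M = "insert k (N - {j})"
      have M: "dual_feasible c ?M" "feasible q ?M"
        using dual_feasible_exchange[OF cb j(1) k(1,2) _ less.prems(2) cj] k by (auto simp: pivot_rel_def)
      have "val ?M = val N + \<theta> * rcost N e j"
        unfolding val_def k(6) pair_add_scale by (simp add: rcost_def)
      then have "val ?M < val N" using k(5) rj by (simp add: mult_pos_neg)
      then have "below ?M \<subset> below N" using M by (auto simp: below_def)
      then have "card (below ?M) < card (below N)" using fin by (intro psubset_card_mono)
      then have "(?M, N') \<in> (opt_pivot_rel q c)\<^sup>*" using less.hyps M by blast
      moreover have "(N, ?M) \<in> opt_pivot_rel q c" using k M less.prems by (simp add: opt_pivot_rel_def)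
      ultimately show ?thesis by (rule converse_rtrancl_into_rtrancl[rotated])
    qed simp
  qed
qed

end

section \<open>Bases visited by a curve of costs\<close>

context coord_subspace begin

lemma dual_feasible_continuous_closed:
  fixes a b :: real
  assumes "\<And>i. i < n \<Longrightarrow> continuous_on {a..b} (\<lambda>t. p t i)"
  shows "closed {t \<in> {a..b}. dual_feasible (p t) N}"
proof -
  have "closed ({a..b} \<inter> (\<Inter>j\<in>N. {t \<in> {a..b}. 0 \<le> rcost N (p t) j}))"
    unfolding rcost_def pair_def
    by (intro closed_Int closed_INT ballI continuous_on_closed_Collect_le continuous_intros assms) auto
  also have "{a..b} \<inter> (\<Inter>j\<in>N. {t \<in> {a..b}. 0 \<le> rcost N (p t) j}) = {t \<in> {a..b}. dual_feasible (p t) N}"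
    by (auto simp: dual_feasible_def)
  finally show ?thesis .
qed

text \<open>A discrete intermediate value property. Only upward jumps are restricted; a step may
  fall by any amount.\<close>

lemma rtrancl_crosses_level:
  fixes f :: "'b \<Rightarrow> nat"
  assumes "(x, y) \<in> R\<^sup>*" "f x \<le> k" "k < f y" "\<And>u v. (u, v) \<in> R \<Longrightarrow> f v \<le> Suc (f u)"
  shows "\<exists>u v. (u, v) \<in> R \<and> f v = Suc k"
  using assms(1-3)
proof (induction rule: rtrancl_induct)
  case (step y z)
  show ?case
  proof (cases "f y \<le> k")
    case True
    then have "f z = Suc k" using assms(4)[OF step(2)] step.prems by linarith
    then show ?thesis using step(2) by blast
  next
    case False
    then show ?thesis using step by simp
  qed
qed simp

text \<open>The parameter interval is covered by the closed sets of times at which a basis of level at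
  most \<open>k\<close>, respectively above \<open>k\<close>, is optimal. At a common time, the connected optimal face
  contains a basis of level exactly \<open>k + 1\<close>.\<close>

lemma curve_visits_level:
  fixes a b :: real
  assumes nd: "nondegenerate q" and q: "\<And>i. 0 \<le> q i" and ab: "a \<le> b"
    and p: "\<And>i. i < n \<Longrightarrow> continuous_on {a..b} (\<lambda>t. p t i)"
    and p0: "\<And>i t. i < n \<Longrightarrow> t \<in> {a..b} \<Longrightarrow> 0 \<le> p t i"
    and A: "feasible q Na" "dual_feasible (p a) Na" and B: "feasible q Nb" "dual_feasible (p b) Nb"
    and f: "\<And>N N'. (N, N') \<in> pivot_rel q \<Longrightarrow> f N' \<le> Suc (f N)"
    and k: "f Na \<le> k" "k < f Nb"
  shows "\<exists>N t. feasible q N \<and> t \<in> {a..b} \<and> dual_feasible (p t) N \<and> f N = Suc k"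
proof -
  define T1 where "T1 = (\<Union>N\<in>{N. feasible q N \<and> f N \<le> k}. {t \<in> {a..b}. dual_feasible (p t) N})"
  define T2 where "T2 = (\<Union>N\<in>{N. feasible q N \<and> k < f N}. {t \<in> {a..b}. dual_feasible (p t) N})"
  have "finite {N. feasible q N \<and> P N}" for P
    by (rule finite_subset[OF _ finite_cobases]) (auto simp: feasible_def)
  then have cl: "closed T1" "closed T2"
    unfolding T1_def T2_def using dual_feasible_continuous_closed[OF p] by (auto intro!: closed_UN)
  have "{a..b} \<subseteq> T1 \<union> T2"
  proof
    fix t assume t: "t \<in> {a..b}"
    obtain N where N: "feasible q N" "dual_feasible (p t) N"
      using optimum_exists_nonneg[OF nd q, of "p t"] p0[OF _ t] by blast
    then show "t \<in> T1 \<union> T2" using t by (cases "f N \<le> k") (auto simp: T1_def T2_def)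
  qed
  note cover = this
  have "a \<in> T1 \<inter> {a..b}" "b \<in> T2 \<inter> {a..b}" using A B k ab by (auto simp: T1_def T2_def)
  then have "T1 \<inter> T2 \<inter> {a..b} \<noteq> {}"
    using connected_closedD[OF connected_Icc[of a b] _ cover cl] by blast
  then obtain t where t: "t \<in> T1" "t \<in> T2" "t \<in> {a..b}" by blast
  obtain N where N: "feasible q N" "f N \<le> k" "dual_feasible (p t) N" using t(1) by (auto simp: T1_def)
  obtain N' where N': "feasible q N'" "k < f N'" "dual_feasible (p t) N'" using t(2) by (auto simp: T2_def)
  have "(N, N') \<in> (opt_pivot_rel q (p t))\<^sup>*"
    by (rule optimal_face_connected[OF nd N'(1,3) N(1,3)])
  from rtrancl_crosses_level[OF this N(2) N'(2)] obtain L L' where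
    "(L, L') \<in> opt_pivot_rel q (p t)" "f L' = Suc k"
    using f unfolding opt_pivot_rel_def by blast
  then have "feasible q L'" "dual_feasible (p t) L'" "f L' = Suc k"
    by (auto simp: opt_pivot_rel_def pivot_rel_def)
  then show ?thesis using t(3) by blast
qed

section \<open>Distance in the pivot graph\<close>

definition pivot_dist :: "(nat \<Rightarrow> real) \<Rightarrow> nat set \<Rightarrow> nat set \<Rightarrow> nat" where
  "pivot_dist q N N' = (LEAST k. (N, N') \<in> pivot_rel q ^^ k)"

text \<open>For the zero cost every feasible cobasis is optimal, so connectedness of the optimal
  face is connectedness of the whole pivot graph.\<close>

lemma pivot_connected:
  assumes "nondegenerate q" "feasible q N" "feasible q N'"
  shows "(N, N') \<in> (pivot_rel q)\<^sup>*"
proof -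
  have "(N, N') \<in> (opt_pivot_rel q (\<lambda>_. 0))\<^sup>*"
    using assms by (intro optimal_face_connected) (auto simp: dual_feasible_def rcost_def pair_def)
  moreover have "opt_pivot_rel q (\<lambda>_. 0) \<subseteq> pivot_rel q" by (auto simp: opt_pivot_rel_def)
  ultimately show ?thesis by (rule rtrancl_mono[THEN subsetD, rotated])
qed

lemma pivot_dist_path:
  assumes "nondegenerate q" "feasible q N" "feasible q N'"
  shows "(N, N') \<in> pivot_rel q ^^ pivot_dist q N N'"
proof -
  have "\<exists>k. (N, N') \<in> pivot_rel q ^^ k"
    using pivot_connected[OF assms] by (simp add: rtrancl_is_UN_relpow)
  then show ?thesis unfolding pivot_dist_def by (rule LeastI_ex)
qed

lemma pivot_dist_step:
  assumes "nondegenerate q" "feasible q N" "(L, L') \<in> pivot_rel q"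
  shows "pivot_dist q N L' \<le> Suc (pivot_dist q N L)"
proof -
  have "(N, L) \<in> pivot_rel q ^^ pivot_dist q N L"
    using assms by (intro pivot_dist_path) (auto simp: pivot_rel_def)
  then have "(N, L') \<in> pivot_rel q ^^ Suc (pivot_dist q N L)" using assms(3) by auto
  then show ?thesis unfolding pivot_dist_def[of q N L'] by (rule Least_le)
qed

text \<open>Every level from 1 to the distance is attained by a visited basis. Strict positivity at
  time \<open>a\<close> makes \<open>Na\<close> the only basis optimal there, and it has level 0, so
  only bases entered later have to be counted.\<close>

lemma pivot_dist_le_visited:
  fixes a b :: real
  assumes nd: "nondegenerate q" and q: "\<And>i. 0 \<le> q i" and ab: "a \<le> b"
    and p: "\<And>i. i < n \<Longrightarrow> continuous_on {a..b} (\<lambda>t. p t i)"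
    and p0: "\<And>i t. i < n \<Longrightarrow> t \<in> {a..b} \<Longrightarrow> 0 \<le> p t i"
    and A: "feasible q Na" "\<And>j. j \<in> Na \<Longrightarrow> 0 < rcost Na (p a) j"
    and B: "feasible q Nb" "\<And>j. j \<in> Nb \<Longrightarrow> 0 < rcost Nb (p b) j"
  shows "pivot_dist q Na Nb \<le>
    card {N. feasible q N \<and> (\<exists>t\<in>{a..b}. dual_feasible (p t) N) \<and> \<not> dual_feasible (p a) N}"
    (is "_ \<le> card ?S")
proof -
  let ?f = "pivot_dist q Na"
  have d: "dual_feasible (p a) Na" "dual_feasible (p b) Nb"
    using A(2) B(2) by (auto simp: dual_feasible_def intro: less_imp_le)
  have f0: "?f Na = 0" unfolding pivot_dist_def by (rule Least_eq_0) simp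
  have "{1..?f Nb} \<subseteq> ?f ` ?S"
  proof
    fix k assume "k \<in> {1..?f Nb}"
    then obtain l where l: "k = Suc l" "l < ?f Nb" by (cases k) auto
    obtain N t where N: "feasible q N" "t \<in> {a..b}" "dual_feasible (p t) N" "?f N = k"
      using curve_visits_level[where f = ?f and k = l, OF nd q ab p p0 A(1) d(1) B(1) d(2)
          pivot_dist_step[OF nd A(1)]] l f0
      by auto
    moreover have "\<not> dual_feasible (p a) N"
      using strict_dual_feasible_unique[OF nd A N(1)] N(4) f0 l by auto
    ultimately have "N \<in> ?S" by blast
    then show "k \<in> ?f ` ?S" using N(4) by blast
  qed
  moreover have "finite ?S"
    by (rule finite_subset[OF _ finite_cobases]) (auto simp: feasible_def)
  ultimately have "card {1..?f Nb} \<le> card ?S" by (rule surj_card_le[rotated])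
  then show ?thesis by simp
qed

end

section \<open>Exponential noise and moving boxes\<close>

text \<open>A substitute for differentiating \<open>F\<close>, of which only short increments are
  controlled, by the rate at the left end. Uniform continuity of \<open>\<rho>\<close> turns each
  left-end value into an integral, up to \<open>e\<close> times the step length.\<close>

lemma increment_le_integral:
  fixes F \<rho> :: "real \<Rightarrow> real"
  assumes ab: "a \<le> b" and cont: "continuous_on {a..b} \<rho>" and \<delta>: "0 < \<delta>"
    and step: "\<And>u v. a \<le> u \<Longrightarrow> u \<le> v \<Longrightarrow> v \<le> b \<Longrightarrow> v - u \<le> \<delta> \<Longrightarrow> F v - F u \<le> (v - u) * \<rho> u"
  shows "F b - F a \<le> integral {a..b} \<rho>"
proof (rule field_le_epsilon)
  fix e' :: real assume e': "0 < e'"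
  \<comment> \<open>The summand 1 in the denominator covers the case \<open>a = b\<close>.\<close>
  define e where "e = e' / (1 + (b - a))"
  have e: "0 < e" "e * (b - a) \<le> e'"
    using e' ab by (auto simp: e_def field_simps)
  have "uniformly_continuous_on {a..b} \<rho>"
    by (intro compact_uniformly_continuous cont) simp
  then obtain \<eta> where \<eta>: "0 < \<eta>" and uc: "\<And>x y. x \<in> {a..b} \<Longrightarrow> y \<in> {a..b} \<Longrightarrow> dist y x < \<eta> \<Longrightarrow> dist (\<rho> y) (\<rho> x) < e"
    unfolding uniformly_continuous_on_def using e(1) by metis
  have piece: "F v - F u \<le> integral {u..v} \<rho> + e * (v - u)"
    if uv: "a \<le> u" "u \<le> v" "v \<le> b" "v - u \<le> \<delta>" "v - u < \<eta>" for u v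
  proof -
    have i: "\<rho> integrable_on {u..v}"
      using uv by (intro integrable_continuous_interval continuous_on_subset[OF cont]) auto
    have "F v - F u \<le> (v - u) * \<rho> u" using step uv by blast
    also have "\<dots> = integral {u..v} (\<lambda>_. \<rho> u)" using uv by simp
    also have "\<dots> \<le> integral {u..v} (\<lambda>t. \<rho> t + e)"
    proof (rule integral_le)
      show "(\<lambda>t. \<rho> t + e) integrable_on {u..v}" using i by (intro integrable_add) auto
      fix t assume t: "t \<in> {u..v}"
      then have "dist (\<rho> u) (\<rho> t) < e" using uv by (intro uc) (auto simp: dist_real_def)
      then show "\<rho> u \<le> \<rho> t + e" by (simp add: dist_real_def)
    qed (rule integrable_const_ivl)
    also have "\<dots> = integral {u..v} \<rho> + e * (v - u)"
      using i uv by (subst integral_add) auto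
    finally show ?thesis .
  qed
  obtain K :: nat where K: "(b - a) / min \<delta> (\<eta> / 2) < real K" using reals_Archimedean2 by blast
  have m: "0 < min \<delta> (\<eta> / 2)" using \<delta> \<eta> by simp
  have K0: "0 < real K" using K ab m by (smt (verit) divide_nonneg_pos)
  define h where "h = (b - a) / real K"
  have h: "0 \<le> h" "h \<le> \<delta>" "h < \<eta>"
  proof -
    show "0 \<le> h" using ab K0 by (simp add: h_def)
    have "(b - a) < real K * min \<delta> (\<eta> / 2)" using K m by (simp add: pos_divide_less_eq)
    then have "h < min \<delta> (\<eta> / 2)" using K0 unfolding h_def by (simp only: pos_divide_less_eq mult.commute[of _ "real K"])
    then show "h \<le> \<delta>" "h < \<eta>" using \<eta> by auto
  qed
  have Kh: "real K * h = b - a" using K0 by (simp add: h_def)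
  have "F (a + real i * h) - F a \<le> integral {a..a + real i * h} \<rho> + e * (real i * h)" if "i \<le> K" for i
    using that
  proof (induction i)
    case (Suc i)
    let ?u = "a + real i * h" and ?v = "a + real (Suc i) * h"
    have vb: "?v \<le> b"
      using mult_right_mono[of "real (Suc i)" "real K" h] Suc.prems h(1) Kh by simp
    have u: "a \<le> ?u" "?u \<le> ?v" "?v - ?u = h" using h(1) by (auto simp: algebra_simps)
    have "F ?v - F ?u \<le> integral {?u..?v} \<rho> + e * (?v - ?u)"
      using u vb h by (intro piece) auto
    moreover have "integral {a..?u} \<rho> + integral {?u..?v} \<rho> = integral {a..?v} \<rho>"
      using u vb by (intro Henstock_Kurzweil_Integration.integral_combine integrable_continuous_interval continuous_on_subset[OF cont]) auto
    ultimately show ?case using Suc u(3) by (simp add: algebra_simps)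
  qed simp
  from this[of K] show "F b - F a \<le> integral {a..b} \<rho> + e'"
    using Kh e(2) by (simp add: mult.commute)
qed

text \<open>Depending on the sign of \<open>u\<close>, one of the two exponentials is at most 1 and
  its term is bounded by \<open>A\<close>. The other term is the current value up to that error, and
  within the step it changes by a fraction of at most \<open>exp (v - u) - 1\<close>. Hence the
  bound involves the current value and no \<open>exp \<bar>u\<bar>\<close>.\<close>

lemma exp_pair_increment:
  fixes \<alpha> \<beta> A u v :: real
  assumes A: "\<bar>\<alpha>\<bar> \<le> A" "\<bar>\<beta>\<bar> \<le> A" and uv: "u \<le> v"
  shows "\<bar>(\<beta> * exp v + \<alpha> * exp (- v)) - (\<beta> * exp u + \<alpha> * exp (- u))\<bar>
    \<le> (exp (v - u) - 1) * (\<bar>\<beta> * exp u + \<alpha> * exp (- u)\<bar> + 2 * A)"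
proof -
  define \<theta> where "\<theta> = v - u"
  have \<theta>: "0 \<le> \<theta>" "v = u + \<theta>" using uv by (auto simp: \<theta>_def)
  define E where "E = exp \<theta> - 1"
  define E' where "E' = 1 - exp (- \<theta>)"
  have E: "0 \<le> E'" "E' \<le> E" "0 \<le> E"
  proof -
    have "exp \<theta> + exp (- \<theta>) \<ge> 2"
      using exp_ge_add_one_self[of \<theta>] exp_ge_add_one_self[of "- \<theta>"] by linarith
    then show "0 \<le> E'" "E' \<le> E" "0 \<le> E" using \<theta> by (auto simp: E_def E'_def)
  qed
  let ?g = "\<beta> * exp u + \<alpha> * exp (- u)"
  have d: "(\<beta> * exp v + \<alpha> * exp (- v)) - ?g = E * (\<beta> * exp u) - E' * (\<alpha> * exp (- u))"
    unfolding \<theta>(2) E_def E'_def by (simp add: exp_add exp_minus exp_diff field_simps)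
  have A0: "0 \<le> A" using A by linarith
  show ?thesis
  proof (cases "0 \<le> u")
    case True
    have "\<bar>\<alpha> * exp (- u)\<bar> \<le> A * 1"
      unfolding abs_mult using True A A0 by (intro mult_mono) auto
    then have "\<bar>(E + E') * (\<alpha> * exp (- u))\<bar> \<le> (2 * E) * A"
      unfolding abs_mult[of "E + E'"] using E by (intro mult_mono) auto
    moreover have "E * (\<beta> * exp u) - E' * (\<alpha> * exp (- u)) = E * ?g - (E + E') * (\<alpha> * exp (- u))"
      by (simp add: algebra_simps)
    moreover have "\<bar>E * ?g\<bar> = E * \<bar>?g\<bar>" using E by (simp add: abs_mult)
    ultimately show ?thesis unfolding d E_def[symmetric] \<theta>_def[symmetric]
      by (simp add: algebra_simps)
  next
    case False
    have "\<bar>\<beta> * exp u\<bar> \<le> A * 1"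
      unfolding abs_mult using False A A0 by (intro mult_mono) auto
    then have "\<bar>(E + E') * (\<beta> * exp u)\<bar> \<le> (2 * E) * A"
      unfolding abs_mult[of "E + E'"] using E by (intro mult_mono) auto
    moreover have "E * (\<beta> * exp u) - E' * (\<alpha> * exp (- u)) = (E + E') * (\<beta> * exp u) - E' * ?g"
      by (simp add: algebra_simps)
    moreover have "\<bar>E' * ?g\<bar> \<le> E * \<bar>?g\<bar>" unfolding abs_mult using E by (intro mult_mono) auto
    ultimately show ?thesis unfolding d E_def[symmetric] \<theta>_def[symmetric]
      by (simp add: algebra_simps)
  qed
qed

text \<open>The bound on \<open>h\<close> yields \<open>4 * h \<le> 1\<close> and
  \<open>5 * (h * Z) \<le> 1\<close>. Both exponentials are then taken on the interval from 0 to
  1/4, where \<open>exp x - 1\<close> is at most 5/4 of \<open>x\<close>, and the square of 5/4 is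
  below 2.\<close>

lemma exp_minus_one_double:
  fixes h z Z :: real
  assumes "0 \<le> h" "h \<le> 1 / (4 + 5 * Z)" "0 \<le> z" "z \<le> Z"
  shows "exp ((exp h - 1) * z) - 1 \<le> 2 * h * z"
proof -
  have Z: "0 \<le> Z" using assms by linarith
  have hZ: "h * (4 + 5 * Z) \<le> 1" using assms(2) Z by (simp add: pos_le_divide_eq)
  then have h4: "4 * h \<le> 1" "5 * (h * Z) \<le> 1"
    using mult_nonneg_nonneg[OF assms(1) Z] assms(1) by (auto simp: algebra_simps)
  have "exp h \<le> 1 + h + h\<^sup>2" using assms h4 by (intro exp_bound) auto
  moreover have "h\<^sup>2 \<le> h / 4" using mult_left_mono[OF h4(1) assms(1)] by (simp add: power2_eq_square)
  ultimately have eh: "exp h - 1 \<le> 5/4 * h" by linarith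
  define w where "w = (exp h - 1) * z"
  have w0: "0 \<le> w" using assms by (simp add: w_def)
  have w1: "w \<le> 5/4 * (h * z)" unfolding w_def using mult_right_mono[OF eh assms(3)] by simp
  have "h * z \<le> h * Z" using assms by (intro mult_left_mono)
  then have w4: "w \<le> 1/4" using w1 h4 by linarith
  have "exp w \<le> 1 + w + w\<^sup>2" using w0 w4 by (intro exp_bound) auto
  moreover have "w\<^sup>2 \<le> w / 4" using mult_left_mono[OF w4 w0] by (simp add: power2_eq_square)
  ultimately have "exp w - 1 \<le> 5/4 * w" by linarith
  also have "\<dots> \<le> 2 * h * z" using w1 mult_nonneg_nonneg[OF assms(1,3)] by linarith
  finally show ?thesis by (simp add: w_def)
qed

section \<open>The standard exponential distribution\<close>

definition expo :: "real measure" where "expo = density lborel (exponential_density 1)"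

lemma sets_expo[measurable_cong, simp]: "sets expo = sets borel"
  and space_expo[simp]: "space expo = UNIV"
  by (simp_all add: expo_def)

lemma prob_space_expo: "prob_space expo"
  unfolding expo_def by (rule prob_space_exponential_density) simp

interpretation expo: prob_space expo by (rule prob_space_expo)
interpretation expo_prod: product_prob_space "\<lambda>_ :: nat. expo" UNIV by unfold_locales

lemma distributed_expo: "distributed expo lborel (\<lambda>x. x) (exponential_density 1)"
  by (auto simp: distributed_def expo_def distr_id2 exponential_density_nonneg)

lemma AE_expo: "AE x in expo. 0 \<le> x"
  unfolding expo_def by (subst AE_density) (auto simp: exponential_density_def)

lemma emeasure_expo_greaterThan: "emeasure expo {- y<..} = ennreal (min 1 (exp y))"
proof (cases "y \<le> 0")
  case True
  then have "\<P>(x in expo. - y < x) = exp (- (- y) * 1)"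
    by (intro expo.exponential_distributedD_gt[OF distributed_expo]) auto
  then show ?thesis using True by (simp add: expo.emeasure_eq_measure greaterThan_def min_absorb2)
next
  case False
  have "AE x in expo. x \<in> {- y<..}" using AE_expo by eventually_elim (use False in auto)
  then show ?thesis using expo.emeasure_eq_1_AE[of "{-y<..}"] False by (simp add: min_def)
qed

lemma emeasure_expo_singleton: "emeasure expo {y} = 0"
  unfolding expo_def by (subst emeasure_density) (auto simp: nn_integral_indicator_singleton)

lemma emeasure_expo_atLeast: "emeasure expo {- y..} = ennreal (min 1 (exp y))"
proof -
  have "{- y..} = {- y} \<union> {- y<..}" by auto
  then have "emeasure expo {- y..} = emeasure expo {- y} + emeasure expo {- y<..}"
    by (simp add: plus_emeasure)
  then show ?thesis by (simp add: emeasure_expo_singleton emeasure_expo_greaterThan)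
qed

lemma nn_integral_expo_abs: "(\<integral>\<^sup>+x. ennreal \<bar>x\<bar> \<partial>expo) = 1"
proof -
  have int: "integrable expo (\<lambda>x. x ^ 1)"
    using expo.erlang_ith_moment_integrable[OF _ distributed_expo, of 1] by simp
  have "(\<integral>\<^sup>+x. ennreal \<bar>x\<bar> \<partial>expo) = (\<integral>\<^sup>+x. ennreal x \<partial>expo)"
    using AE_expo by (intro nn_integral_cong_AE) auto
  also have "\<dots> = ennreal (\<integral>x. x \<partial>expo)"
    using int AE_expo by (intro nn_integral_eq_integral) auto
  also have "(\<integral>x. x \<partial>expo) = 1"
    using expo.exponential_distributed_expectation[OF _ distributed_expo] by simp
  finally show ?thesis by simp
qed

text \<open>Closed boxes describe when a basis is optimal, open ones give pairwise disjoint cones.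
  Single points have no mass, so both probabilities agree, and an entry rate found for closed boxes
  can be charged to the open cones.\<close>

lemma emeasure_expo_box:
  assumes "finite J"
  shows "emeasure (PiM J (\<lambda>_::nat. expo)) {x \<in> space (PiM J (\<lambda>_. expo)). \<forall>j\<in>J. 0 \<le> x j + s j}
      = ennreal (\<Prod>j\<in>J. min 1 (exp (s j)))"
    and "emeasure (PiM J (\<lambda>_::nat. expo)) {x \<in> space (PiM J (\<lambda>_. expo)). \<forall>j\<in>J. 0 < x j + s j}
      = ennreal (\<Prod>j\<in>J. min 1 (exp (s j)))"
proof -
  have "{x \<in> space (PiM J (\<lambda>_. expo)). \<forall>j\<in>J. 0 \<le> x j + s j} = Pi\<^sub>E J (\<lambda>j. {- s j..})"
    by (auto simp: space_PiM PiE_def Pi_def)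
  then show "emeasure (PiM J (\<lambda>_::nat. expo)) {x \<in> space (PiM J (\<lambda>_. expo)). \<forall>j\<in>J. 0 \<le> x j + s j}
      = ennreal (\<Prod>j\<in>J. min 1 (exp (s j)))"
    using assms by (simp add: expo_prod.emeasure_PiM emeasure_expo_atLeast prod_ennreal)
  have "{x \<in> space (PiM J (\<lambda>_. expo)). \<forall>j\<in>J. 0 < x j + s j} = Pi\<^sub>E J (\<lambda>j. {- s j<..})"
    by (auto simp: space_PiM PiE_def Pi_def)
  then show "emeasure (PiM J (\<lambda>_::nat. expo)) {x \<in> space (PiM J (\<lambda>_. expo)). \<forall>j\<in>J. 0 < x j + s j}
      = ennreal (\<Prod>j\<in>J. min 1 (exp (s j)))"
    using assms by (simp add: expo_prod.emeasure_PiM emeasure_expo_greaterThan prod_ennreal)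
qed

text \<open>By compactness, attaining nonnegativity at some time means coming arbitrarily close to it
  at rational times.\<close>

lemma visited_measurable:
  fixes \<phi> :: "'j \<Rightarrow> real \<Rightarrow> 'x \<Rightarrow> real"
  assumes J: "finite J"
    and meas: "\<And>j t. j \<in> J \<Longrightarrow> \<phi> j t \<in> borel_measurable M"
    and cont: "\<And>j x. j \<in> J \<Longrightarrow> x \<in> space M \<Longrightarrow> continuous_on {a..b} (\<lambda>t. \<phi> j t x)"
  shows "{x \<in> space M. \<exists>t\<in>{a..b}. \<forall>j\<in>J. 0 \<le> \<phi> j t x} \<in> sets M"
proof (cases "a < b")
  case ab: True
  have eq: "(\<exists>t\<in>{a..b}. \<forall>j\<in>J. 0 \<le> \<phi> j t x) \<longleftrightarrow>
      (\<forall>k::nat. \<exists>r::rat. of_rat r \<in> {a..b} \<and> (\<forall>j\<in>J. - (1 / real (Suc k)) < \<phi> j (of_rat r) x))"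
    if x: "x \<in> space M" for x
  proof
    assume "\<exists>t\<in>{a..b}. \<forall>j\<in>J. 0 \<le> \<phi> j t x"
    then obtain t where t: "t \<in> {a..b}" "\<And>j. j \<in> J \<Longrightarrow> 0 \<le> \<phi> j t x" by blast
    show "\<forall>k::nat. \<exists>r::rat. of_rat r \<in> {a..b} \<and> (\<forall>j\<in>J. - (1 / real (Suc k)) < \<phi> j (of_rat r) x)"
    proof
      fix k :: nat
      let ?e = "1 / real (Suc k)"
      have "\<forall>\<^sub>F s in at t within {a..b}. - ?e < \<phi> j s x" if j: "j \<in> J" for j
      proof (rule order_tendstoD(1))
        show "((\<lambda>s. \<phi> j s x) \<longlongrightarrow> \<phi> j t x) (at t within {a..b})"
          using cont[OF j x] t(1) by (auto simp: continuous_on_def)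
        show "- ?e < \<phi> j t x" using t(2)[OF j] by (simp add: less_le_trans[of _ 0])
      qed
      then have "\<forall>\<^sub>F s in at t within {a..b}. \<forall>j\<in>J. - ?e < \<phi> j s x"
        using J by (intro eventually_ball_finite) auto
      then obtain d where d: "d > 0" "\<And>s. s \<in> {a..b} \<Longrightarrow> s \<noteq> t \<Longrightarrow> dist s t < d \<Longrightarrow> \<forall>j\<in>J. - ?e < \<phi> j s x"
        unfolding eventually_at by blast
      have "max a (t - d) < min b (t + d)" using t(1) ab d(1) by auto
      then obtain r where r: "max a (t - d) < of_rat r" "of_rat r < min b (t + d)"
        using of_rat_dense by blast
      have "\<forall>j\<in>J. - ?e < \<phi> j (of_rat r) x"
      proof (cases "of_rat r = t")
        case True
        then show ?thesis using t(2) by (auto simp: less_le_trans[of _ 0])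
      next
        case False
        then show ?thesis using r by (intro d(2)) (auto simp: dist_real_def)
      qed
      then show "\<exists>r::rat. of_rat r \<in> {a..b} \<and> (\<forall>j\<in>J. - ?e < \<phi> j (of_rat r) x)" using r by (intro exI[of _ r]) auto
    qed
  next
    assume "\<forall>k::nat. \<exists>r::rat. of_rat r \<in> {a..b} \<and> (\<forall>j\<in>J. - (1 / real (Suc k)) < \<phi> j (of_rat r) x)"
    then obtain r where r: "\<And>k. of_rat (r k) \<in> {a..b}" "\<And>k j. j \<in> J \<Longrightarrow> - (1 / real (Suc k)) < \<phi> j (of_rat (r k)) x"
      by metis
    then obtain t \<sigma> where t: "t \<in> {a..b}" "strict_mono \<sigma>" "((\<lambda>k. of_rat (r k)) \<circ> \<sigma>) \<longlonglongrightarrow> t"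
      using compact_Icc[of a b, unfolded compact_def, rule_format, of "\<lambda>k. of_rat (r k)"] by blast
    have "0 \<le> \<phi> j t x" if j: "j \<in> J" for j
    proof (rule LIMSEQ_le)
      have "(\<lambda>k. - (1 / real (Suc k))) \<longlonglongrightarrow> - 0"
        by (intro tendsto_minus lim_inverse_n'[THEN LIMSEQ_Suc])
      from LIMSEQ_subseq_LIMSEQ[OF this t(2)] show "((\<lambda>k. - (1 / real (Suc k))) \<circ> \<sigma>) \<longlonglongrightarrow> 0" by simp
      show "((\<lambda>s. \<phi> j s x) \<circ> ((\<lambda>k. of_rat (r k)) \<circ> \<sigma>)) \<longlonglongrightarrow> \<phi> j t x"
        using cont[OF j x] t r unfolding continuous_on_sequentially by (auto simp: comp_def)
      show "\<exists>N. \<forall>k\<ge>N. ((\<lambda>k. - (1 / real (Suc k))) \<circ> \<sigma>) k \<le> ((\<lambda>s. \<phi> j s x) \<circ> ((\<lambda>k. of_rat (r k)) \<circ> \<sigma>)) k"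
        using r(2)[OF j] by (auto intro: less_imp_le)
    qed
    then show "\<exists>t\<in>{a..b}. \<forall>j\<in>J. 0 \<le> \<phi> j t x" using t(1) by blast
  qed
  note meas[measurable]
  have "{x \<in> space M. \<exists>t\<in>{a..b}. \<forall>j\<in>J. 0 \<le> \<phi> j t x} =
      {x \<in> space M. \<forall>k::nat. \<exists>r::rat. of_rat r \<in> {a..b} \<and> (\<forall>j\<in>J. - (1 / real (Suc k)) < \<phi> j (of_rat r) x)}"
    using eq by auto
  also have "\<dots> \<in> sets M" using J by measurable
  finally show ?thesis .
next
  case False
  note meas[measurable]
  have "{x \<in> space M. \<exists>t\<in>{a..b}. \<forall>j\<in>J. 0 \<le> \<phi> j t x} = {x \<in> space M. a = b \<and> (\<forall>j\<in>J. 0 \<le> \<phi> j a x)}"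
    using False by (cases "a = b") auto
  also have "\<dots> \<in> sets M" using J by measurable
  finally show ?thesis .
qed

text \<open>Within a step of length \<open>h\<close> the shift \<open>s j\<close> rises at most to
  \<open>m j\<close>, so noise visited for the first time lies in a slightly larger box but not in
  the current one. By the exponential law the enlargement multiplies the mass of the box by at most
  \<open>exp ((exp h - 1) * z u)\<close>, so the new mass is a small multiple of the current mass,
  the product in the integrand.\<close>

lemma entry_probability:
  fixes J :: "nat set" and \<alpha> \<beta> \<sigma> :: "nat \<Rightarrow> real" and A S a b :: real
  defines "P \<equiv> PiM J (\<lambda>_. expo)"
    and "s \<equiv> (\<lambda>j t. \<beta> j * exp t + \<alpha> j * exp (- t) + \<sigma> j)"
  assumes J: "finite J" and ab: "a \<le> b"
    and \<alpha>: "\<And>j. j \<in> J \<Longrightarrow> \<bar>\<alpha> j\<bar> \<le> A" and \<beta>: "\<And>j. j \<in> J \<Longrightarrow> \<bar>\<beta> j\<bar> \<le> A"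
    and \<sigma>: "\<And>j. j \<in> J \<Longrightarrow> \<bar>\<sigma> j\<bar> \<le> S"
  shows "emeasure P {x \<in> space P. (\<exists>t\<in>{a..b}. \<forall>j\<in>J. 0 \<le> x j + s j t) \<and> \<not> (\<forall>j\<in>J. 0 \<le> x j + s j a)}
    \<le> (\<integral>\<^sup>+t. ennreal (2 * (\<Sum>j\<in>J. max 0 (- s j t) + S + 2 * A) * (\<Prod>j\<in>J. min 1 (exp (s j t))))
          * indicator {a..b} t \<partial>lborel)"
proof -
  interpret P: prob_space P unfolding P_def by (intro prob_space_PiM prob_space_expo)
  define z where "z t = (\<Sum>j\<in>J. max 0 (- s j t) + S + 2 * A)" for t
  define Q where "Q t = (\<Prod>j\<in>J. min 1 (exp (s j t)))" for t
  define \<rho> where "\<rho> t = 2 * z t * Q t" for t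
  define V where "V v = {x \<in> space P. \<exists>t\<in>{a..v}. \<forall>j\<in>J. 0 \<le> x j + s j t}" for v
  define Box where "Box r = {x \<in> space P. \<forall>j\<in>J. 0 \<le> x j + r j}" for r
  define F where "F v = measure P (V v)" for v
  have cs: "continuous_on T (s j)" for T j unfolding s_def by (intro continuous_intros)
  have cz: "continuous_on T z" for T unfolding z_def by (intro continuous_intros cs)
  have cQ: "continuous_on T Q" for T unfolding Q_def by (intro continuous_intros cs)
  have c\<rho>: "continuous_on T \<rho>" for T unfolding \<rho>_def by (intro continuous_intros cz cQ)
  have z0: "0 \<le> z t" for t unfolding z_def
  proof (intro sum_nonneg)
    fix j assume "j \<in> J"
    with \<alpha>[of j] \<sigma>[of j] show "0 \<le> max 0 (- s j t) + S + 2 * A" by linarith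
  qed
  have Q0: "0 \<le> Q t" for t unfolding Q_def by (intro prod_nonneg) auto
  have Vm: "V v \<in> sets P" for v
    unfolding V_def
    by (rule visited_measurable[OF J]) (auto simp: P_def intro!: continuous_intros cs)
  have Bm: "Box r \<in> sets P" for r
    unfolding Box_def P_def using J by measurable
  have mB: "measure P (Box r) = (\<Prod>j\<in>J. min 1 (exp (r j)))" for r
    unfolding Box_def P_def measure_def emeasure_expo_box(1)[OF J] by (simp add: prod_nonneg)
  have "bounded (z ` {a..b})" by (intro compact_imp_bounded compact_continuous_image cz) simp
  then obtain Z where Z: "\<And>t. t \<in> {a..b} \<Longrightarrow> z t \<le> Z"
    unfolding bounded_real by (meson abs_le_D1 imageI)
  have Z0: "0 \<le> Z" using z0[of a] Z[of a] ab by auto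
  have step: "F v - F u \<le> (v - u) * \<rho> u"
    if uv: "a \<le> u" "u \<le> v" "v \<le> b" "v - u \<le> 1 / (4 + 5 * Z)" for u v
  proof -
    define h where "h = v - u"
    define m where "m j = s j u + (exp h - 1) * (\<bar>s j u - \<sigma> j\<bar> + 2 * A)" for j
    have eh: "0 \<le> exp h - 1" using uv by (simp add: h_def)
    have A0: "0 \<le> A" if "j \<in> J" for j using \<alpha>[OF that] by linarith
    have le_m: "s j t \<le> m j" if "j \<in> J" "t \<in> {u..v}" for j t
    proof -
      have "s j t - s j u \<le> (exp (t - u) - 1) * (\<bar>s j u - \<sigma> j\<bar> + 2 * A)"
        using exp_pair_increment[of "\<alpha> j" A "\<beta> j" u t] \<alpha>[OF that(1)] \<beta>[OF that(1)] that(2)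
        unfolding s_def by (simp add: algebra_simps)
      also have "\<dots> \<le> (exp h - 1) * (\<bar>s j u - \<sigma> j\<bar> + 2 * A)"
        using that A0[OF that(1)] by (intro mult_right_mono) (auto simp: h_def)
      finally show ?thesis by (simp add: m_def)
    qed
    have "V v \<subseteq> V u \<union> (Box m - Box (\<lambda>j. s j u))"
    proof
      fix x assume "x \<in> V v"
      then obtain t where x: "x \<in> space P" and t: "t \<in> {a..v}" "\<forall>j\<in>J. 0 \<le> x j + s j t"
        by (auto simp: V_def)
      show "x \<in> V u \<union> (Box m - Box (\<lambda>j. s j u))"
      proof (cases "x \<in> V u")
        case False
        then have "\<not> t \<le> u" using x t by (auto simp: V_def)
        then have "t \<in> {u..v}" using t by auto
        then have "x \<in> Box m" using le_m t x by (fastforce simp: Box_def)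
        moreover have "x \<notin> Box (\<lambda>j. s j u)" using False uv x by (auto simp: Box_def V_def)
        ultimately show ?thesis by simp
      qed simp
    qed
    then have "F v \<le> measure P (V u \<union> (Box m - Box (\<lambda>j. s j u)))"
      unfolding F_def using Vm Bm by (intro P.finite_measure_mono) auto
    also have "\<dots> \<le> F u + measure P (Box m - Box (\<lambda>j. s j u))"
      unfolding F_def using Vm Bm by (intro measure_Un_le) auto
    also have "measure P (Box m - Box (\<lambda>j. s j u)) = measure P (Box m) - Q u"
    proof -
      have "Box (\<lambda>j. s j u) \<subseteq> Box m" using le_m[of _ u] uv by (force simp: Box_def)
      then show ?thesis using Bm by (subst P.finite_measure_Diff) (auto simp: mB Q_def)
    qed
    finally have Fv: "F v - F u \<le> measure P (Box m) - Q u" by simp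
    \<comment> \<open>A coordinate with \<open>s j u \<ge> 0\<close> already has full mass. For a
      negative one the exponential part \<open>s j u - \<sigma> j\<close> is at most
      \<open>- s j u + S\<close> in absolute value: fast motion occurs only far below zero, a gap
      that the noise has to exceed anyway.\<close>
    have "min 1 (exp (m j)) \<le> exp ((exp h - 1) * (max 0 (- s j u) + S + 2 * A)) * min 1 (exp (s j u))"
      if j: "j \<in> J" for j
    proof (cases "0 \<le> s j u")
      case True
      have "0 \<le> (exp h - 1) * (max 0 (- s j u) + S + 2 * A)"
        using A0[OF j] \<sigma>[OF j] eh by (intro mult_nonneg_nonneg) auto
      then show ?thesis using True by (simp add: min_def)
    next
      case False
      then have "\<bar>s j u - \<sigma> j\<bar> \<le> max 0 (- s j u) + S" using \<sigma>[OF j] by linarith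
      then have "m j \<le> s j u + (exp h - 1) * (max 0 (- s j u) + S + 2 * A)"
        unfolding m_def using eh by (intro add_left_mono mult_left_mono) auto
      then have "exp (m j) \<le> exp (s j u) * exp ((exp h - 1) * (max 0 (- s j u) + S + 2 * A))"
        unfolding exp_add[symmetric] by simp
      moreover have "min 1 (exp (s j u)) = exp (s j u)" using False by simp
      ultimately show ?thesis by (metis min.coboundedI2 mult.commute)
    qed
    then have "measure P (Box m) \<le> (\<Prod>j\<in>J. exp ((exp h - 1) * (max 0 (- s j u) + S + 2 * A)) * min 1 (exp (s j u)))"
      unfolding mB by (intro prod_mono) auto
    also have "\<dots> = exp ((exp h - 1) * z u) * Q u"
      by (simp only: prod.distrib Q_def z_def exp_sum[OF J] sum_distrib_left)
    finally have "F v - F u \<le> (exp ((exp h - 1) * z u) - 1) * Q u" using Fv by (simp add: algebra_simps)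
    also have "\<dots> \<le> (2 * h * z u) * Q u"
      using uv Z[of u] by (intro mult_right_mono exp_minus_one_double[of h Z] Q0 z0) (auto simp: h_def)
    finally show ?thesis by (simp add: \<rho>_def h_def mult_ac)
  qed
  have "F b - F a \<le> integral {a..b} \<rho>"
    using Z0 by (intro increment_le_integral[OF ab c\<rho> _ step]) auto
  moreover have "V a \<subseteq> V b" using ab by (auto simp: V_def)
  ultimately have "measure P (V b - V a) \<le> integral {a..b} \<rho>"
    using Vm by (subst P.finite_measure_Diff) (auto simp: F_def)
  then have "emeasure P (V b - V a) \<le> ennreal (integral {a..b} \<rho>)"
    by (simp add: P.emeasure_eq_measure ennreal_leI)
  also have "ennreal (integral {a..b} \<rho>) = (\<integral>\<^sup>+t. ennreal (\<rho> t) * indicator {a..b} t \<partial>lborel)"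
  proof -
    have "(\<rho> has_integral integral {a..b} \<rho>) {a..b}"
      by (intro integrable_integral integrable_continuous_interval c\<rho>)
    then have i: "((\<lambda>t. if t \<in> {a..b} then \<rho> t else 0) has_integral integral {a..b} \<rho>) UNIV"
      by (simp only: has_integral_restrict_UNIV)
    have m: "\<rho> \<in> borel_measurable borel" by (intro borel_measurable_continuous_onI c\<rho>)
    have "(\<integral>\<^sup>+t. ennreal (if t \<in> {a..b} then \<rho> t else 0) \<partial>lborel) = ennreal (integral {a..b} \<rho>)"
    proof (rule nn_integral_has_integral_lborel[OF _ _ i])
      show "(\<lambda>t. if t \<in> {a..b} then \<rho> t else 0) \<in> borel_measurable borel" using m by measurable
      show "0 \<le> (if t \<in> {a..b} then \<rho> t else 0)" for t using z0[of t] Q0[of t] by (simp add: \<rho>_def)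
    qed
    moreover have "(\<integral>\<^sup>+t. ennreal (if t \<in> {a..b} then \<rho> t else 0) \<partial>lborel)
        = (\<integral>\<^sup>+t. ennreal (\<rho> t) * indicator {a..b} t \<partial>lborel)"
      by (intro nn_integral_cong) (simp add: indicator_def)
    ultimately show ?thesis by simp
  qed
  also have "V b - V a = {x \<in> space P. (\<exists>t\<in>{a..b}. \<forall>j\<in>J. 0 \<le> x j + s j t) \<and> \<not> (\<forall>j\<in>J. 0 \<le> x j + s j a)}"
    by (auto simp: V_def)
  finally show ?thesis unfolding \<rho>_def z_def Q_def .
qed

section \<open>Expected number of cones entered\<close>

locale bounded_coord_subspace = coord_subspace +
  fixes \<kappa> :: real and d :: nat
  assumes fund_le: "cobasis N \<Longrightarrow> j \<in> N \<Longrightarrow> \<bar>fund N j k\<bar> \<le> \<kappa>"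
    and card_cobasis: "cobasis N \<Longrightarrow> card N = d"
    and kappa_ge_1: "1 \<le> \<kappa>"
begin

lemma rcost_abs_le:
  assumes "cobasis N" "j \<in> N"
  shows "\<bar>rcost N c j\<bar> \<le> \<kappa> * (\<Sum>i<n. \<bar>c i\<bar>)"
proof -
  have "\<bar>rcost N c j\<bar> \<le> (\<Sum>i<n. \<bar>c i * fund N j i\<bar>)" unfolding rcost_def pair_def by (rule sum_abs)
  also have "\<dots> \<le> (\<Sum>i<n. \<kappa> * \<bar>c i\<bar>)"
  proof (intro sum_mono)
    fix i
    show "\<bar>c i * fund N j i\<bar> \<le> \<kappa> * \<bar>c i\<bar>"
      using mult_left_mono[OF fund_le[OF assms, of i], of "\<bar>c i\<bar>"] by (simp add: abs_mult mult.commute)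
  qed
  finally show ?thesis by (simp add: sum_distrib_left)
qed

text \<open>The noise \<open>X j\<close> enters the reduced cost of \<open>j\<close> with
  coefficient one and no other reduced cost of \<open>N\<close>. Given the coordinates outside
  \<open>N\<close>, the reduced costs are therefore independent shifted exponentials.\<close>

lemma rcost_split:
  assumes "cobasis N" "j \<in> N"
  shows "rcost N X j = X j + (\<Sum>k\<in>{..<n} - N. X k * fund N j k)"
proof -
  have "rcost N X j = (\<Sum>k\<in>N. X k * fund N j k) + (\<Sum>k\<in>{..<n} - N. X k * fund N j k)"
    unfolding rcost_def pair_def using cobasis_subset[OF assms(1)]
    by (subst sum.subset_diff[of N "{..<n}"]) (auto simp: add.commute)
  also have "(\<Sum>k\<in>N. X k * fund N j k) = (\<Sum>k\<in>N. if k = j then X j else 0)"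
    using assms by (intro sum.cong) (auto simp: fund_delta)
  finally show ?thesis using assms cobasis_finite[OF assms(1)] by simp
qed

section \<open>The shadow curve and the cones it enters\<close>

definition curve :: "nat set \<Rightarrow> nat set \<Rightarrow> real \<Rightarrow> (nat \<Rightarrow> real) \<Rightarrow> nat \<Rightarrow> real" where
  "curve Na Nb t X = (\<lambda>i. indicator Nb i * exp t + indicator Na i * exp (- t) + X i)"

lemma rcost_curve:
  "rcost N (curve Na Nb t X) j = rcost N (indicator Nb) j * exp t + rcost N (indicator Na) j * exp (- t) + rcost N X j"
  by (simp only: rcost_def pair_def curve_def distrib_right sum.distrib sum_distrib_right)
    (simp only: mult_ac)

lemma rcost_indicator_le:
  assumes "cobasis N" "j \<in> N" "cobasis M"
  shows "\<bar>rcost N (indicator M) j\<bar> \<le> \<kappa> * real d"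
proof -
  have "(\<Sum>i<n. \<bar>indicator M i :: real\<bar>) = (\<Sum>i\<in>{..<n} \<inter> M. 1)"
    unfolding sum.inter_restrict[OF finite_lessThan] by (intro sum.cong) (auto simp: indicator_def)
  also have "{..<n} \<inter> M = M" using cobasis_subset[OF assms(3)] by auto
  finally show ?thesis using rcost_abs_le[OF assms(1,2), of "indicator M"] card_cobasis[OF assms(3)] by simp
qed

abbreviation "noise \<equiv> PiM {..<n} (\<lambda>_. expo)"

text \<open>A bound, valid inside the cone of any basis, for the sum of speeds in
  \<open>entry_probability\<close>. The first summand collects the noise in the \<open>d\<close>
  reduced costs, the second the terms \<open>2 * A\<close> with
  \<open>A = \<kappa> * d\<close>.\<close>

definition weight :: "(nat \<Rightarrow> real) \<Rightarrow> real" where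
  "weight X = real d * \<kappa> * (\<Sum>i<n. \<bar>X i\<bar>) + 2 * real d * (\<kappa> * real d)"

text \<open>An event for each basis, so a basis counts once however often the curve returns to its
  cone.\<close>

definition entering :: "nat set \<Rightarrow> nat set \<Rightarrow> real \<Rightarrow> real \<Rightarrow> nat set \<Rightarrow> (nat \<Rightarrow> real) set" where
  "entering Na Nb a b N = {X \<in> space noise. (\<exists>t\<in>{a..b}. dual_feasible (curve Na Nb t X) N) \<and>
     \<not> dual_feasible (curve Na Nb a X) N}"

definition strict_cone :: "nat set \<Rightarrow> nat set \<Rightarrow> real \<Rightarrow> nat set \<Rightarrow> (nat \<Rightarrow> real) set" where
  "strict_cone Na Nb t N = {X \<in> space noise. \<forall>j\<in>N. 0 < rcost N (curve Na Nb t X) j}"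

lemma rcost_measurable[measurable]: "(\<lambda>X. rcost N X j) \<in> borel_measurable noise"
  unfolding rcost_def pair_def by measurable

lemma strict_cone_measurable:
  assumes "cobasis N" shows "strict_cone Na Nb t N \<in> sets noise"
  unfolding strict_cone_def rcost_curve using cobasis_finite[OF assms] by measurable

lemma entering_measurable:
  assumes "cobasis N" shows "entering Na Nb a b N \<in> sets noise"
proof -
  have "{X \<in> space noise. \<exists>t\<in>{a..b}. \<forall>j\<in>N. 0 \<le> rcost N (curve Na Nb t X) j} \<in> sets noise"
    unfolding rcost_curve
    by (rule visited_measurable[OF cobasis_finite[OF assms]]) (auto intro!: continuous_intros)
  moreover have "{X \<in> space noise. \<forall>j\<in>N. 0 \<le> rcost N (curve Na Nb a X) j} \<in> sets noise"
    unfolding rcost_curve using cobasis_finite[OF assms] by measurable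
  ultimately have "{X \<in> space noise. \<exists>t\<in>{a..b}. \<forall>j\<in>N. 0 \<le> rcost N (curve Na Nb t X) j} -
      {X \<in> space noise. \<forall>j\<in>N. 0 \<le> rcost N (curve Na Nb a X) j} \<in> sets noise"
    by (rule sets.Diff)
  also have "{X \<in> space noise. \<exists>t\<in>{a..b}. \<forall>j\<in>N. 0 \<le> rcost N (curve Na Nb t X) j} -
      {X \<in> space noise. \<forall>j\<in>N. 0 \<le> rcost N (curve Na Nb a X) j} = entering Na Nb a b N"
    by (auto simp: entering_def dual_feasible_def)
  finally show ?thesis .
qed

lemma weight_measurable[measurable]: "weight \<in> borel_measurable noise"
  unfolding weight_def[abs_def] by measurable

text \<open>Conditioned on the noise outside \<open>N\<close>, the event is the one of
  \<open>entry_probability\<close>. Integrating back turns the product of coordinate masses into the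
  probability of the open cone. The existential form hides the conditional rate and keeps what the
  summation over cones uses.\<close>

lemma entering_rate:
  assumes N: "cobasis N" and Na: "cobasis Na" and Nb: "cobasis Nb" and ab: "a \<le> b"
  shows "\<exists>\<phi>. \<phi> \<in> borel_measurable lborel \<and>
    emeasure noise (entering Na Nb a b N) \<le> (\<integral>\<^sup>+t. \<phi> t * indicator {a..b} t \<partial>lborel) \<and>
    (\<forall>t. \<phi> t \<le> (\<integral>\<^sup>+X. ennreal (2 * weight X) * indicator (strict_cone Na Nb t N) X \<partial>noise))"
proof -
  define B where "B = {..<n} - N"
  define A where "A = \<kappa> * real d"
  note subN = cobasis_subset[OF N] and finN = cobasis_finite[OF N]
  have BN: "B \<inter> N = {}" "finite B" "B \<union> N = {..<n}" using subN by (auto simp: B_def)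
  define PB where "PB = PiM B (\<lambda>_. expo)"
  define PN where "PN = PiM N (\<lambda>_. expo)"
  define \<sigma> where "\<sigma> x j = (\<Sum>k\<in>B. x k * fund N j k)" for x j
  define S where "S x = \<kappa> * (\<Sum>k\<in>B. \<bar>x k\<bar>)" for x :: "nat \<Rightarrow> real"
  define \<alpha> where "\<alpha> j = rcost N (indicator Na) j" for j
  define \<beta> where "\<beta> j = rcost N (indicator Nb) j" for j
  define s where "s x j t = \<beta> j * exp t + \<alpha> j * exp (- t) + \<sigma> x j" for x j t
  define \<rho> where "\<rho> x t = 2 * (\<Sum>j\<in>N. max 0 (- s x j t) + S x + 2 * A) * (\<Prod>j\<in>N. min 1 (exp (s x j t)))" for x t
  define H where "H t X = ennreal (2 * weight X) * indicator (strict_cone Na Nb t N) X" for t X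
  let ?m = "\<lambda>x y. merge B N (x, y)"
  have \<sigma>: "\<bar>\<sigma> x j\<bar> \<le> S x" if "j \<in> N" for x j
  proof -
    have "\<bar>\<sigma> x j\<bar> \<le> (\<Sum>k\<in>B. \<bar>x k * fund N j k\<bar>)" unfolding \<sigma>_def by (rule sum_abs)
    also have "\<dots> \<le> (\<Sum>k\<in>B. \<kappa> * \<bar>x k\<bar>)"
    proof (intro sum_mono)
      fix k
      show "\<bar>x k * fund N j k\<bar> \<le> \<kappa> * \<bar>x k\<bar>"
        using mult_left_mono[OF fund_le[OF N that, of k], of "\<bar>x k\<bar>"] by (simp add: abs_mult mult.commute)
    qed
    finally show ?thesis by (simp add: S_def sum_distrib_left)
  qed
  have rm: "rcost N (curve Na Nb t (?m x y)) j = y j + s x j t" if "j \<in> N" for x y j t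
  proof -
    have "(\<Sum>k\<in>{..<n} - N. ?m x y k * fund N j k) = \<sigma> x j"
      unfolding \<sigma>_def B_def[symmetric] using BN by (intro sum.cong) auto
    moreover have "?m x y j = y j" using that BN by (auto simp: merge_def)
    ultimately show ?thesis
      unfolding rcost_curve rcost_split[OF N that, of "?m x y"] s_def \<alpha>_def \<beta>_def by simp
  qed
  have msp: "?m x y \<in> space noise" if "x \<in> space PB" "y \<in> space PN" for x y
    unfolding space_PiM space_expo PiE_UNIV_domain PiE_def BN(3)[symmetric] by simp
  interpret PB: prob_space PB unfolding PB_def by (intro prob_space_PiM prob_space_expo)
  interpret PL: pair_sigma_finite PB lborel
    by (intro pair_sigma_finite.intro PB.sigma_finite_measure_axioms lborel.sigma_finite_measure_axioms)
  have sm: "(\<lambda>x. s (fst x) j (snd x)) \<in> borel_measurable (PB \<Otimes>\<^sub>M lborel)" for j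
    unfolding s_def \<sigma>_def PB_def by measurable
  have Sm: "S \<in> borel_measurable PB" unfolding S_def[abs_def] PB_def by measurable
  have \<rho>m: "(\<lambda>x. \<rho> (fst x) (snd x)) \<in> borel_measurable (PB \<Otimes>\<^sub>M lborel)"
    unfolding \<rho>_def using sm Sm by measurable
  define \<phi> where "\<phi> t = (\<integral>\<^sup>+x. ennreal (\<rho> x t) \<partial>PB)" for t
  have \<phi>m: "\<phi> \<in> borel_measurable lborel"
  proof -
    have "(\<lambda>(t, x). ennreal (\<rho> x t)) \<in> borel_measurable (lborel \<Otimes>\<^sub>M PB)"
      using measurable_compose[OF measurable_pair_swap' \<rho>m] by (simp add: case_prod_beta')
    then show ?thesis unfolding \<phi>_def[abs_def] by (rule PB.borel_measurable_nn_integral)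
  qed
  have inner: "(\<integral>\<^sup>+y. indicator (entering Na Nb a b N) (?m x y) \<partial>PN)
      \<le> (\<integral>\<^sup>+t. ennreal (\<rho> x t) * indicator {a..b} t \<partial>lborel)" if x: "x \<in> space PB" for x
  proof -
    let ?E = "{y \<in> space PN. (\<exists>t\<in>{a..b}. \<forall>j\<in>N. 0 \<le> y j + s x j t) \<and> \<not> (\<forall>j\<in>N. 0 \<le> y j + s x j a)}"
    have "(\<integral>\<^sup>+y. indicator (entering Na Nb a b N) (?m x y) \<partial>PN) = (\<integral>\<^sup>+y. indicator ?E y \<partial>PN)"
      using msp[OF x] by (intro nn_integral_cong) (auto simp: indicator_def entering_def dual_feasible_def rm)
    also have "\<dots> = emeasure PN ?E"
    proof (rule nn_integral_indicator)
      have V: "{y \<in> space PN. \<exists>t\<in>{a..b}. \<forall>j\<in>N. 0 \<le> y j + s x j t} \<in> sets PN"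
        by (rule visited_measurable[OF finN]) (auto simp: PN_def s_def intro!: continuous_intros)
      have W: "{y \<in> space PN. \<forall>j\<in>N. 0 \<le> y j + s x j a} \<in> sets PN"
        unfolding PN_def using finN by measurable
      have "?E = {y \<in> space PN. \<exists>t\<in>{a..b}. \<forall>j\<in>N. 0 \<le> y j + s x j t} - {y \<in> space PN. \<forall>j\<in>N. 0 \<le> y j + s x j a}"
        by auto
      then show "?E \<in> sets PN" using sets.Diff[OF V W] by simp
    qed
    also have "\<dots> \<le> (\<integral>\<^sup>+t. ennreal (\<rho> x t) * indicator {a..b} t \<partial>lborel)"
      unfolding PN_def \<rho>_def s_def
      by (rule entry_probability[OF finN ab])
         (auto simp: \<alpha>_def \<beta>_def A_def \<sigma> intro: rcost_indicator_le[OF N _ Na] rcost_indicator_le[OF N _ Nb])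
    finally show ?thesis .
  qed
  have "emeasure noise (entering Na Nb a b N) = (\<integral>\<^sup>+X. indicator (entering Na Nb a b N) X \<partial>noise)"
    using entering_measurable[OF N] by simp
  also have "\<dots> = (\<integral>\<^sup>+x. (\<integral>\<^sup>+y. indicator (entering Na Nb a b N) (?m x y) \<partial>PN) \<partial>PB)"
    unfolding PN_def PB_def BN(3)[symmetric] using BN finN entering_measurable[OF N]
    by (intro expo_prod.product_nn_integral_fold) auto
  also have "\<dots> \<le> (\<integral>\<^sup>+x. (\<integral>\<^sup>+t. ennreal (\<rho> x t) * indicator {a..b} t \<partial>lborel) \<partial>PB)"
    by (intro nn_integral_mono inner)
  also have "\<dots> = (\<integral>\<^sup>+t. (\<integral>\<^sup>+x. ennreal (\<rho> x t) * indicator {a..b} t \<partial>PB) \<partial>lborel)"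
    by (rule PL.Fubini'[symmetric]) (use \<rho>m in \<open>simp add: case_prod_beta'\<close>)
  also have "\<dots> = (\<integral>\<^sup>+t. \<phi> t * indicator {a..b} t \<partial>lborel)"
  proof (intro nn_integral_cong)
    fix t
    have "(\<lambda>x. \<rho> x t) \<in> borel_measurable PB"
      using measurable_compose[OF measurable_Pair2'[of t lborel PB] \<rho>m] by simp
    then show "(\<integral>\<^sup>+x. ennreal (\<rho> x t) * indicator {a..b} t \<partial>PB) = \<phi> t * indicator {a..b} t"
      unfolding \<phi>_def by (intro nn_integral_multc) auto
  qed
  finally have E: "emeasure noise (entering Na Nb a b N) \<le> (\<integral>\<^sup>+t. \<phi> t * indicator {a..b} t \<partial>lborel)" .
  have "\<phi> t \<le> (\<integral>\<^sup>+X. H t X \<partial>noise)" for t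
  proof -
    have "ennreal (\<rho> x t) \<le> (\<integral>\<^sup>+y. H t (?m x y) \<partial>PN)" if x: "x \<in> space PB" for x
    proof -
      let ?C = "{y \<in> space PN. \<forall>j\<in>N. 0 < y j + s x j t}"
      let ?z = "\<Sum>j\<in>N. max 0 (- s x j t) + S x + 2 * A"
      have Cm: "?C \<in> sets PN" unfolding PN_def using finN by measurable
      have A0: "0 \<le> A" using kappa_ge_1 by (simp add: A_def)
      have S0: "0 \<le> S x" using kappa_ge_1 by (auto simp: S_def intro!: mult_nonneg_nonneg sum_nonneg)
      have z0: "0 \<le> ?z" using A0 S0 by (intro sum_nonneg) auto
      \<comment> \<open>The product in \<open>\<rho>\<close> is the mass of the open box, that is,
        the conditional probability of the open cone at time \<open>t\<close>.\<close>
      have "ennreal (\<rho> x t) = ennreal (2 * ?z) * emeasure PN ?C"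
        unfolding PN_def emeasure_expo_box(2)[OF finN] \<rho>_def using z0
        by (subst ennreal_mult[symmetric]) (auto intro!: prod_nonneg)
      also have "\<dots> = (\<integral>\<^sup>+y. ennreal (2 * ?z) * indicator ?C y \<partial>PN)"
        using Cm by (simp add: nn_integral_cmult_indicator)
      also have "\<dots> \<le> (\<integral>\<^sup>+y. H t (?m x y) \<partial>PN)"
      proof (intro nn_integral_mono)
        fix y assume y: "y \<in> space PN"
        show "ennreal (2 * ?z) * indicator ?C y \<le> H t (?m x y)"
        proof (cases "y \<in> ?C")
          case True
          then have "?m x y \<in> strict_cone Na Nb t N" using msp[OF x y] by (auto simp: strict_cone_def rm)
          moreover have "?z \<le> weight (?m x y)"
          proof -
            \<comment> \<open>Inside the cone \<open>y j\<close> exceeds \<open>- s x j t\<close>,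
              so the part of the speed due to the distance from zero is bounded by the
              noise.\<close>
            have "?z \<le> (\<Sum>j\<in>N. \<bar>y j\<bar> + S x + 2 * A)"
            proof (intro sum_mono add_right_mono)
              fix j assume "j \<in> N"
              then have "0 < y j + s x j t" using True by blast
              then show "max 0 (- s x j t) \<le> \<bar>y j\<bar>" by (simp add: max_def)
            qed
            also have "\<dots> = (\<Sum>j\<in>N. \<bar>y j\<bar>) + real d * (S x + 2 * A)"
              using card_cobasis[OF N] by (simp add: sum.distrib algebra_simps)
            \<comment> \<open>Unless \<open>N\<close> is empty, \<open>d * \<kappa>\<close> is at
              least one; it gives the noise on \<open>N\<close> the same coefficient as the noise on
              \<open>B\<close>.\<close>
            also have "(\<Sum>j\<in>N. \<bar>y j\<bar>) \<le> real d * \<kappa> * (\<Sum>j\<in>N. \<bar>y j\<bar>)"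
            proof (cases "N = {}")
              case False
              then have "card N > 0" using finN by (simp add: card_gt_0_iff)
              then have "1 \<le> real d" using card_cobasis[OF N] by simp
              then have "1 * 1 \<le> real d * \<kappa>" using kappa_ge_1 by (intro mult_mono) auto
              from mult_right_mono[OF this sum_nonneg[of N "\<lambda>j. \<bar>y j\<bar>"]] show ?thesis by simp
            qed simp
            finally have "?z \<le> real d * \<kappa> * ((\<Sum>j\<in>N. \<bar>y j\<bar>) + (\<Sum>k\<in>B. \<bar>x k\<bar>)) + 2 * real d * A"
              by (simp add: S_def algebra_simps)
            also have "(\<Sum>j\<in>N. \<bar>y j\<bar>) + (\<Sum>k\<in>B. \<bar>x k\<bar>) = (\<Sum>i<n. \<bar>?m x y i\<bar>)"
            proof -
              have "(\<Sum>i<n. \<bar>?m x y i\<bar>) = (\<Sum>i\<in>B. \<bar>?m x y i\<bar>) + (\<Sum>i\<in>N. \<bar>?m x y i\<bar>)"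
                unfolding BN(3)[symmetric] using BN finN by (intro sum.union_disjoint) auto
              also have "(\<Sum>i\<in>B. \<bar>?m x y i\<bar>) = (\<Sum>k\<in>B. \<bar>x k\<bar>)"
                by (intro sum.cong) (auto simp: merge_def)
              also have "(\<Sum>i\<in>N. \<bar>?m x y i\<bar>) = (\<Sum>j\<in>N. \<bar>y j\<bar>)"
                using BN by (intro sum.cong) (auto simp: merge_def)
              finally show ?thesis by simp
            qed
            finally show ?thesis by (simp add: weight_def A_def)
          qed
          ultimately show ?thesis using True by (auto simp: H_def intro!: ennreal_leI)
        qed simp
      qed
      finally show ?thesis .
    qed
    then have "\<phi> t \<le> (\<integral>\<^sup>+x. (\<integral>\<^sup>+y. H t (?m x y) \<partial>PN) \<partial>PB)"
      unfolding \<phi>_def by (intro nn_integral_mono)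
    also have "\<dots> = (\<integral>\<^sup>+X. H t X \<partial>noise)"
      unfolding PN_def PB_def BN(3)[symmetric] using BN finN
      by (intro expo_prod.product_nn_integral_fold[symmetric])
         (use strict_cone_measurable[OF N] in \<open>auto simp: H_def[abs_def]\<close>)
    finally show ?thesis .
  qed
  then show ?thesis using \<phi>m E unfolding H_def by blast
qed

section \<open>Summation over all cones\<close>

lemma prob_space_noise: "prob_space noise"
  by (intro prob_space_PiM prob_space_expo)

lemma nn_integral_noise_abs: "(\<integral>\<^sup>+X. ennreal (\<Sum>i<n. \<bar>X i\<bar>) \<partial>noise) = ennreal (real n)"
proof -
  have 1: "(\<integral>\<^sup>+X. ennreal \<bar>X i\<bar> \<partial>noise) = 1" if "i < n" for i
  proof -
    have "(\<integral>\<^sup>+X. ennreal \<bar>X i\<bar> \<partial>noise) = (\<integral>\<^sup>+x. ennreal \<bar>x\<bar> \<partial>distr noise expo (\<lambda>X. X i))"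
      using that by (subst nn_integral_distr) auto
    also have "distr noise expo (\<lambda>X. X i) = expo"
      using that by (intro distr_PiM_component prob_space_expo) auto
    finally show ?thesis by (simp add: nn_integral_expo_abs)
  qed
  have "(\<integral>\<^sup>+X. ennreal (\<Sum>i<n. \<bar>X i\<bar>) \<partial>noise) = (\<integral>\<^sup>+X. (\<Sum>i<n. ennreal \<bar>X i\<bar>) \<partial>noise)"
    by (simp add: sum_ennreal)
  also have "\<dots> = (\<Sum>i<n. \<integral>\<^sup>+X. ennreal \<bar>X i\<bar> \<partial>noise)"
    by (intro nn_integral_sum) auto
  also have "\<dots> = ennreal (real n)" using 1 by (simp add: ennreal_of_nat_eq_real_of_nat)
  finally show ?thesis .
qed

lemma nn_integral_weight:
  "(\<integral>\<^sup>+X. ennreal (2 * weight X) \<partial>noise) = ennreal (2 * (real d * \<kappa> * n + 2 * real d * (\<kappa> * real d)))"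
proof -
  interpret P: prob_space noise by (rule prob_space_noise)
  have c: "0 \<le> 2 * (real d * \<kappa>)" "0 \<le> 4 * real d * (\<kappa> * real d)" using kappa_ge_1 by auto
  have "ennreal (2 * weight X) = ennreal (2 * (real d * \<kappa>)) * ennreal (\<Sum>i<n. \<bar>X i\<bar>) + ennreal (4 * real d * (\<kappa> * real d))" for X
  proof -
    have S: "0 \<le> (\<Sum>i<n. \<bar>X i\<bar>)" by (simp add: sum_nonneg)
    have "2 * weight X = 2 * (real d * \<kappa>) * (\<Sum>i<n. \<bar>X i\<bar>) + 4 * real d * (\<kappa> * real d)"
      by (simp add: weight_def algebra_simps)
    then show ?thesis using ennreal_plus[OF mult_nonneg_nonneg[OF c(1) S] c(2)] ennreal_mult[OF c(1) S] by metis
  qed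
  then have "(\<integral>\<^sup>+X. ennreal (2 * weight X) \<partial>noise) =
      ennreal (2 * (real d * \<kappa>)) * (\<integral>\<^sup>+X. ennreal (\<Sum>i<n. \<bar>X i\<bar>) \<partial>noise) + ennreal (4 * real d * (\<kappa> * real d))"
    by (simp add: nn_integral_add nn_integral_cmult P.emeasure_space_1)
  also have "\<dots> = ennreal (2 * (real d * \<kappa>) * n + 4 * real d * (\<kappa> * real d))"
    unfolding nn_integral_noise_abs using ennreal_mult[OF c(1), of n]
      ennreal_plus[OF mult_nonneg_nonneg[OF c(1)] c(2), of n] by (metis of_nat_0_le_iff)
  finally show ?thesis by (simp add: algebra_simps)
qed

lemma finite_feasible: "finite {N. feasible q N}"
  by (rule finite_subset[OF _ finite_cobases]) (auto simp: feasible_def)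

text \<open>Uniqueness of a strictly optimal basis leaves at most one nonzero summand.\<close>

lemma sum_strict_cone_le:
  assumes "nondegenerate q"
  shows "(\<Sum>N | feasible q N. c * indicator (strict_cone Na Nb t N) X) \<le> (c :: ennreal)"
proof (cases "\<exists>N. feasible q N \<and> X \<in> strict_cone Na Nb t N")
  case True
  then obtain N where N: "feasible q N" "X \<in> strict_cone Na Nb t N" by blast
  have "X \<notin> strict_cone Na Nb t N'" if "feasible q N'" "N' \<noteq> N" for N'
  proof
    assume "X \<in> strict_cone Na Nb t N'"
    then have "dual_feasible (curve Na Nb t X) N'"
      by (auto simp: strict_cone_def dual_feasible_def intro: less_imp_le)
    then show False
      using strict_dual_feasible_unique[OF assms N(1) _ that(1)] N(2) that(2) by (auto simp: strict_cone_def)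
  qed
  then have "(\<Sum>M\<in>{N. feasible q N} - {N}. c * indicator (strict_cone Na Nb t M) X) = 0"
    by (intro sum.neutral) auto
  then show ?thesis
    using N sum.remove[OF finite_feasible[of q], of N "\<lambda>M. c * indicator (strict_cone Na Nb t M) X"] by simp
next
  case False
  then have "(\<Sum>N | feasible q N. c * indicator (strict_cone Na Nb t N) X) = 0"
    by (intro sum.neutral) auto
  then show ?thesis by simp
qed

text \<open>The rates are summed over the bases before integrating over time. At each time the open
  cones are disjoint, so the total rate is at most the expected weight, however many bases there
  are.\<close>

lemma total_entering:
  assumes nd: "nondegenerate q" and "cobasis Na" "cobasis Nb" "a \<le> b"
  shows "(\<Sum>N | feasible q N. emeasure noise (entering Na Nb a b N))
    \<le> ennreal ((b - a) * (2 * (real d * \<kappa> * n + 2 * real d * (\<kappa> * real d))))"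
proof -
  let ?F = "{N. feasible q N}"
  let ?w = "2 * (real d * \<kappa> * n + 2 * real d * (\<kappa> * real d))"
  have w0: "0 \<le> ?w" using kappa_ge_1 by auto
  have cb: "cobasis N" if "N \<in> ?F" for N using that by (simp add: feasible_def)
  define rate where "rate N \<phi> \<longleftrightarrow> \<phi> \<in> borel_measurable lborel \<and>
    emeasure noise (entering Na Nb a b N) \<le> (\<integral>\<^sup>+t. \<phi> t * indicator {a..b} t \<partial>lborel) \<and>
    (\<forall>t. \<phi> t \<le> (\<integral>\<^sup>+X. ennreal (2 * weight X) * indicator (strict_cone Na Nb t N) X \<partial>noise))" for N \<phi>
  define \<phi> where "\<phi> N = (SOME \<phi>. rate N \<phi>)" for N
  have rate: "rate N (\<phi> N)" if "N \<in> ?F" for N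
    unfolding \<phi>_def by (rule someI_ex[where P = "rate N"]) (unfold rate_def, rule entering_rate[OF cb[OF that] assms(2-4)])
  have \<phi>m: "\<phi> N \<in> borel_measurable lborel"
    and \<phi>E: "emeasure noise (entering Na Nb a b N) \<le> (\<integral>\<^sup>+t. \<phi> N t * indicator {a..b} t \<partial>lborel)"
    and \<phi>le: "\<phi> N t \<le> (\<integral>\<^sup>+X. ennreal (2 * weight X) * indicator (strict_cone Na Nb t N) X \<partial>noise)"
    if "N \<in> ?F" for N t
    using rate[OF that] by (simp_all add: rate_def)
  have "(\<Sum>N\<in>?F. \<phi> N t) \<le> ennreal ?w" for t
  proof -
    have "(\<Sum>N\<in>?F. \<phi> N t) \<le> (\<Sum>N\<in>?F. \<integral>\<^sup>+X. ennreal (2 * weight X) * indicator (strict_cone Na Nb t N) X \<partial>noise)"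
      by (intro sum_mono \<phi>le)
    also have "\<dots> = (\<integral>\<^sup>+X. (\<Sum>N\<in>?F. ennreal (2 * weight X) * indicator (strict_cone Na Nb t N) X) \<partial>noise)"
      using strict_cone_measurable[OF cb] by (intro nn_integral_sum[symmetric]) auto
    also have "\<dots> \<le> (\<integral>\<^sup>+X. ennreal (2 * weight X) \<partial>noise)"
      by (intro nn_integral_mono sum_strict_cone_le nd)
    finally show ?thesis by (simp add: nn_integral_weight)
  qed
  note total = this
  have "(\<Sum>N\<in>?F. emeasure noise (entering Na Nb a b N)) \<le> (\<Sum>N\<in>?F. \<integral>\<^sup>+t. \<phi> N t * indicator {a..b} t \<partial>lborel)"
    by (intro sum_mono \<phi>E)
  also have "\<dots> = (\<integral>\<^sup>+t. (\<Sum>N\<in>?F. \<phi> N t * indicator {a..b} t) \<partial>lborel)"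
    using \<phi>m by (intro nn_integral_sum[symmetric]) auto
  also have "\<dots> \<le> (\<integral>\<^sup>+t. ennreal ?w * indicator {a..b} t \<partial>lborel)"
    unfolding sum_distrib_right[symmetric] by (intro nn_integral_mono mult_right_mono total) auto
  also have "\<dots> = ennreal ?w * ennreal (b - a)" using assms(4) by (simp add: nn_integral_cmult_indicator)
  also have "\<dots> = ennreal ((b - a) * ?w)" using w0 assms(4) by (simp only: ennreal_mult mult.commute diff_ge_0_iff_ge)
  finally show ?thesis .
qed

section \<open>From entered cones to the pivot distance\<close>

lemma rcost_indicator_self:
  assumes "cobasis N" "j \<in> N"
  shows "rcost N (indicator N) j = 1"
proof -
  have "(\<Sum>k\<in>{..<n} - N. indicator N k * fund N j k) = 0" by (intro sum.neutral) auto
  then show ?thesis using rcost_split[OF assms, of "indicator N"] assms(2) by simp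
qed

text \<open>At time \<open>T\<close> the reduced costs of \<open>Nb\<close> contain
  \<open>exp T\<close> from its own indicator. Against it stand at most \<open>\<kappa> * n\<close>
  from the other indicator and \<open>4 * \<kappa> * n\<close> from the noise, whence the
  requirement on \<open>T\<close>. Time \<open>- T\<close> is symmetric, with \<open>Na\<close> in
  the role of \<open>Nb\<close>.\<close>

lemma pivot_dist_pointwise:
  assumes nd: "nondegenerate q" and q: "\<And>i. 0 \<le> q i" and A: "feasible q Na" and B: "feasible q Nb"
    and T: "0 \<le> T" "5 * \<kappa> * n < exp T"
    and X: "X \<in> space noise" "\<And>i. i < n \<Longrightarrow> 0 \<le> X i" "(\<Sum>i<n. \<bar>X i\<bar>) \<le> 4 * n"
  shows "pivot_dist q Na Nb \<le> card {N. feasible q N \<and> X \<in> entering Na Nb (- T) T N}"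
proof -
  have cb: "cobasis Na" "cobasis Nb" using A B by (auto simp: feasible_def)
  have dn: "real d \<le> real n" using card_cobasis[OF cb(1)] card_mono[OF _ cobasis_subset[OF cb(1)]] by simp
  have pos: "0 < exp T + c * exp (- T) + rcost N X j"
    if "cobasis N" "j \<in> N" "\<bar>c\<bar> \<le> \<kappa> * real d" for N j c
  proof -
    have "\<bar>rcost N X j\<bar> \<le> \<kappa> * (4 * n)"
      using rcost_abs_le[OF that(1,2), of X] mult_left_mono[OF X(3), of \<kappa>] kappa_ge_1 by linarith
    moreover have "\<bar>c * exp (- T)\<bar> \<le> (\<kappa> * n) * 1"
      unfolding abs_mult
    proof (intro mult_mono)
      show "\<bar>c\<bar> \<le> \<kappa> * n" using that(3) mult_left_mono[OF dn, of \<kappa>] kappa_ge_1 by linarith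
    qed (use T kappa_ge_1 in auto)
    ultimately show ?thesis using T(2) by (simp add: abs_le_iff algebra_simps)
  qed
  have "pivot_dist q Na Nb \<le> card {N. feasible q N \<and>
      (\<exists>t\<in>{- T..T}. dual_feasible (curve Na Nb t X) N) \<and> \<not> dual_feasible (curve Na Nb (- T) X) N}"
  proof (rule pivot_dist_le_visited[OF nd q _ _ _ A _ B])
    show "- T \<le> T" using T by simp
    show "continuous_on {- T..T} (\<lambda>t. curve Na Nb t X i)" for i
      unfolding curve_def by (intro continuous_intros)
    show "0 \<le> curve Na Nb t X i" if "i < n" for i t using X(2)[OF that] by (simp add: curve_def)
    show "0 < rcost Na (curve Na Nb (- T) X) j" if "j \<in> Na" for j
      unfolding rcost_curve rcost_indicator_self[OF cb(1) that]
      using pos[OF cb(1) that rcost_indicator_le[OF cb(1) that cb(2)]] by (simp add: algebra_simps)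
    show "0 < rcost Nb (curve Na Nb T X) j" if "j \<in> Nb" for j
      unfolding rcost_curve rcost_indicator_self[OF cb(2) that]
      using pos[OF cb(2) that rcost_indicator_le[OF cb(2) that cb(1)]] by (simp add: algebra_simps)
  qed
  then show ?thesis using X(1) by (simp add: entering_def)
qed

text \<open>Outside the event \<open>\<Sum>|X i| \<le> 4n\<close> the trivial estimate
  \<open>D \<le> D * \<Sum>|X i| / (4n)\<close> costs only a quarter of \<open>D\<close> in expectation.\<close>

lemma pivot_dist_bound:
  assumes nd: "nondegenerate q" and q: "\<And>i. 0 \<le> q i" and A: "feasible q Na" and B: "feasible q Nb"
    and n: "0 < n"
  shows "real (pivot_dist q Na Nb) \<le> 16 * (real d * \<kappa> * n) * ln (8 * \<kappa> * n)"
proof -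
  interpret P: prob_space noise by (rule prob_space_noise)
  \<comment> \<open>Any factor above 5 would do; 8 is absorbed as \<open>2 ^ 3\<close> when the
    logarithm is simplified.\<close>
  define T where "T = ln (8 * \<kappa> * n)"
  define D where "D = real (pivot_dist q Na Nb)"
  let ?F = "{N. feasible q N}"
  have kn: "1 \<le> \<kappa> * n" using mult_mono[of 1 \<kappa> 1 "real n"] kappa_ge_1 n by simp
  have T: "0 \<le> T" "5 * \<kappa> * n < exp T" using kn by (auto simp: T_def)
  have cb: "cobasis Na" "cobasis Nb" using A B by (auto simp: feasible_def)
  have dn: "real d \<le> real n" using card_cobasis[OF cb(1)] card_mono[OF _ cobasis_subset[OF cb(1)]] by simp
  have D0: "0 \<le> D" by (simp add: D_def)
  have em: "entering Na Nb (- T) T N \<in> sets noise" if "N \<in> ?F" for N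
    using that by (intro entering_measurable) (simp add: feasible_def)
  have "AE X in noise. \<forall>i\<in>{..<n}. 0 \<le> X i"
    using AE_expo by (intro AE_finite_allI AE_PiM_component prob_space_expo) auto
  then have "AE X in noise. ennreal D \<le> (\<Sum>N\<in>?F. indicator (entering Na Nb (- T) T N) X)
      + ennreal (D / (4 * n)) * ennreal (\<Sum>i<n. \<bar>X i\<bar>)"
    using AE_space
  proof eventually_elim
    case (elim X)
    show ?case
    proof (cases "(\<Sum>i<n. \<bar>X i\<bar>) \<le> 4 * n")
      case True
      have "(\<Sum>N\<in>?F. indicator (entering Na Nb (- T) T N) X :: ennreal) = of_nat (card {N \<in> ?F. X \<in> entering Na Nb (- T) T N})"
      proof -
        have "(\<Sum>N\<in>?F. indicator (entering Na Nb (- T) T N) X :: ennreal)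
            = (\<Sum>N\<in>?F. if X \<in> entering Na Nb (- T) T N then 1 else 0)"
          by (intro sum.cong) auto
        also have "\<dots> = (\<Sum>N\<in>{N \<in> ?F. X \<in> entering Na Nb (- T) T N}. 1)"
          by (rule sum.inter_filter[OF finite_feasible, symmetric])
        finally show ?thesis by simp
      qed
      moreover have "pivot_dist q Na Nb \<le> card {N \<in> ?F. X \<in> entering Na Nb (- T) T N}"
        using pivot_dist_pointwise[OF nd q A B T _ _ True] elim by simp
      ultimately have "ennreal D \<le> (\<Sum>N\<in>?F. indicator (entering Na Nb (- T) T N) X)"
        by (simp add: D_def ennreal_of_nat_eq_real_of_nat)
      then show ?thesis by (simp add: add_increasing2)
    next
      case False
      have "D * (4 * n) \<le> D * (\<Sum>i<n. \<bar>X i\<bar>)" using False D0 by (intro mult_left_mono) auto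
      then have "D \<le> D / (4 * n) * (\<Sum>i<n. \<bar>X i\<bar>)" using n by (simp add: field_simps)
      then have "ennreal D \<le> ennreal (D / (4 * n)) * ennreal (\<Sum>i<n. \<bar>X i\<bar>)"
        using D0 by (subst ennreal_mult[symmetric]) (auto intro!: ennreal_leI sum_nonneg)
      then show ?thesis by (simp add: add_increasing)
    qed
  qed
  then have "(\<integral>\<^sup>+X. ennreal D \<partial>noise) \<le> (\<integral>\<^sup>+X. (\<Sum>N\<in>?F. indicator (entering Na Nb (- T) T N) X)
      + ennreal (D / (4 * n)) * ennreal (\<Sum>i<n. \<bar>X i\<bar>) \<partial>noise)"
    by (rule nn_integral_mono_AE)
  also have "\<dots> = (\<Sum>N\<in>?F. emeasure noise (entering Na Nb (- T) T N)) + ennreal (D / (4 * n)) * ennreal n"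
  proof -
    have "(\<integral>\<^sup>+X. (\<Sum>N\<in>?F. indicator (entering Na Nb (- T) T N) X) \<partial>noise)
        = (\<Sum>N\<in>?F. \<integral>\<^sup>+X. indicator (entering Na Nb (- T) T N) X \<partial>noise)"
      using em by (intro nn_integral_sum) auto
    also have "\<dots> = (\<Sum>N\<in>?F. emeasure noise (entering Na Nb (- T) T N))"
      using em by (intro sum.cong refl nn_integral_indicator) auto
    finally show ?thesis
      using em by (subst nn_integral_add) (auto simp: nn_integral_cmult nn_integral_noise_abs)
  qed
  also have "ennreal (D / (4 * n)) * ennreal n = ennreal (D / 4)"
    using n D0 by (subst ennreal_mult[symmetric]) auto
  also have "(\<Sum>N\<in>?F. emeasure noise (entering Na Nb (- T) T N))
      \<le> ennreal ((T - (- T)) * (2 * (real d * \<kappa> * n + 2 * real d * (\<kappa> * real d))))"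
    using T by (intro total_entering nd cb) auto
  finally have le: "ennreal D \<le> ennreal ((T - (- T)) * (2 * (real d * \<kappa> * n + 2 * real d * (\<kappa> * real d)))) + ennreal (D / 4)"
    by (simp add: P.emeasure_space_1)
  have R: "0 \<le> (T - (- T)) * (2 * (real d * \<kappa> * n + 2 * real d * (\<kappa> * real d)))" "0 \<le> D / 4"
    using T D0 kappa_ge_1 by auto
  \<comment> \<open>Three quarters of \<open>D\<close> remain on the left; the resulting factor 3
    cancels against \<open>n + 2 * d \<le> 3 * n\<close>.\<close>
  have "D \<le> (T - (- T)) * (2 * (real d * \<kappa> * n + 2 * real d * (\<kappa> * real d))) + D / 4"
    using le unfolding ennreal_plus[OF R, symmetric] ennreal_le_iff[OF add_nonneg_nonneg[OF R]] .
  then have "3 * D \<le> 16 * T * (real d * \<kappa> * n + 2 * (real d * \<kappa> * real d))" by (simp add: algebra_simps)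
  also have "\<dots> \<le> 16 * T * (real d * \<kappa> * n + 2 * (real d * \<kappa> * n))"
    using dn kappa_ge_1 T by (intro mult_left_mono add_left_mono) auto
  finally show ?thesis by (simp add: D_def T_def algebra_simps)
qed

end

section \<open>Degeneracy\<close>

lemma eventually_poly_nonzero_at_right:
  fixes p :: "real poly"
  assumes "p \<noteq> 0"
  shows "\<forall>\<^sub>F x in at_right a. poly p x \<noteq> 0"
proof -
  have "finite {x. poly p x = 0}" by (rule poly_roots_finite[OF assms])
  then have "\<not> a islimpt {x. poly p x = 0}" by (rule islimpt_finite)
  then have "\<forall>\<^sub>F x in at a. x \<notin> {x. poly p x = 0}"
    unfolding islimpt_conv_frequently_at frequently_def by simp
  then show ?thesis by (simp add: eventually_at_split)
qed

context coord_subspace begin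

text \<open>Steinitz exchange: as long as \<open>N\<close> is not contained in \<open>M\<close>, one
  of its elements is replaced by an element of \<open>M\<close> without change of size, and nested
  cobases coincide.\<close>

lemma cobasis_card_eq:
  assumes "cobasis N" "cobasis M"
  shows "card N = card M"
  using assms(1)
proof (induction "card (N - M)" arbitrary: N rule: less_induct)
  case less
  note N = less.prems
  have fin: "finite N" "finite M" using cobasis_finite N assms(2) by auto
  show ?case
  proof (cases "N \<subseteq> M")
    case True
    have "M \<subseteq> N"
    proof
      fix j assume j: "j \<in> M"
      show "j \<in> N"
      proof (rule ccontr)
        assume "j \<notin> N"
        then have "fund M j i = 0" if "i \<in> N" for i
          using that True fund_delta[OF assms(2) j, of i] by auto
        then have "fund M j = (\<lambda>_. 0)" by (rule cobasis_zero[OF N fund_mem[OF assms(2) j]])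
        then show False using fund_delta[OF assms(2) j j] by simp
      qed
    qed
    then show ?thesis using True by simp
  next
    case False
    then obtain j where j: "j \<in> N" "j \<notin> M" by blast
    have "\<exists>k\<in>M. fund N j k \<noteq> 0"
    proof (rule ccontr)
      assume "\<not> ?thesis"
      then have "fund N j = (\<lambda>_. 0)" by (intro cobasis_zero[OF assms(2) fund_mem[OF N j(1)]]) auto
      then show False using fund_delta[OF N j(1) j(1)] by simp
    qed
    then obtain k where k: "k \<in> M" "fund N j k \<noteq> 0" by blast
    have kN: "k \<notin> N" using fund_delta[OF N j(1), of k] k j by (auto split: if_splits)
    have kn: "k < n" using cobasis_subset[OF assms(2)] k by auto
    have "insert k (N - {j}) - M \<subset> N - M" using j k by auto
    then have "card (insert k (N - {j}) - M) < card (N - M)" using fin by (intro psubset_card_mono) auto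
    then have "card (insert k (N - {j})) = card M"
      using less.hyps exchange(1)[OF N j(1) kn kN k(2)] by blast
    moreover have "card (insert k (N - {j})) = card N"
      using fin kN card.remove[OF fin(1) j(1)] by simp
    ultimately show ?thesis by simp
  qed
qed

text \<open>Perturbation along the moment curve. For \<open>k\<close> outside \<open>N\<close>,
  coordinate \<open>k\<close> of the basic solution is a polynomial in \<open>\<epsilon>\<close>
  with coefficient 1 at degree \<open>Suc k\<close>, because the indices in \<open>N\<close>
  contribute to other degrees; so it is nonzero for all small positive \<open>\<epsilon>\<close>.
  Negative coordinates stay negative by continuity, hence no new cobasis becomes feasible.\<close>

lemma perturbation_exists:
  assumes u: "\<And>i. 0 \<le> u i"
  obtains q where "\<And>i. 0 \<le> q i" "nondegenerate q" "\<And>N. feasible q N \<Longrightarrow> feasible u N"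
proof -
  \<comment> \<open>The exponents start at one, so that \<open>\<epsilon> = 0\<close> gives back
    \<open>u\<close>.\<close>
  define q where "q \<epsilon> = (\<lambda>i. u i + (if i < n then \<epsilon> ^ Suc i else 0))" for \<epsilon> :: real
  define p where "p N k = [:bsol N u k:] + monom 1 (Suc k) - (\<Sum>j\<in>N. monom (fund N j k) (Suc j))" for N k
  have poly_p: "poly (p N k) \<epsilon> = bsol N (q \<epsilon>) k" if "cobasis N" "k < n" for N k \<epsilon>
  proof -
    have "(\<Sum>j\<in>N. q \<epsilon> j * fund N j k) = (\<Sum>j\<in>N. u j * fund N j k) + (\<Sum>j\<in>N. fund N j k * \<epsilon> ^ Suc j)"
      unfolding sum.distrib[symmetric] using cobasis_subset[OF that(1)]
      by (intro sum.cong) (auto simp: q_def algebra_simps)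
    then show ?thesis using that(2)
      by (simp add: p_def bsol_def q_def poly_monom poly_sum)
  qed
  have p0: "poly (p N k) 0 = bsol N u k" for N k
    by (simp add: p_def poly_monom poly_sum)
  have nz: "p N k \<noteq> 0" if "cobasis N" "k \<notin> N" for N k
  proof -
    have "(\<Sum>j\<in>N. coeff (monom (fund N j k) (Suc j)) (Suc k)) = 0"
      using that(2) by (intro sum.neutral) auto
    then have "coeff (p N k) (Suc k) = 1" by (simp add: p_def coeff_sum)
    then show ?thesis by auto
  qed
  define S where "S = {(N, k). cobasis N \<and> k < n \<and> k \<notin> N}"
  have "finite S"
    by (rule finite_subset[of _ "{N. cobasis N} \<times> {..<n}"]) (auto simp: S_def finite_cobases)
  moreover have "\<forall>\<^sub>F \<epsilon> in at_right 0. poly (p N k) \<epsilon> \<noteq> 0 \<and> (bsol N u k < 0 \<longrightarrow> poly (p N k) \<epsilon> < 0)"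
    if "(N, k) \<in> S" for N k
  proof (intro eventually_conj)
    show "\<forall>\<^sub>F \<epsilon> in at_right 0. poly (p N k) \<epsilon> \<noteq> 0"
      using nz that by (intro eventually_poly_nonzero_at_right) (auto simp: S_def)
    show "\<forall>\<^sub>F \<epsilon> in at_right 0. bsol N u k < 0 \<longrightarrow> poly (p N k) \<epsilon> < 0"
    proof (cases "bsol N u k < 0")
      case True
      have "((poly (p N k)) \<longlongrightarrow> poly (p N k) 0) (at_right 0)" by (intro tendsto_intros)
      then show ?thesis using order_tendstoD(2)[of _ _ _ 0] True by (auto simp: p0 elim: eventually_mono)
    qed simp
  qed
  ultimately have "\<forall>\<^sub>F \<epsilon> in at_right 0. \<forall>(N, k)\<in>S. poly (p N k) \<epsilon> \<noteq> 0 \<and> (bsol N u k < 0 \<longrightarrow> poly (p N k) \<epsilon> < 0)"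
    by (intro eventually_ball_finite) auto
  then have "\<forall>\<^sub>F \<epsilon> in at_right 0. 0 < \<epsilon> \<and> (\<forall>(N, k)\<in>S. poly (p N k) \<epsilon> \<noteq> 0 \<and> (bsol N u k < 0 \<longrightarrow> poly (p N k) \<epsilon> < 0))"
    using eventually_at_right_less[of 0] by eventually_elim auto
  then have "\<exists>\<epsilon>>0. \<forall>(N, k)\<in>S. poly (p N k) \<epsilon> \<noteq> 0 \<and> (bsol N u k < 0 \<longrightarrow> poly (p N k) \<epsilon> < 0)"
    by (rule eventually_happens'[rotated]) simp
  then obtain \<epsilon> where \<epsilon>: "0 < \<epsilon>"
    "\<And>N k. (N, k) \<in> S \<Longrightarrow> poly (p N k) \<epsilon> \<noteq> 0 \<and> (bsol N u k < 0 \<longrightarrow> poly (p N k) \<epsilon> < 0)"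
    by blast
  show ?thesis
  proof (rule that[of "q \<epsilon>"])
    show "0 \<le> q \<epsilon> i" for i using u[of i] \<epsilon>(1) by (simp add: q_def)
    show "nondegenerate (q \<epsilon>)"
      unfolding nondegenerate_def
    proof (intro allI impI)
      fix N k assume N: "feasible (q \<epsilon>) N" "k < n" "k \<notin> N"
      then have "bsol N (q \<epsilon>) k \<noteq> 0" using \<epsilon>(2)[of N k] poly_p by (auto simp: S_def feasible_def)
      then show "0 < bsol N (q \<epsilon>) k" using N(1) by (auto simp: feasible_def order_less_le)
    qed
    show "feasible u N" if N: "feasible (q \<epsilon>) N" for N
      unfolding feasible_def
    proof (intro conjI allI)
      show cb: "cobasis N" using N by (simp add: feasible_def)
      fix i
      consider "i \<in> N" | "i \<notin> N" "i < n" | "n \<le> i" by linarith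
      then show "0 \<le> bsol N u i"
      proof cases
        case 2
        then have "\<not> poly (p N i) \<epsilon> < 0" using poly_p[OF cb, of i] N by (auto simp: feasible_def not_less)
        then show ?thesis using \<epsilon>(2)[of N i] cb 2 by (force simp: S_def)
      next
        case 3
        then have "(\<Sum>j\<in>N. u j * fund N j i) = 0" using vanish[OF fund_mem[OF cb]] by simp
        then show ?thesis using u[of i] by (simp add: bsol_def)
      qed (simp add: bsol_zero[OF cb])
    qed
  qed
qed

text \<open>The optimality criterion is evaluated on the perturbed right-hand side \<open>q\<close>, but the
  unperturbed slice of \<open>u\<close> already excludes rays of decreasing cost.\<close>

lemma minimiser_cobasis:
  assumes nd: "nondegenerate q" and q: "\<And>i. 0 \<le> q i" and qu: "\<And>N. feasible q N \<Longrightarrow> feasible u N"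
    and bd: "\<And>x. x \<in> slice u \<Longrightarrow> \<delta> \<le> pair c x" and v: "v \<in> slice u" "pair c v = \<delta>"
    and uniq: "\<And>x. x \<in> slice u \<Longrightarrow> pair c x = \<delta> \<Longrightarrow> x = v"
  shows "\<exists>N. feasible q N \<and> bsol N u = v"
proof -
  have "0 \<le> rcost N c j" if N: "feasible q N" and j: "j \<in> N" and f: "\<And>k. 0 \<le> fund N j k" for N j
  proof (rule ccontr)
    assume "\<not> 0 \<le> rcost N c j"
    then have r: "rcost N c j < 0" by simp
    have cb: "cobasis N" and Nu: "feasible u N" using N qu by (auto simp: feasible_def)
    \<comment> \<open>The step length at which the cost along the ray equals
      \<open>\<delta> - 1\<close>, below the lower bound \<open>\<delta>\<close>.\<close>
    define t where "t = (\<delta> - 1 - pair c (bsol N u)) / rcost N c j"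
    have t: "0 \<le> t"
      unfolding t_def using bd[OF bsol_slice[OF Nu]] r by (intro divide_nonpos_neg) auto
    have "(\<lambda>i. (bsol N u i - u i) + t * fund N j i) \<in> W"
      by (intro add_scale_mem bsol_mem fund_mem cb j)
    then have "(\<lambda>i. bsol N u i + t * fund N j i) \<in> slice u"
      using Nu f t by (auto simp: slice_def feasible_def algebra_simps)
    from bd[OF this] have "\<delta> \<le> pair c (bsol N u) + t * rcost N c j"
      by (simp add: pair_add_scale rcost_def)
    then show False using r by (simp add: t_def)
  qed
  then obtain N where N: "feasible q N" "dual_feasible c N" using optimum_exists[OF nd q] by blast
  have cb: "cobasis N" and s: "bsol N u \<in> slice u" using N qu bsol_slice by (auto simp: feasible_def)
  have "pair c (bsol N u) \<le> \<delta>" using optimal_value[OF cb N(2) v(1)] v(2) by simp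
  then have "bsol N u = v" using bd[OF s] uniq[OF s] by simp
  then show ?thesis using N by blast
qed

end

section \<open>Kernels of matrices\<close>

unbundle no vec_syntax

definition coords :: "real Matrix.vec \<Rightarrow> nat \<Rightarrow> real" where
  "coords v = (\<lambda>i. if i < dim_vec v then v $ i else 0)"

definition kernel_coords :: "real Matrix.mat \<Rightarrow> (nat \<Rightarrow> real) set" where
  "kernel_coords A = coords ` mat_kernel A"

lemma coords_index: "v \<in> carrier_vec n \<Longrightarrow> i < n \<Longrightarrow> coords v i = v $ i"
  and coords_outside: "v \<in> carrier_vec n \<Longrightarrow> n \<le> i \<Longrightarrow> coords v i = 0"
  by (auto simp: coords_def)

lemma coords_vec: "(\<And>i. n \<le> i \<Longrightarrow> w i = 0) \<Longrightarrow> coords (Matrix.vec n w) = w"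
  by (auto simp: coords_def fun_eq_iff)

lemma vec_coords: "v \<in> carrier_vec n \<Longrightarrow> Matrix.vec n (coords v) = v"
  by (auto simp: coords_def)

lemma coords_inj: "v \<in> carrier_vec n \<Longrightarrow> w \<in> carrier_vec n \<Longrightarrow> coords v = coords w \<Longrightarrow> v = w"
  by (metis vec_coords)

lemma coords_add_scale:
  "v \<in> carrier_vec n \<Longrightarrow> w \<in> carrier_vec n \<Longrightarrow> (\<lambda>i. coords w i + c * coords v i) = coords (w + c \<cdot>\<^sub>v v)"
  by (auto simp: coords_def fun_eq_iff)

locale kernel_matrix =
  fixes m n :: nat and A :: "real Matrix.mat"
  assumes A: "A \<in> carrier_mat m n"
begin

lemma kernel_carrier: "v \<in> mat_kernel A \<Longrightarrow> v \<in> carrier_vec n"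
  and kernel_mult: "v \<in> mat_kernel A \<Longrightarrow> A *\<^sub>v v = 0\<^sub>v m"
  using mat_kernelD[OF A] by auto

lemma kernel_add_scale:
  assumes "v \<in> mat_kernel A" "w \<in> mat_kernel A"
  shows "w + c \<cdot>\<^sub>v v \<in> mat_kernel A"
proof (rule mat_kernelI[OF A])
  have c: "v \<in> carrier_vec n" "w \<in> carrier_vec n" using assms kernel_carrier by auto
  then show "w + c \<cdot>\<^sub>v v \<in> carrier_vec n" by auto
  have "A *\<^sub>v (w + c \<cdot>\<^sub>v v) = A *\<^sub>v w + c \<cdot>\<^sub>v (A *\<^sub>v v)"
    using c A by (simp add: mult_add_distrib_mat_vec mult_mat_vec)
  also have "\<dots> = 0\<^sub>v m" using assms kernel_mult by (intro eq_vecI) auto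
  finally show "A *\<^sub>v (w + c \<cdot>\<^sub>v v) = 0\<^sub>v m" .
qed

lemma zero_in_kernel: "0\<^sub>v n \<in> mat_kernel A"
  by (rule mat_kernelI[OF A]) (use A in \<open>auto intro!: eq_vecI\<close>)

lemma kernel_coords_iff: "w \<in> kernel_coords A \<longleftrightarrow> (\<forall>i\<ge>n. w i = 0) \<and> Matrix.vec n w \<in> mat_kernel A"
proof
  assume "w \<in> kernel_coords A"
  then obtain v where v: "v \<in> mat_kernel A" "w = coords v" by (auto simp: kernel_coords_def)
  then show "(\<forall>i\<ge>n. w i = 0) \<and> Matrix.vec n w \<in> mat_kernel A"
    using kernel_carrier[OF v(1)] by (simp add: vec_coords coords_outside)
next
  assume "(\<forall>i\<ge>n. w i = 0) \<and> Matrix.vec n w \<in> mat_kernel A"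
  then show "w \<in> kernel_coords A" unfolding kernel_coords_def by (metis coords_vec imageI)
qed

sublocale coord_subspace n "kernel_coords A"
proof
  show "(\<lambda>_. 0) \<in> kernel_coords A"
  proof -
    have "Matrix.vec n (\<lambda>_. 0 :: real) = 0\<^sub>v n" by auto
    then show ?thesis using zero_in_kernel by (simp add: kernel_coords_iff)
  qed
next
  fix w v c assume "w \<in> kernel_coords A" "v \<in> kernel_coords A"
  then obtain x y where x: "x \<in> mat_kernel A" "w = coords x" and y: "y \<in> mat_kernel A" "v = coords y"
    by (auto simp: kernel_coords_def)
  have "(\<lambda>i. w i + c * v i) = coords (x + c \<cdot>\<^sub>v y)"
    unfolding x(2) y(2) by (rule coords_add_scale[OF kernel_carrier[OF y(1)] kernel_carrier[OF x(1)]])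
  then show "(\<lambda>i. w i + c * v i) \<in> kernel_coords A"
    unfolding kernel_coords_def using kernel_add_scale[OF y(1) x(1)] by blast
next
  fix w i assume "w \<in> kernel_coords A" "n \<le> i"
  then show "w i = 0" by (simp add: kernel_coords_iff)
qed

section \<open>Elementary vectors and the circuit imbalance of the kernel\<close>

lemma vec_supp_alt: "v \<in> carrier_vec n \<Longrightarrow> vec_supp v = {i. coords v i \<noteq> 0}"
  by (auto simp: vec_supp_def coords_def)

lemma elementary_iff:
  "g \<in> elementary_vectors n (mat_kernel A) \<longleftrightarrow> g \<in> mat_kernel A \<and> coords g \<noteq> (\<lambda>_. 0) \<and>
    (\<forall>w\<in>kernel_coords A. w \<noteq> (\<lambda>_. 0) \<longrightarrow> \<not> {i. w i \<noteq> 0} \<subset> {i. coords g i \<noteq> 0})"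
proof -
  have "coords (0\<^sub>v n) = (\<lambda>_. 0)" by (auto simp: coords_def)
  then have z: "v \<noteq> 0\<^sub>v n \<longleftrightarrow> coords v \<noteq> (\<lambda>_. 0)" if "v \<in> mat_kernel A" for v
    using coords_inj[OF kernel_carrier[OF that] zero_carrier_vec] by metis
  have "(\<exists>h\<in>mat_kernel A. h \<noteq> 0\<^sub>v n \<and> vec_supp h \<subset> vec_supp g) \<longleftrightarrow>
      (\<exists>h\<in>mat_kernel A. coords h \<noteq> (\<lambda>_. 0) \<and> {i. coords h i \<noteq> 0} \<subset> {i. coords g i \<noteq> 0})" if "g \<in> mat_kernel A"
  proof (rule bex_cong[OF refl])
    fix h assume h: "h \<in> mat_kernel A"
    show "(h \<noteq> 0\<^sub>v n \<and> vec_supp h \<subset> vec_supp g) \<longleftrightarrow>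
      (coords h \<noteq> (\<lambda>_. 0) \<and> {i. coords h i \<noteq> 0} \<subset> {i. coords g i \<noteq> 0})"
      unfolding z[OF h] vec_supp_alt[OF kernel_carrier[OF h]] vec_supp_alt[OF kernel_carrier[OF that]] ..
  qed
  then show ?thesis
    unfolding elementary_vectors_def kernel_coords_def using z by blast
qed

text \<open>Subtract the multiple of \<open>h\<close> that cancels coordinate \<open>i\<close> of
  \<open>g\<close>: the difference has strictly smaller support than \<open>g\<close>, so minimality
  makes it zero.\<close>

lemma elementary_proportional:
  assumes g: "g \<in> elementary_vectors n (mat_kernel A)" and h: "h \<in> elementary_vectors n (mat_kernel A)"
    and s: "vec_supp g = vec_supp h" and ij: "i \<in> vec_supp g" "j \<in> vec_supp g"
  shows "g $ j / g $ i = h $ j / h $ i"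
proof -
  have c: "g \<in> mat_kernel A" "h \<in> mat_kernel A" "g \<in> carrier_vec n" "h \<in> carrier_vec n"
    using g h kernel_carrier by (auto simp: elementary_iff)
  define w where "w = (\<lambda>k. coords g k + - (coords g i / coords h i) * coords h k)"
  have hi: "coords h i \<noteq> 0" and gi: "coords g i \<noteq> 0" and hj: "coords h j \<noteq> 0" using ij s c by (auto simp: vec_supp_alt)
  have w: "w \<in> kernel_coords A"
    unfolding w_def using c by (intro add_scale_mem) (auto simp: kernel_coords_def)
  have "w i = 0" using hi by (simp add: w_def)
  moreover have "{k. w k \<noteq> 0} \<subseteq> {k. coords g k \<noteq> 0}"
    using s c by (auto simp: w_def vec_supp_alt set_eq_iff)
  ultimately have "{k. w k \<noteq> 0} \<subset> {k. coords g k \<noteq> 0}" using gi by blast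
  then have "w = (\<lambda>_. 0)" using g w unfolding elementary_iff by blast
  then have "w j = 0" by simp
  then have "coords g j / coords g i = coords h j / coords h i" using hi gi by (simp add: w_def field_simps)
  moreover have "i < n" "j < n" using ij c by (auto simp: vec_supp_def)
  ultimately show ?thesis using c by (simp add: coords_index)
qed

definition ratios :: "real set" where
  "ratios = {\<bar>g $ j / g $ i\<bar> | g i j. g \<in> elementary_vectors n (mat_kernel A) \<and> i \<in> vec_supp g \<and> j \<in> vec_supp g}"

text \<open>By proportionality one representative per support yields all quotients. Finiteness is
  what gives \<open>Max\<close> in the definition of the imbalance its meaning.\<close>

lemma finite_ratios: "finite ratios"
proof -
  define rep where "rep I = (SOME g. g \<in> elementary_vectors n (mat_kernel A) \<and> vec_supp g = I)" for I
  have "ratios \<subseteq> (\<lambda>(I, i, j). \<bar>rep I $ j / rep I $ i\<bar>) ` (Pow {..<n} \<times> {..<n} \<times> {..<n})"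
  proof
    fix r assume "r \<in> ratios"
    then obtain g i j where g: "g \<in> elementary_vectors n (mat_kernel A)" "i \<in> vec_supp g" "j \<in> vec_supp g"
      and r: "r = \<bar>g $ j / g $ i\<bar>" by (auto simp: ratios_def)
    have "rep (vec_supp g) \<in> elementary_vectors n (mat_kernel A) \<and> vec_supp (rep (vec_supp g)) = vec_supp g"
      unfolding rep_def by (rule someI[where x = g]) (use g in auto)
    then have "g $ j / g $ i = rep (vec_supp g) $ j / rep (vec_supp g) $ i"
      using g by (intro elementary_proportional) auto
    moreover have "vec_supp g \<subseteq> {..<n}"
      using g(1) kernel_carrier[of g] by (auto simp: elementary_iff vec_supp_def)
    ultimately show "r \<in> (\<lambda>(I, i, j). \<bar>rep I $ j / rep I $ i\<bar>) ` (Pow {..<n} \<times> {..<n} \<times> {..<n})"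
      using g r by (intro image_eqI[of _ _ "(vec_supp g, i, j)"]) auto
  qed
  then show ?thesis by (rule finite_subset) auto
qed

text \<open>A vector of \<open>W\<close> supported inside the support of \<open>fund N j\<close>
  vanishes on \<open>N\<close> except possibly at \<open>j\<close>. It is therefore a multiple of
  \<open>fund N j\<close>, with the same support unless it is zero.\<close>

lemma fund_elementary:
  assumes N: "cobasis N" and j: "j \<in> N"
  shows "Matrix.vec n (fund N j) \<in> elementary_vectors n (mat_kernel A)"
proof -
  have f: "fund N j \<in> kernel_coords A" by (rule fund_mem[OF N j])
  have e: "coords (Matrix.vec n (fund N j)) = fund N j" using vanish[OF f] by (intro coords_vec)
  have "fund N j \<noteq> (\<lambda>_. 0)"
  proof
    assume "fund N j = (\<lambda>_. 0)"
    then show False using fund_delta[OF N j j] by simp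
  qed
  moreover have "\<not> {i. w i \<noteq> 0} \<subset> {i. fund N j i \<noteq> 0}"
    if w: "w \<in> kernel_coords A" "w \<noteq> (\<lambda>_. 0)" for w
  proof
    assume s: "{i. w i \<noteq> 0} \<subset> {i. fund N j i \<noteq> 0}"
    have "w = (\<lambda>i. w j * fund N j i)"
    proof (rule cobasis_eqI[OF N w(1) scale_mem[OF f]])
      fix i assume "i \<in> N"
      then show "w i = w j * fund N j i"
        using s fund_delta[OF N j, of i] by (cases "i = j") auto
    qed
    then have wi: "w i = w j * fund N j i" for i by (rule fun_cong)
    have "w j \<noteq> 0"
    proof
      assume "w j = 0"
      then have "w i = 0" for i using wi[of i] by (simp only: mult_zero_left)
      then show False using w(2) by blast
    qed
    then have "w i \<noteq> 0" if "fund N j i \<noteq> 0" for i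
      using wi[of i] that by (metis mult_eq_0_iff)
    then show False using s by blast
  qed
  ultimately show ?thesis unfolding elementary_iff e using f kernel_coords_iff by blast
qed

lemma kappa_alt:
  "kappa A = (if mat_kernel A = {0\<^sub>v n} \<or> mat_kernel A = carrier_vec n then 1 else Max ratios)"
  using A by (simp add: kappa_def circuit_imbalance_def ratios_def)

lemma full_kernel_cobasis:
  assumes full: "mat_kernel A = carrier_vec n" and N: "cobasis N"
  shows "N = {..<n}"
proof (rule ccontr)
  assume "N \<noteq> {..<n}"
  then obtain k where k: "k < n" "k \<notin> N" using cobasis_subset[OF N] by auto
  have e: "(\<lambda>i. if i = k then 1 else 0) \<in> kernel_coords A" using k full by (auto simp: kernel_coords_iff)
  have "(\<lambda>i. if i = k then 1 else 0 :: real) = (\<lambda>_. 0)"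
    by (rule cobasis_zero[OF N e]) (use k in auto)
  from fun_cong[OF this, of k] show False by simp
qed

text \<open>The entry at \<open>j\<close> is 1, so each nonzero entry is a quotient of two entries
  of one elementary vector. When the kernel is the full space, the dual basis consists of unit
  vectors, in accordance with the conventional value 1.\<close>

lemma fund_le_kappa:
  assumes N: "cobasis N" and j: "j \<in> N"
  shows "\<bar>fund N j k\<bar> \<le> kappa A"
proof -
  have f: "fund N j \<in> kernel_coords A" by (rule fund_mem[OF N j])
  have jj: "fund N j j = 1" using fund_delta[OF N j j] by simp
  have jn: "j < n" using cobasis_subset[OF N] j by auto
  have "Matrix.vec n (fund N j) \<noteq> 0\<^sub>v n" using jn jj by (metis index_vec index_zero_vec(1) zero_neq_one)
  then have ne: "mat_kernel A \<noteq> {0\<^sub>v n}" using f by (auto simp: kernel_coords_iff)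
  show ?thesis
  proof (cases "mat_kernel A = carrier_vec n")
    case True
    then have "N = {..<n}" using N by (rule full_kernel_cobasis)
    then show ?thesis using fund_delta[OF N j, of k] vanish[OF f, of k] True
      by (cases "k < n") (auto simp: kappa_alt)
  next
    case False
    then have k: "kappa A = Max ratios" using ne by (simp add: kappa_alt)
    have r: "\<bar>fund N j k\<bar> \<in> ratios" if "k < n" "fund N j k \<noteq> 0" for k
      unfolding ratios_def mem_Collect_eq
      using that jn jj fund_elementary[OF N j]
      by (intro exI[of _ "Matrix.vec n (fund N j)"] exI[of _ j] exI[of _ k]) (auto simp: vec_supp_def)
    have "1 \<in> ratios" using r[of j] jn jj by simp
    then have 1: "1 \<le> kappa A" using k finite_ratios by simp
    show ?thesis
    proof (cases "k < n \<and> fund N j k \<noteq> 0")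
      case True
      then show ?thesis using r[of k] k finite_ratios by simp
    next
      case False
      then have "fund N j k = 0" using vanish[OF f, of k] by (cases "k < n") auto
      then show ?thesis using 1 by simp
    qed
  qed
qed

lemma cobasis_exists: "\<exists>N. cobasis N"
  using cobasis_within[of "{..<n}"] vanish by (metis lessThan_iff not_le order_refl ext)

lemma one_le_kappa: "1 \<le> kappa A"
proof (cases "mat_kernel A = {0\<^sub>v n}")
  case True
  then show ?thesis by (simp add: kappa_alt)
next
  case False
  obtain N where N: "cobasis N" using cobasis_exists by blast
  have "N \<noteq> {}"
  proof
    assume e: "N = {}"
    have "v = 0\<^sub>v n" if v: "v \<in> mat_kernel A" for v
    proof -
      have "coords v = (\<lambda>_. 0)" using cobasis_zero[OF N] v e by (auto simp: kernel_coords_def)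
      then have "coords v = coords (0\<^sub>v n)" by (auto simp: coords_def fun_eq_iff)
      then show ?thesis using coords_inj[OF kernel_carrier[OF v] zero_carrier_vec] by blast
    qed
    then show False using False zero_in_kernel by blast
  qed
  then obtain j where "j \<in> N" by blast
  then show ?thesis using fund_le_kappa[OF N, of j j] fund_delta[OF N, of j j] by simp
qed

lemma mult_mat_vec_index:
  "i < m \<Longrightarrow> (\<And>k. n \<le> k \<Longrightarrow> w k = 0) \<Longrightarrow> (A *\<^sub>v Matrix.vec n w) $ i = (\<Sum>k<n. A $$ (i, k) * w k)"
  using A by (auto simp: scalar_prod_def atLeast0LessThan)

text \<open>A nonzero kernel vector supported on the indices of independent columns is impossible, so
  the remaining coordinates detect the kernel and contain a cobasis.\<close>

lemma cobasis_card_rank: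
  assumes N: "cobasis N"
  shows "card N + vec_space.rank m A \<le> n"
proof -
  interpret V: vec_space "TYPE(real)" m .
  obtain S where S: "finite S" "maximal S (\<lambda>T. T \<subseteq> set (cols A) \<and> V.lin_indpt T)"
    using maximal_exists_superset[of "set (cols A)" "\<lambda>T. T \<subseteq> set (cols A) \<and> V.lin_indpt T" "{}"]
    by (metis (no_types, lifting) List.finite_set V.unit_vecs_basis V.basis_def V.subset_li_is_li empty_subsetI)
  have li: "S \<subseteq> set (cols A)" "V.lin_indpt S" using S(2) by (auto simp: maximal_def)
  have rank: "V.rank A = card S" by (rule V.rank_card_indpt[OF A S(2)])
  have "\<exists>k<n. col A k = v" if "v \<in> S" for v
    using that li(1) A by (force simp: cols_def)
  \<comment> \<open>A column may be repeated in the matrix; one position is chosen for each vector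
    of \<open>S\<close>.\<close>
  then obtain idx where idx: "\<And>v. v \<in> S \<Longrightarrow> idx v < n \<and> col A (idx v) = v" by metis
  have inj: "inj_on idx S" by (rule inj_onI) (metis idx)
  define Z where "Z = {..<n} - idx ` S"
  have Sc: "S \<subseteq> carrier_vec m" using li(1) cols_dim[of A] A by auto
  have "w = (\<lambda>_. 0)" if w: "w \<in> kernel_coords A" "\<And>i. i \<in> Z \<Longrightarrow> w i = 0" for w
  proof (rule ccontr)
    assume "w \<noteq> (\<lambda>_. 0)"
    then obtain k where k: "w k \<noteq> 0" by auto
    then have "k \<in> idx ` S" using w(2)[of k] vanish[OF w(1), of k] by (cases "k < n") (auto simp: Z_def)
    then obtain v where v: "v \<in> S" "k = idx v" by blast
    have "V.lincomb (\<lambda>v. w (idx v)) S = 0\<^sub>v m"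
    proof (rule eq_vecI)
      show d: "dim_vec (V.lincomb (\<lambda>v. w (idx v)) S) = dim_vec (0\<^sub>v m :: real Matrix.vec)"
        using V.lincomb_dim[OF S(1) Sc] by simp
      fix i assume "i < dim_vec (0\<^sub>v m :: real Matrix.vec)"
      then have i: "i < m" by simp
      have "V.lincomb (\<lambda>v. w (idx v)) S $ i = (\<Sum>v\<in>S. w (idx v) * v $ i)"
        by (rule V.lincomb_index[OF i Sc])
      also have "\<dots> = (\<Sum>v\<in>S. A $$ (i, idx v) * w (idx v))"
      proof (rule sum.cong)
        fix v assume v: "v \<in> S"
        then have "v $ i = A $$ (i, idx v)" using idx[OF v] i A by (metis carrier_matD index_col)
        then show "w (idx v) * v $ i = A $$ (i, idx v) * w (idx v)" by simp
      qed simp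
      also have "\<dots> = (\<Sum>k\<in>idx ` S. A $$ (i, k) * w k)" using inj by (simp add: sum.reindex)
      also have "\<dots> = (\<Sum>k<n. A $$ (i, k) * w k)"
        using idx w(2) by (intro sum.mono_neutral_left) (auto simp: Z_def)
      also have "\<dots> = (A *\<^sub>v Matrix.vec n w) $ i"
        using mult_mat_vec_index[OF i, of w] vanish[OF w(1)] by simp
      also have "\<dots> = 0" using w(1) kernel_mult i by (simp add: kernel_coords_iff)
      finally show "V.lincomb (\<lambda>v. w (idx v)) S $ i = 0\<^sub>v m $ i" using i by simp
    qed
    then have "V.lin_dep S"
      using V.lin_dep_crit[OF S(1) order_refl _ v(1), of "\<lambda>v. w (idx v)"] k v(2) by auto
    then show False using li(2) by simp
  qed
  then obtain N' where N': "N' \<subseteq> Z" "cobasis N'" using cobasis_within[of Z] by (auto simp: Z_def)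
  have "card N = card N'" by (rule cobasis_card_eq[OF N N'(2)])
  also have "\<dots> \<le> card Z" using N'(1) by (intro card_mono) (auto simp: Z_def)
  also have "card Z = n - card S"
    unfolding Z_def using idx inj by (subst card_Diff_subset) (auto simp: S(1) card_image)
  finally have "card N \<le> n - card S" .
  \<comment> \<open>Rules out truncation in the natural number \<open>n - card S\<close>.\<close>
  moreover have "card S \<le> n" using card_inj_on_le[OF inj, of "{..<n}"] idx by auto
  ultimately show ?thesis using rank by simp
qed

end

section \<open>The vertex-edge graph\<close>

unbundle no inner_syntax

context kernel_matrix begin

lemma pair_scalar_prod:
  "c \<in> carrier_vec n \<Longrightarrow> x \<in> carrier_vec n \<Longrightarrow> c \<bullet> x = pair (coords c) (coords x)"
  unfolding scalar_prod_def pair_def by (rule sum.cong) (auto simp: coords_def)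

lemma polyhedron_iff:
  "x \<in> std_polyhedron A b \<longleftrightarrow> x \<in> carrier_vec n \<and> A *\<^sub>v x = b \<and> (\<forall>i. 0 \<le> coords x i)"
proof -
  have "0\<^sub>v n \<le> x \<longleftrightarrow> (\<forall>i. 0 \<le> coords x i)" if x: "x \<in> carrier_vec n"
  proof -
    have "0\<^sub>v n \<le> x \<longleftrightarrow> (\<forall>i<n. 0 \<le> x $ i)"
      unfolding Matrix.less_eq_vec_def using x by simp
    also have "\<dots> \<longleftrightarrow> (\<forall>i. 0 \<le> coords x i)"
      using coords_index[OF x] coords_outside[OF x] by (metis not_le order_refl)
    finally show ?thesis .
  qed
  moreover have "dim_col A = n" using A by simp
  ultimately show ?thesis unfolding std_polyhedron_def by blast
qed

lemma kernel_diff_iff: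
  assumes "x \<in> carrier_vec n" "u \<in> carrier_vec n"
  shows "(\<lambda>i. coords x i - coords u i) \<in> kernel_coords A \<longleftrightarrow> A *\<^sub>v x = A *\<^sub>v u"
proof -
  have "(\<lambda>i. coords x i - coords u i) = coords (x + (-1) \<cdot>\<^sub>v u)"
    using coords_add_scale[OF assms(2,1), of "-1"] by simp
  moreover have "coords y \<in> kernel_coords A \<longleftrightarrow> A *\<^sub>v y = 0\<^sub>v m" if "y \<in> carrier_vec n" for y
    unfolding kernel_coords_iff vec_coords[OF that] mat_kernel[OF A] using that coords_outside[OF that] by auto
  moreover have "A *\<^sub>v (x + (-1) \<cdot>\<^sub>v u) = A *\<^sub>v x + (-1) \<cdot>\<^sub>v (A *\<^sub>v u)"
    using assms A by (simp add: mult_add_distrib_mat_vec mult_mat_vec)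
  moreover have "A *\<^sub>v x + (-1) \<cdot>\<^sub>v (A *\<^sub>v u) = 0\<^sub>v m \<longleftrightarrow> A *\<^sub>v x = A *\<^sub>v u"
  proof
    assume e: "A *\<^sub>v x + (-1) \<cdot>\<^sub>v (A *\<^sub>v u) = 0\<^sub>v m"
    show "A *\<^sub>v x = A *\<^sub>v u"
    proof (rule eq_vecI)
      fix i assume "i < dim_vec (A *\<^sub>v u)"
      then have i: "i < m" using A by simp
      have "(A *\<^sub>v x + (-1) \<cdot>\<^sub>v (A *\<^sub>v u)) $ i = (A *\<^sub>v x) $ i - (A *\<^sub>v u) $ i"
        using i A by (simp del: index_mult_mat_vec)
      then show "(A *\<^sub>v x) $ i = (A *\<^sub>v u) $ i" using e i by simp
    qed simp
  next
    assume "A *\<^sub>v x = A *\<^sub>v u"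
    then show "A *\<^sub>v x + (-1) \<cdot>\<^sub>v (A *\<^sub>v u) = 0\<^sub>v m" using A by (intro eq_vecI) auto
  qed
  ultimately show ?thesis using assms by simp
qed

lemma polyhedron_slice:
  assumes "u \<in> std_polyhedron A b" "x \<in> carrier_vec n"
  shows "x \<in> std_polyhedron A b \<longleftrightarrow> coords x \<in> slice (coords u)"
  using assms kernel_diff_iff[OF assms(2), of u] by (auto simp: polyhedron_iff slice_def)

lemma slice_polyhedron:
  assumes u: "u \<in> std_polyhedron A b" and y: "y \<in> slice (coords u)"
  shows "coords (Matrix.vec n y) = y" "Matrix.vec n y \<in> std_polyhedron A b"
proof -
  have "y i = 0" if "n \<le> i" for i
    using y u vanish[of "\<lambda>i. y i - coords u i" i] that coords_outside[of u n i]
    by (auto simp: slice_def polyhedron_iff)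
  then show *: "coords (Matrix.vec n y) = y" by (rule coords_vec)
  show "Matrix.vec n y \<in> std_polyhedron A b"
    using polyhedron_slice[OF u, of "Matrix.vec n y"] y * by simp
qed

text \<open>Faces maximise, so the functional is the negated sum of the chosen coordinates: its
  maximum 0 is attained exactly where all of them vanish.\<close>

lemma coordinate_face:
  assumes M: "M \<subseteq> {..<n}" and F: "F = {x \<in> std_polyhedron A b. \<forall>l\<in>M. coords x l = 0}" and ne: "F \<noteq> {}"
  shows "is_face n (std_polyhedron A b) F"
proof -
  define c where "c = Matrix.vec n (\<lambda>i. if i \<in> M then - 1 else 0 :: real)"
  have c: "c \<in> carrier_vec n" by (simp add: c_def)
  have val: "c \<bullet> x = - (\<Sum>l\<in>M. coords x l)" if x: "x \<in> std_polyhedron A b" for x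
  proof -
    have xc: "x \<in> carrier_vec n" using x by (simp add: polyhedron_iff)
    have "c \<bullet> x = (\<Sum>i<n. if i \<in> M then - coords x i else 0)"
      unfolding pair_scalar_prod[OF c xc] pair_def
      by (intro sum.cong) (auto simp: c_def coords_def)
    also have "\<dots> = (\<Sum>i\<in>{..<n} \<inter> M. - coords x i)" by (simp add: sum.inter_restrict)
    also have "{..<n} \<inter> M = M" using M by auto
    finally show ?thesis by (simp add: sum_negf)
  qed
  have finM: "finite M" using M finite_subset by blast
  have "\<forall>x\<in>std_polyhedron A b. c \<bullet> x \<le> 0"
    using val by (auto simp: polyhedron_iff intro!: sum_nonneg)
  moreover have "F = {x \<in> std_polyhedron A b. c \<bullet> x = 0}"
    unfolding F using val finM by (auto simp: polyhedron_iff sum_nonneg_eq_0_iff)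
  ultimately show ?thesis unfolding is_face_def using ne c by blast
qed

lemma feasible_vertex:
  assumes u: "u \<in> std_polyhedron A b" and N: "feasible (coords u) N"
  shows "Matrix.vec n (bsol N (coords u)) \<in> vertices_of n (std_polyhedron A b)"
proof -
  let ?v = "Matrix.vec n (bsol N (coords u))"
  have cb: "cobasis N" using N by (simp add: feasible_def)
  note v = slice_polyhedron[OF u bsol_slice[OF N]]
  have "{?v} = {x \<in> std_polyhedron A b. \<forall>l\<in>N. coords x l = 0}"
  proof (intro equalityI subsetI)
    fix x assume "x \<in> {?v}"
    then show "x \<in> {x \<in> std_polyhedron A b. \<forall>l\<in>N. coords x l = 0}" using v bsol_zero[OF cb] by simp
  next
    fix x assume x: "x \<in> {x \<in> std_polyhedron A b. \<forall>l\<in>N. coords x l = 0}"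
    then have xc: "x \<in> carrier_vec n" by (simp add: polyhedron_iff)
    have "coords x \<in> slice (coords u)" using polyhedron_slice[OF u xc] x by simp
    then have "bsol N (coords u) = coords x" using x by (intro bsol_eqI[OF cb]) (auto simp: slice_def)
    then show "x \<in> {?v}" using vec_coords[OF xc] by simp
  qed
  then have "is_face n (std_polyhedron A b) {?v}"
    using cobasis_subset[OF cb] by (intro coordinate_face) auto
  then show ?thesis by (simp add: vertices_of_def)
qed

lemma vertex_in_polyhedron: "v \<in> vertices_of n (std_polyhedron A b) \<Longrightarrow> v \<in> std_polyhedron A b"
  by (auto simp: vertices_of_def is_face_def)

text \<open>A vertex is the unique maximiser of some functional. With the sign reversed,
  \<open>minimiser_cobasis\<close> supplies a cobasis that survives the perturbation and whose
  unperturbed basic solution is this vertex.\<close>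

lemma vertex_cobasis:
  assumes u: "u \<in> std_polyhedron A b" and v: "v \<in> vertices_of n (std_polyhedron A b)"
    and nd: "nondegenerate q" and q: "\<And>i. 0 \<le> q i" and qu: "\<And>N. feasible q N \<Longrightarrow> feasible (coords u) N"
  shows "\<exists>N. feasible q N \<and> bsol N (coords u) = coords v"
proof -
  obtain c \<delta> where c: "c \<in> carrier_vec n" "\<And>x. x \<in> std_polyhedron A b \<Longrightarrow> c \<bullet> x \<le> \<delta>"
    "{v} = {x \<in> std_polyhedron A b. c \<bullet> x = \<delta>}"
    using v by (auto simp: vertices_of_def is_face_def)
  have vP: "v \<in> std_polyhedron A b" "c \<bullet> v = \<delta>" using c(3) by auto
  have vc: "v \<in> carrier_vec n" using vP by (simp add: polyhedron_iff)
  let ?c = "\<lambda>i. - coords c i"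
  have neg: "pair ?c x = - pair (coords c) x" for x by (simp add: pair_def sum_negf)
  have val: "pair (coords c) y = c \<bullet> Matrix.vec n y" if "y \<in> slice (coords u)" for y
    using pair_scalar_prod[OF c(1), of "Matrix.vec n y"] slice_polyhedron[OF u that] by simp
  show ?thesis
  proof (rule minimiser_cobasis[OF nd q qu, of "- \<delta>" ?c])
    show "- \<delta> \<le> pair ?c x" if "x \<in> slice (coords u)" for x
      using c(2)[OF slice_polyhedron(2)[OF u that]] val[OF that] by (simp add: neg)
    show "coords v \<in> slice (coords u)" using polyhedron_slice[OF u vc] vP by simp
    show "pair ?c (coords v) = - \<delta>" using pair_scalar_prod[OF c(1) vc] vP by (simp add: neg)
    show "x = coords v" if x: "x \<in> slice (coords u)" "pair ?c x = - \<delta>" for x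
    proof -
      have "Matrix.vec n x \<in> {v}" unfolding c(3)
        using slice_polyhedron(2)[OF u x(1)] val[OF x(1)] x(2) by (simp add: neg)
      then have "Matrix.vec n x = v" by simp
      then show ?thesis using slice_polyhedron(1)[OF u x(1)] by simp
    qed
  qed
qed

lemma affine_dim_line:
  fixes F :: "real Matrix.vec set"
  assumes F: "F \<subseteq> carrier_vec n" and f: "f \<in> carrier_vec n"
    and line: "\<And>x y. x \<in> F \<Longrightarrow> y \<in> F \<Longrightarrow> \<exists>t. x - y = t \<cdot>\<^sub>v f"
    and ne: "v \<in> F" "v' \<in> F" "v \<noteq> v'"
  shows "vec_space.affine_dim n F = 1"
proof -
  interpret V: vec_space "TYPE(real)" n .
  define D where "D = {x - y | x y. x \<in> F \<and> y \<in> F}"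
  define w where "w = v' - v"
  have vc: "v \<in> carrier_vec n" "v' \<in> carrier_vec n" using F ne by auto
  have wc: "w \<in> carrier_vec n" using vc by (simp add: w_def)
  have Dc: "D \<subseteq> carrier_vec n"   proof
    fix z assume "z \<in> D"
    then obtain x y where z: "z = x - y" "x \<in> F" "y \<in> F" by (auto simp: D_def)
    then have "x \<in> carrier_vec n" "y \<in> carrier_vec n" using F by blast+
    then show "z \<in> carrier_vec n" unfolding z(1) by simp
  qed
  have w0: "w \<noteq> 0\<^sub>v n"
  proof
    assume e: "w = 0\<^sub>v n"
    have "v = v'"
    proof (rule eq_vecI)
      fix i assume "i < dim_vec v'"
      then have "i < n" using vc by simp
      moreover from this have "w $ i = v' $ i - v $ i" using vc by (simp add: w_def)
      ultimately show "v $ i = v' $ i" using e by simp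
    qed (use vc in simp)
    with ne show False by simp
  qed
  obtain s where s: "w = s \<cdot>\<^sub>v f" using line[OF ne(2,1)] by (auto simp: w_def)
  have s0: "s \<noteq> 0"
  proof
    assume "s = 0"
    then have "w = 0\<^sub>v n" using s f by (auto intro!: eq_vecI)
    with w0 show False by simp
  qed
  have sp: "t \<cdot>\<^sub>v w \<in> V.span {w}" for t
  proof -
    have "V.lincomb (\<lambda>_. t) {w} = t \<cdot>\<^sub>v w" using wc by (simp add: V.lincomb_def)
    then show ?thesis using V.finite_span[of "{w}"] wc by (auto intro: exI[of _ "\<lambda>_. t"])
  qed
  have "D \<subseteq> V.span {w}"
  proof
    fix z assume "z \<in> D"
    then obtain x y where xy: "z = x - y" "x \<in> F" "y \<in> F" by (auto simp: D_def)
    then obtain t where "z = t \<cdot>\<^sub>v f" using line by blast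
    then have "z = (t / s) \<cdot>\<^sub>v w" using s s0 f by (auto intro!: eq_vecI)
    then show "z \<in> V.span {w}" using sp by simp
  qed
  moreover have "{w} \<subseteq> D" using ne by (auto simp: D_def w_def)
  ultimately have span: "V.span D = V.span {w}"
    using V.span_subsetI[of "{w}" D] V.span_is_monotone[of "{w}" D] wc by auto
  have li: "V.lin_indpt {w}"
  proof
    assume "V.lin_dep {w}"
    then obtain a z where "V.lincomb a {w} = 0\<^sub>v n" "z \<in> {w}" "a z \<noteq> 0"
      using V.finite_lin_dep[of "{w}"] wc by (auto simp: module_vec_simps)
    then have "a w \<cdot>\<^sub>v w = 0\<^sub>v n" "a w \<noteq> 0" using wc by (auto simp: V.lincomb_def)
    have "w = 0\<^sub>v n"
    proof (rule eq_vecI)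
      fix i assume i: "i < dim_vec (0\<^sub>v n :: real Matrix.vec)"
      have "(a w \<cdot>\<^sub>v w) $ i = a w * w $ i" using i wc by simp
      then show "w $ i = 0\<^sub>v n $ i" using i \<open>a w \<cdot>\<^sub>v w = 0\<^sub>v n\<close> \<open>a w \<noteq> 0\<close> by simp
    qed (use wc in simp)
    with w0 show False by simp
  qed
  have "vectorspace.dim class_ring (V.span_vs {w}) = card {w}"
    by (rule V.dim_span) (use wc li in \<open>auto simp: maximal_def\<close>)
  then show ?thesis unfolding V.affine_dim_def D_def[symmetric] span by simp
qed

text \<open>Fixing the coordinates in \<open>N - {j}\<close> at zero leaves only the direction
  \<open>fund N j\<close>, and its negative entry at \<open>k\<close> bounds the face. Before
  perturbation both basic solutions may be the same point, which is the first alternative.\<close>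

lemma pivot_edge:
  assumes u: "u \<in> std_polyhedron A b" and NN': "(N, N') \<in> pivot_rel q"
    and qu: "\<And>N. feasible q N \<Longrightarrow> feasible (coords u) N"
  defines "v \<equiv> Matrix.vec n (bsol N (coords u))" and "v' \<equiv> Matrix.vec n (bsol N' (coords u))"
  shows "v = v' \<or> (v, v') \<in> parcs (vertex_edge_graph n (std_polyhedron A b))"
proof (cases "v = v'")
  case False
  let ?P = "std_polyhedron A b"
  obtain j k where j: "j \<in> N" and k: "k < n" "k \<notin> N" "fund N j k < 0" and N': "N' = insert k (N - {j})"
    and fq: "feasible q N" "feasible q N'"
    using NN' by (auto simp: pivot_rel_def)
  have fe: "feasible (coords u) N" "feasible (coords u) N'" using qu fq by auto
  have cb: "cobasis N" "cobasis N'" using fe by (auto simp: feasible_def)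
  note vP = slice_polyhedron[OF u bsol_slice[OF fe(1)], folded v_def]
  note vP' = slice_polyhedron[OF u bsol_slice[OF fe(2)], folded v'_def]
  define F where "F = {x \<in> ?P. \<forall>l\<in>N - {j}. coords x l = 0}"
  have vF: "v \<in> F" "v' \<in> F"
    using vP vP' bsol_zero[OF cb(1)] bsol_zero[OF cb(2)] N' by (auto simp: F_def)
  have face: "is_face n ?P F"
    using cobasis_subset[OF cb(1)] vF F_def by (intro coordinate_face[of "N - {j}"]) auto
  define f where "f = Matrix.vec n (fund N j)"
  have cf: "coords f = fund N j" unfolding f_def by (intro coords_vec) (rule vanish[OF fund_mem[OF cb(1) j]])
  have Fc: "F \<subseteq> carrier_vec n" by (auto simp: F_def polyhedron_iff)
  have par: "coords x = (\<lambda>i. coords y i + (coords x j - coords y j) * fund N j i)" if xy: "x \<in> F" "y \<in> F" for x y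
  proof -
    have c: "x \<in> carrier_vec n" "y \<in> carrier_vec n" using xy Fc by auto
    have W: "(\<lambda>i. coords x i - coords y i) \<in> kernel_coords A"
      using kernel_diff_iff[OF c] xy by (auto simp: F_def polyhedron_iff)
    have "(\<lambda>i. coords x i - coords y i) = (\<lambda>i. (coords x j - coords y j) * fund N j i)"
    proof (rule cobasis_eqI[OF cb(1) W scale_mem[OF fund_mem[OF cb(1) j]]])
      fix i assume "i \<in> N"
      then show "coords x i - coords y i = (coords x j - coords y j) * fund N j i"
        using xy fund_delta[OF cb(1) j, of i] by (cases "i = j") (auto simp: F_def)
    qed
    from fun_cong[OF this] show ?thesis by (auto simp: fun_eq_iff algebra_simps)
  qed
  have line: "\<exists>t. x - y = t \<cdot>\<^sub>v f" if xy: "x \<in> F" "y \<in> F" for x y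
  proof (intro exI eq_vecI)
    have c: "x \<in> carrier_vec n" "y \<in> carrier_vec n" using xy Fc by auto
    show "dim_vec (x - y) = dim_vec ((coords x j - coords y j) \<cdot>\<^sub>v f)" using c by (simp add: f_def)
    fix i assume "i < dim_vec ((coords x j - coords y j) \<cdot>\<^sub>v f)"
    then have i: "i < n" by (simp add: f_def)
    have "coords x i = coords y i + (coords x j - coords y j) * fund N j i" using par[OF xy] by (rule fun_cong)
    then show "(x - y) $ i = ((coords x j - coords y j) \<cdot>\<^sub>v f) $ i"
      using i c by (simp add: f_def coords_index)
  qed
  have dim: "vec_space.affine_dim n F = 1"
    by (rule affine_dim_line[OF Fc _ line vF False]) (simp add: f_def)
  have bdd: "bounded_vecs n F"
  proof -
    \<comment> \<open>The parameter at which coordinate \<open>k\<close> reaches zero on the way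
      from \<open>v\<close> along \<open>f\<close>; beyond it the point leaves the
      polyhedron.\<close>
    define T where "T = coords v k / - fund N j k"
    have bnd: "\<bar>x $ i\<bar> \<le> (\<Sum>i<n. \<bar>coords v i\<bar>) + T * (\<Sum>i<n. \<bar>fund N j i\<bar>)" if x: "x \<in> F" and i: "i < n" for x i
    proof -
      have vj: "coords v j = 0" using vP bsol_zero[OF cb(1) j] by simp
      have e: "coords x i = coords v i + coords x j * fund N j i" for i
        using par[OF x vF(1)] vj by (metis diff_zero)
      have x0: "0 \<le> coords x i" for i using x by (simp add: F_def polyhedron_iff)
      have "coords x j * (- fund N j k) \<le> coords v k" using e[of k] x0[of k] by simp
      moreover have "0 < - fund N j k" using k by simp
      ultimately have xj: "coords x j \<le> T" unfolding T_def by (simp only: pos_le_divide_eq)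
      have "\<bar>coords x i\<bar> \<le> \<bar>coords v i\<bar> + coords x j * \<bar>fund N j i\<bar>"
        unfolding e[of i] using x0[of j] by (metis abs_mult abs_of_nonneg abs_triangle_ineq)
      also have "\<dots> \<le> (\<Sum>i<n. \<bar>coords v i\<bar>) + T * (\<Sum>i<n. \<bar>fund N j i\<bar>)"
        using i x0[of j] xj by (intro add_mono mult_mono member_le_sum sum_nonneg) auto
      finally show ?thesis using coords_index[OF subsetD[OF Fc x] i] by simp
    qed
    then show ?thesis unfolding bounded_vecs_def by blast
  qed
  have "is_edge n ?P F" using face dim bdd by (simp add: is_edge_def)
  then show ?thesis
    using feasible_vertex[OF u fe(1)] feasible_vertex[OF u fe(2)] vF False
    unfolding vertex_edge_graph_def v_def[symmetric] v'_def[symmetric] by auto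
qed simp

end

text \<open>Stationary pivots are carried by \<open>Id\<close> and contribute no arc, so the walk
  may be shorter than \<open>k\<close>.\<close>

lemma awalk_of_relpow:
  assumes "(u, v) \<in> (parcs G \<union> Id) ^^ k" "u \<in> pverts G" and wf: "wf_digraph (with_proj G)"
  shows "\<exists>p. pre_digraph.awalk (with_proj G) u p v \<and> length p \<le> k"
  using assms(1,2)
proof (induction k arbitrary: u)
  case 0
  interpret wf_digraph "with_proj G" by (rule wf)
  show ?case using 0 by (intro exI[of _ "[]"]) (auto simp: awalk_Nil_iff)
next
  case (Suc k)
  interpret wf_digraph "with_proj G" by (rule wf)
  obtain w where w: "(u, w) \<in> parcs G \<union> Id" "(w, v) \<in> (parcs G \<union> Id) ^^ k"
    using relpow_Suc_D2[OF Suc.prems(1)] by blast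
  show ?case
  proof (cases "(u, w) \<in> parcs G")
    case True
    then have "w \<in> pverts G" using head_in_verts[of "(u, w)"] by simp
    then obtain p where "awalk w p v" "length p \<le> k" using Suc.IH[OF w(2)] by blast
    then show ?thesis using True by (intro exI[of _ "(u, w) # p"]) (auto simp: awalk_Cons_iff)
  next
    case False
    then show ?thesis using Suc.IH[OF w(2)] w(1) Suc.prems(2) by (metis IdE UnE fst_conv le_SucI snd_conv)
  qed
qed

lemma distance_le_of_relpow:
  assumes "(u, v) \<in> (parcs G \<union> Id) ^^ k" "u \<in> pverts G" and wf: "wf_digraph (with_proj G)"
  shows "wf_digraph.\<mu> (with_proj G) (\<lambda>_. 1) u v \<le> ereal (real k)"
proof -
  interpret wf_digraph "with_proj G" by (rule wf)
  obtain p where p: "awalk u p v" "length p \<le> k" using awalk_of_relpow[OF assms] by blast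
  have "\<mu> (\<lambda>_. 1) u v \<le> ereal (awalk_cost (\<lambda>_. 1) p)" by (rule min_cost_le_walk_cost[OF p(1)])
  also have "awalk_cost (\<lambda>_. 1) p = real (length p)" by (simp add: awalk_cost_def sum_list_triv)
  finally show ?thesis using p(2) by (meson ereal_less_eq(3) of_nat_le_iff order_trans)
qed

section \<open>The diameter bound\<close>

context kernel_matrix begin

text \<open>The dimension of the kernel; all cobases have this size, so the choice is
  immaterial.\<close>

definition corank :: nat where "corank = card (SOME N. cobasis N)"

lemma card_cobasis_corank: "cobasis N \<Longrightarrow> card N = corank"
  unfolding corank_def using cobasis_exists by (metis cobasis_card_eq someI_ex)

sublocale bounded_coord_subspace n "kernel_coords A" "kappa A" corank
  by unfold_locales (auto simp: fund_le_kappa card_cobasis_corank one_le_kappa)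

lemma pivot_path_vertices:
  assumes u: "u \<in> std_polyhedron A b" and qu: "\<And>N. feasible q N \<Longrightarrow> feasible (coords u) N"
    and "(N, N') \<in> pivot_rel q ^^ k"
  shows "(Matrix.vec n (bsol N (coords u)), Matrix.vec n (bsol N' (coords u)))
    \<in> (parcs (vertex_edge_graph n (std_polyhedron A b)) \<union> Id) ^^ k"
  using assms(3)
proof (induction k arbitrary: N')
  case (Suc k)
  then obtain M where M: "(N, M) \<in> pivot_rel q ^^ k" "(M, N') \<in> pivot_rel q" by auto
  show ?case using Suc.IH[OF M(1)] pivot_edge[OF u M(2) qu] by auto
qed simp

text \<open>A single perturbation, based at \<open>u\<close>, serves both ends, because every vertex
  of the polyhedron has a cobasis that is feasible for \<open>q\<close>.\<close>

lemma distance_le_pivot_dist: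
  assumes u: "u \<in> vertices_of n (std_polyhedron A b)" and v: "v \<in> vertices_of n (std_polyhedron A b)"
  obtains q N N' where "nondegenerate q" "\<And>i. 0 \<le> q i" "feasible q N" "feasible q N'"
    "wf_digraph.\<mu> (with_proj (vertex_edge_graph n (std_polyhedron A b))) (\<lambda>_. 1) u v
      \<le> ereal (real (pivot_dist q N N'))"
proof -
  have uP: "u \<in> std_polyhedron A b" and uc: "u \<in> carrier_vec n" and vc: "v \<in> carrier_vec n"
    using vertex_in_polyhedron u v by (auto simp: polyhedron_iff)
  have u0: "0 \<le> coords u i" for i using uP by (simp add: polyhedron_iff)
  obtain q where q: "\<And>i. 0 \<le> q i" "nondegenerate q" "\<And>N. feasible q N \<Longrightarrow> feasible (coords u) N"
    using perturbation_exists[of "coords u", OF u0] by blast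
  obtain N where N: "feasible q N" "bsol N (coords u) = coords u" using vertex_cobasis[OF uP u q(2,1,3)] by blast
  obtain N' where N': "feasible q N'" "bsol N' (coords u) = coords v" using vertex_cobasis[OF uP v q(2,1,3)] by blast
  have "(u, v) \<in> (parcs (vertex_edge_graph n (std_polyhedron A b)) \<union> Id) ^^ pivot_dist q N N'"
    using pivot_path_vertices[OF uP q(3) pivot_dist_path[OF q(2) N(1) N'(1)]]
    unfolding N(2) N'(2) vec_coords[OF uc] vec_coords[OF vc] .
  then have "wf_digraph.\<mu> (with_proj (vertex_edge_graph n (std_polyhedron A b))) (\<lambda>_. 1) u v
      \<le> ereal (real (pivot_dist q N N'))"
    using u by (intro distance_le_of_relpow wf_vertex_edge_graph) (auto simp: vertex_edge_graph_def)
  then show ?thesis using that q N(1) N'(1) by blast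
qed

text \<open>160 is the 16 of \<open>pivot_dist_bound\<close>, times 5 from the logarithm, times 2
  from \<open>n \<le> 2 * (n - m) * m\<close>. If \<open>m\<close> or the size of the cobases is
  zero, the right side can vanish, but then there is only one cobasis and the distance is
  zero.\<close>

lemma pivot_dist_le_polynomial:
  assumes rank: "vec_space.rank m A = m"
    and nd: "nondegenerate q" "\<And>i. 0 \<le> q i" and N: "feasible q N" "feasible q N'"
  shows "real (pivot_dist q N N')
    \<le> 160 * ((real n - real m) ^ 3 * real m * kappa A * ln (kappa A + real n))"
proof -
  have cb: "cobasis N" "cobasis N'" using N by (auto simp: feasible_def)
  \<comment> \<open>Full row rank enters here and bounds the size of a cobasis by
    \<open>n - m\<close>.\<close>
  have dm: "corank + m \<le> n" using cobasis_card_rank[OF cb(1)] rank card_cobasis_corank[OF cb(1)] by simp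
  have k1: "1 \<le> kappa A" by (rule one_le_kappa)
  define e where "e = real n - real m"
  have e: "real corank \<le> e" "0 \<le> e" using dm by (auto simp: e_def)
  have ln0: "0 \<le> ln (kappa A + n)" using k1 by (intro ln_ge_zero) auto
  have rhs: "0 \<le> 160 * (e ^ 3 * real m * kappa A * ln (kappa A + n))"
    using e k1 ln0 by auto
  have refl: "pivot_dist q N N = 0" unfolding pivot_dist_def by (rule Least_eq_0) simp
  show ?thesis
  proof (cases "corank = 0 \<or> m = 0")
    case True
    have "N = N'"
    proof (cases "m = 0")
      case True
      have "mat_kernel A = carrier_vec n"
        unfolding mat_kernel[OF A] using A True by (auto intro!: eq_vecI)
      then show ?thesis using full_kernel_cobasis cb by metis
    next
      case False
      then have "N = {}" "N' = {}" using True cb card_cobasis_corank cobasis_finite by auto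
      then show ?thesis by simp
    qed
    then show ?thesis using refl rhs by (simp add: e_def)
  next
    case False
    then have pos: "1 \<le> real corank" "1 \<le> real m" "0 < n" using dm by auto
    have e1: "1 \<le> e" using pos e by linarith
    have "real n = e + m" by (simp add: e_def)
    \<comment> \<open>Expanding the product gives \<open>e + m \<le> e * m + 1\<close>, and
      \<open>1 \<le> e * m\<close> absorbs the 1.\<close>
    moreover have "0 \<le> (e - 1) * (real m - 1)" using e1 pos by simp
    ultimately have nem: "real n \<le> 2 * (e * m)" using mult_mono[OF e1 pos(2)] e by (simp add: algebra_simps)
    \<comment> \<open>8 is at most the cube of \<open>kappa A + n\<close>, and
      \<open>kappa A * n\<close> at most its square.\<close>
    have "8 * kappa A * n \<le> (kappa A + n) ^ 5"
    proof -
      have "2 \<le> kappa A + n" using k1 pos(3) by linarith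
      then have "2 ^ 3 \<le> (kappa A + n) ^ 3" by (intro power_mono) auto
      moreover have "kappa A * n \<le> (kappa A + n) ^ 2" using k1 by (simp add: power2_eq_square algebra_simps)
      ultimately have "8 * (kappa A * n) \<le> (kappa A + n) ^ 3 * (kappa A + n) ^ 2"
        using k1 by (intro mult_mono) auto
      then show ?thesis by (simp add: power_add[symmetric])
    qed
    then have "ln (8 * kappa A * n) \<le> ln ((kappa A + n) ^ 5)"
      using k1 pos by (intro ln_mono) auto
    also have "\<dots> = 5 * ln (kappa A + n)" using k1 by (simp add: ln_realpow)
    finally have ln5: "ln (8 * kappa A * n) \<le> 5 * ln (kappa A + n)" .
    have "real (pivot_dist q N N') \<le> 16 * (real corank * kappa A * n) * ln (8 * kappa A * n)"
      by (rule pivot_dist_bound[OF nd N pos(3)])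
    also have "\<dots> \<le> 16 * (real corank * kappa A * n) * (5 * ln (kappa A + n))"
      using ln5 k1 by (intro mult_left_mono) auto
    also have "\<dots> \<le> 16 * (e * kappa A * (2 * (e * m))) * (5 * ln (kappa A + n))"
      using e nem k1 ln0 by (intro mult_right_mono mult_left_mono mult_mono) auto
    also have "\<dots> = 160 * (e ^ 2 * real m * kappa A * ln (kappa A + n))"
      by (simp add: power2_eq_square)
    \<comment> \<open>The estimate so far has the square of \<open>e\<close>;
      \<open>1 \<le> e\<close> raises it to the cube.\<close>
    also have "\<dots> \<le> 160 * (e ^ 3 * real m * kappa A * ln (kappa A + n))"
      using e1 k1 ln0 by (intro mult_left_mono mult_right_mono power_increasing) auto
    finally show ?thesis by (simp add: e_def)
  qed
qed

lemma diameter_le: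
  assumes "vec_space.rank m A = m"
  shows "poly_diameter n (std_polyhedron A b)
    \<le> ereal (160 * ((real n - real m) ^ 3 * real m * kappa A * ln (kappa A + real n)))"
proof -
  let ?R = "160 * ((real n - real m) ^ 3 * real m * kappa A * ln (kappa A + real n))"
  obtain N where N: "cobasis N" using cobasis_exists by blast
  have mn: "m \<le> n" using cobasis_card_rank[OF N] assms by simp
  \<comment> \<open>Covers the value 0 inserted into the supremum, and with it polyhedra without
    vertices.\<close>
  have "0 \<le> ?R" using mn one_le_kappa by (auto intro!: mult_nonneg_nonneg)
  moreover have "wf_digraph.\<mu> (with_proj (vertex_edge_graph n (std_polyhedron A b))) (\<lambda>_. 1) u v \<le> ereal ?R"
    if uv: "u \<in> vertices_of n (std_polyhedron A b)" "v \<in> vertices_of n (std_polyhedron A b)" for u v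
  proof -
    obtain q N N' where q: "nondegenerate q" "\<And>i. 0 \<le> q i" "feasible q N" "feasible q N'"
      and le: "wf_digraph.\<mu> (with_proj (vertex_edge_graph n (std_polyhedron A b))) (\<lambda>_. 1) u v
        \<le> ereal (real (pivot_dist q N N'))"
      using distance_le_pivot_dist[OF uv] by blast
    then show ?thesis using pivot_dist_le_polynomial[OF assms q] by (meson ereal_less_eq(3) order_trans)
  qed
  ultimately show ?thesis unfolding poly_diameter_def by (intro Sup_least) auto
qed

end

theorem theorem4p8:
  shows "\<exists>C :: real. C > 0 \<and>
    (\<forall>(m :: nat) (n :: nat) (A :: real Matrix.mat) (b :: real Matrix.vec).
       A \<in> carrier_mat m n \<longrightarrow> b \<in> carrier_vec m \<longrightarrow> vec_space.rank m A = m \<longrightarrow>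
       poly_diameter n (std_polyhedron A b)
         \<le> ereal (C * ((real n - real m) ^ 3 * real m * kappa A * ln (kappa A + real n))))"
proof (intro exI[of _ 160] conjI allI impI)
  fix m n :: nat and A :: "real Matrix.mat" and b :: "real Matrix.vec"
  assume A: "A \<in> carrier_mat m n" and "vec_space.rank m A = m"
  interpret kernel_matrix m n A by unfold_locales (rule A)
  show "poly_diameter n (std_polyhedron A b)
      \<le> ereal (160 * ((real n - real m) ^ 3 * real m * kappa A * ln (kappa A + real n)))"
    by (rule diameter_le) fact
qed simp

end
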